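(* Let $d\in\{2,3\}$, $\gamma>1$, $T>0$, and let $(\varrho_\infty,\mathbf m_\infty,S_\infty)\in\mathbb R\times\mathbb R^d\times\mathbb R$ with $\varrho_\infty>0$. Let $(\varrho_n,\mathbf m_n,S_n=\varrho_n s_n)_{n\in\mathbb N}$ be a sequence of admissible solutions of the consistent approximation (first approximation problem) of the complete Euler system in $(0,T)\times\mathbb R^d$ (defined in the context), with initial data $(\varrho_{0,n},\mathbf m_{0,n},S_{0,n}=\varrho_{0,n}s_{0,n})$ satisfying $$\varrho_{0,n}\ge 0,\qquad \int_{\mathbb R^d}\mathrm e(\varrho_{0,n},\mathbf m_{0,n},S_{0,n}\,|\,\varrho_\infty,\mathbf m_\infty,S_\infty)\,dx\le E_0$$ with $E_0$ independent of $n$, and (passing to a subsequence as the case may be) $$\varrho_{0,n}-\varrho_\infty\in (L^2+L^1)(\mathbb R^d),\qquad \varrho_{0,n}\rightharpoonup\varrho_0\ \text{ in }\mathcal M^+_{\rm loc}(\mathbb R^d)\ \text{ as } n\to\infty .$$ Suppose that the barycenter $$(\varrho,\mathbf m,S)(t,x)=\big(\langle\mathcal V_{t,x};\tilde\varrho\rangle,\langle\mathcal V_{t,x};\tilde{\mathbf m}\rangle,\langle\mathcal V_{t,x};\tilde S\rangle\big)$$ of the Young measure $\{\mathcal V_{t,x}\}_{(t,x)\in(0,T)\times\mathbb R^d}$ generated by the sequence $(\varrho_n,\mathbf m_n,S_n)$ is an admissible weak solution of the complete Euler system (defined in the context) satisfying $$\varrho(0,x)=\varrho_0(x),\qquad S(t,x)=0\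 \text{ whenever }\varrho(t,x)=0,\ \text{ for a.e. }(t,x)\in(0,T)\times\mathbb R^d .$$ Then $$\varrho_n\to\varrho\ \text{ in }L^q(0,T;L^1_{\rm loc}(\mathbb R^d)),\qquad \mathbf m_n\to\mathbf m\ \text{ in }L^q(0,T;L^1_{\rm loc}(\mathbb R^d;\mathbb R^d)),$$ $$S_n\to S\ \text{ for a.e. }(t,x)\in(0,T)\times\mathbb R^d,$$ for any $1\le q<\infty$. Moreover, passing to a subsequence as the case may be, $$\varrho_n\to\varrho,\qquad \mathbf m_n\to\mathbf m,\qquad S_n\to S\qquad\text{for a.e. }(t,x)\in(0,T)\times\mathbb R^d .$$
   Context: **Pressure and energy.** Put $c_v=\frac1{\gamma-1}$. For $\varrho>0$, $p(\varrho,S)=\varrho^\gamma\exp\big(\frac{S}{c_v\varrho}\big)$. The energy $\mathrm e:\mathbb R\times\mathbb R^d\times\mathbb R\to[0,\infty]$ is the convex lower semicontinuous function $$\mathrm e(\varrho,\mathbf m,S)=\begin{cases}\frac12\frac{|\mathbf m|^2}{\varrho}+c_v\varrho^\gamma\exp\big(\frac{S}{c_v\varrho}\big)&\text{if }\varrho>0,\\ 0&\text{if }\varrho=0,\ \mathbf m=0,\ S\le0,\\ \infty&\text{otherwise.}\end{cases}$$ The relative energy with respect to $(\varrho_\infty,\mathbf m_\infty,S_\infty)$ is $$\mathrm e(\varrho,\mathbf m,S|\varrho_\infty,\mathbf m_\infty,S_\infty)=\mathrm e(\varrho,\mathbf m,S)-\partial\mathrm e(\varrho_\infty,\mathbf m_\infty,S_\infty)\cdot[(\varrho,\mathbf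 m,S)-(\varrho_\infty,\mathbf m_\infty,S_\infty)]-\mathrm e(\varrho_\infty,\mathbf m_\infty,S_\infty),$$ where $\partial\mathrm e$ is the gradient of $\mathrm e$. **Weak solution.** $(\varrho,\mathbf m,S)$ is an (admissible) weak solution of the complete Euler system with initial data $(\varrho_0,\mathbf m_0,S_0)$ if $\varrho,\mathbf m,S$ are measurable on $(0,T)\times\mathbb R^d$, $\varrho\ge0$, and: - $\int_0^T\!\int_{\mathbb R^d}[\varrho\,\partial_t\phi+\mathbf m\cdot\nabla_x\phi]\,dx\,dt=-\int_{\mathbb R^d}\varrho_0\,\phi(0,\cdot)\,dx$ for all $\phi\in C^1_c([0,T)\times\mathbb R^d)$; - $\int_0^T\!\int_{\mathbb R^d}\big[\mathbf m\cdot\partial_t\boldsymbol\varphi+\mathbf 1_{\{\varrho>0\}}\frac{\mathbf m\otimes\mathbf m}{\varrho}:\nabla_x\boldsymbol\varphi+\mathbf 1_{\{\varrho>0\}}p(\varrho,S)\,\mathrm{div}_x\boldsymbol\varphi\big]dx\,dt=-\int_{\mathbb R^d}\mathbf m_0\cdot\boldsymbol\varphi(0,\cdot)\,dx$ for all $\boldsymbol\varphi\in C^1_c([0,T)\times\mathbb R^d;\mathbb R^d)$; - for a.e. $t\in(0,T)$, $\big[\int_{\mathbb R^d}\mathrm e(\varrho,\mathbf m,S|\varrho_\infty,\mathbf m_\infty,S_\infty)(\tau,\cdot)\,dx\big]_{\tau=0}^{\tau=t}\le0$; - $\int_0^T\!\int_{\mathbb R^d}\big[S\,\partial_t\phi+\mathbf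 1_{\{\varrho>0\}}\frac{S}{\varrho}\mathbf m\cdot\nabla_x\phi\big]dx\,dt\le0$ for all $\phi\in C^1_c((0,T)\times\mathbb R^d)$, $\phi\ge0$. The condition $\varrho(0,x)=\varrho_0(x)$ means that the initial density in the weak formulation of the continuity equation is the limit $\varrho_0$ of the initial densities $\varrho_{0,n}$. **First approximation problem (admissible consistent approximation).** $(\varrho_n,\mathbf m_n,S_n=\varrho_ns_n)$ with initial data $(\varrho_{0,n},\mathbf m_{0,n},S_{0,n}=\varrho_{0,n}s_{0,n})$ satisfies $\varrho_n\ge0$ and: - for all $\phi\in C^1_c([0,T)\times\mathbb R^d)$: $-\int_{\mathbb R^d}\varrho_{0,n}\phi(0,\cdot)dx=\int_0^T\!\int_{\mathbb R^d}[\varrho_n\partial_t\phi+\mathbf m_n\cdot\nabla_x\phi]dx\,dt+\int_0^T\mathfrak E_{1,n}[\phi]\,dt$; - for all $\boldsymbol\varphi\in C^1_c([0,T)\times\mathbb R^d;\mathbb R^d)$: $-\int_{\mathbb R^d}\mathbf m_{0,n}\cdot\boldsymbol\varphi(0,\cdot)dx=\int_0^T\!\int_{\mathbb R^d}\big[\mathbf m_n\cdot\partial_t\boldsymbol\varphi+\mathbf 1_{\{\varrho_n>0\}}\frac{\mathbf m_n\otimes\mathbf m_n}{\varrho_n}:\nabla_x\boldsymbol\varphi+\mathbf 1_{\{\varrho_n>0\}}p(\varrho_n,S_n)\mathrm{div}_x\boldsymbol\varphi\big]dx\,dt+\int_0^T\mathfrak E_{2,n}[\boldsymbol\varphi]\,dt$;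 - for a.e. $0\le\tau\le T$: $\int_{\mathbb R^d}\mathrm e(\varrho_n,\mathbf m_n,S_n|\varrho_\infty,\mathbf m_\infty,S_\infty)(\tau)dx\le\int_{\mathbb R^d}\mathrm e(\varrho_{0,n},\mathbf m_{0,n},S_{0,n}|\varrho_\infty,\mathbf m_\infty,S_\infty)dx+\mathfrak E_{3,n}$; - for all $\psi\in C^1_c([0,T)\times\mathbb R^d)$, $\psi\ge0$: $\int_0^T\!\int_{\mathbb R^d}\big[S_n\partial_t\psi+\mathbf 1_{\{\varrho_n>0\}}\frac{S_n}{\varrho_n}\mathbf m_n\cdot\nabla_x\psi\big]dx\,dt\le-\int_{\mathbb R^d}\varrho_{0,n}s_{0,n}\psi(0,\cdot)dx+\int_0^T\mathfrak E_{4,n}[\psi]\,dt$; - the consistency errors satisfy $\mathfrak E_{3,n}\ge0$, $\mathfrak E_{4,n}[\psi]\ge0$, and for fixed $\phi,\boldsymbol\varphi,\psi$ (with $\psi\ge0$), $\mathfrak E_{1,n}[\phi]\to0$, $\mathfrak E_{2,n}[\boldsymbol\varphi]\to0$, $\mathfrak E_{3,n}\to0$, $\mathfrak E_{4,n}[\psi]\to0$ as $n\to\infty$. **Other notation.** $\mathcal M^+_{\rm loc}(\mathbb R^d)$ denotes the nonnegative Radon measures on $\mathbb R^d$, with convergence tested against $C_c(\mathbb R^d)$. A sequence $Z_n$ of $\mathbb R^{d+2}$-valued measurable functions generates the Young measure $\mathcal V$ (a weak( * )-measurable family of probability measures on $\mathbb R^{d+2}$) if $b(Z_n)\to\langle\mathcal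 V_{t,x};b\rangle$ weak( * )ly in $L^\infty((0,T)\times\mathbb R^d)$ for every $b\in C_c(\mathbb R^{d+2})$; the dummy variables are $(\tilde\varrho,\tilde{\mathbf m},\tilde S)$. Under the uniform energy bound such a Young measure exists after passing to a subsequence if necessary, and the sequence is assumed to be such. Convergence in $L^q(0,T;L^1_{\rm loc})$ means convergence in $L^q(0,T;L^1(K))$ for every compact $K\subset\mathbb R^d$.
   Formalization: The first claim S_n→S a.e. fails for the whole sequence (ϱ_n=1, m_n=0, S_n=1_{B_n}, B_n sweeping the unit cube with |B_n|→0); it is proved instead that every subsequence of S_n has a further subsequence converging to S a.e. *)

theory Defs
  imports "HOL-Analysis.Analysis" "HOL-Probability.Probability_Measure"
begin

section \<open>Pressure, energy and relative energy\<close>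

definition c_v :: "real \<Rightarrow> real"
  where "c_v \<gamma> = 1 / (\<gamma> - 1)"

definition pressure :: "real \<Rightarrow> real \<Rightarrow> real \<Rightarrow> real"
  where "pressure \<gamma> \<rho> S = \<rho> powr \<gamma> * exp (S / (c_v \<gamma> * \<rho>))"

definition energy :: "real \<Rightarrow> real \<times> (real^'d) \<times> real \<Rightarrow> ennreal"
  where "energy \<gamma> w = (case w of (\<rho>, m, S) \<Rightarrow>
     if \<rho> > 0 then ennreal (1/2 * (norm m)\<^sup>2 / \<rho> + c_v \<gamma> * \<rho> powr \<gamma> * exp (S / (c_v \<gamma> * \<rho>)))
     else if \<rho> = 0 \<and> m = 0 \<and> S \<le> 0 then 0
     else \<infinity>)"

text \<open>The base point \<open>w\<^sub>i\<close> always has positive density, so the energy is finite and smooth near it and the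
  Frechet derivative applied to \<open>w - w\<^sub>i\<close> is the product of the gradient with \<open>w - w\<^sub>i\<close>.\<close>

definition relative_energy ::
    "real \<Rightarrow> real \<times> (real^'d) \<times> real \<Rightarrow> real \<times> (real^'d) \<times> real \<Rightarrow> ereal"
  where "relative_energy \<gamma> w\<^sub>i w =
     enn2ereal (energy \<gamma> w)
     - ereal (frechet_derivative (\<lambda>v. enn2real (energy \<gamma> v)) (at w\<^sub>i) (w - w\<^sub>i))
     - enn2ereal (energy \<gamma> w\<^sub>i)"

text \<open>The relative energy is nonnegative because the energy is convex, so the conversion to
  \<^typ>\<open>ennreal\<close> loses nothing; the integral may be infinite.\<close>

definition total_relative_energy ::
    "real \<Rightarrow> real \<times> (real^'d) \<times> real \<Rightarrow>
     (real^'d \<Rightarrow> real) \<Rightarrow> (real^'d \<Rightarrow> real^'d) \<Rightarrow> (real^'d \<Rightarrow> real) \<Rightarrow> ennreal"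
  where "total_relative_energy \<gamma> w\<^sub>i \<rho> m S =
     (\<integral>\<^sup>+x. e2ennreal (relative_energy \<gamma> w\<^sub>i (\<rho> x, m x, S x)) \<partial>lebesgue)"

section \<open>Test functions\<close>

text \<open>Functions on \<open>D\<close> that are continuously differentiable up to the part of the boundary belonging
  to \<open>D\<close>, with compact support in \<open>D\<close>; for \<open>D = [0,T) \<times> \<real>\<^sup>d\<close> they need not vanish at \<open>t = 0\<close>.
  Values outside \<open>D\<close> are irrelevant.\<close>

definition C1c :: "'a::real_normed_vector set \<Rightarrow> ('a \<Rightarrow> 'b::real_normed_vector) set"
  where "C1c D = {\<phi>.
     (\<exists>\<phi>'. (\<forall>z\<in>D. (\<phi> has_derivative blinfun_apply (\<phi>' z)) (at z within D)) \<and> continuous_on D \<phi>') \<and>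
     (\<exists>K. compact K \<and> K \<subseteq> D \<and> (\<forall>z\<in>D - K. \<phi> z = 0))}"

definition Cc :: "('a::topological_space \<Rightarrow> real) set"
  where "Cc = {b. continuous_on UNIV b \<and> compact (closure {x. b x \<noteq> 0})}"

abbreviation cylinder :: "real \<Rightarrow> (real \<times> (real^'d)) set"
  where "cylinder T \<equiv> {0<..<T} \<times> UNIV"

abbreviation cylinder0 :: "real \<Rightarrow> (real \<times> (real^'d)) set"
  where "cylinder0 T \<equiv> {0..<T} \<times> UNIV"

definition d_t :: "(real \<times> (real^'d) \<Rightarrow> 'b::real_normed_vector) \<Rightarrow> real \<times> (real^'d) \<Rightarrow> 'b"
  where "d_t \<phi> z = frechet_derivative \<phi> (at z) (1, 0)"

definition grad_x :: "(real \<times> (real^'d) \<Rightarrow> real) \<Rightarrow> real \<times> (real^'d) \<Rightarrow> real^'d"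
  where "grad_x \<phi> z = (\<chi> j. frechet_derivative \<phi> (at z) (0, axis j 1))"

definition jacobian_x :: "(real \<times> (real^'d) \<Rightarrow> real^'d) \<Rightarrow> real \<times> (real^'d) \<Rightarrow> real^'d^'d"
  where "jacobian_x \<phi> z = (\<chi> i j. frechet_derivative \<phi> (at z) (0, axis j 1) $ i)"

definition div_x :: "(real \<times> (real^'d) \<Rightarrow> real^'d) \<Rightarrow> real \<times> (real^'d) \<Rightarrow> real"
  where "div_x \<phi> z = (\<Sum>i\<in>UNIV. frechet_derivative \<phi> (at z) (0, axis i 1) $ i)"

definition outer :: "real^'d \<Rightarrow> real^'d \<Rightarrow> real^'d^'d"
  where "outer a b = (\<chi> i j. a $ i * b $ j)"

section \<open>The Euler system\<close>

text \<open>The integrands of the weak formulations. The inner product of two matrices is the contraction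
  \<open>A : B\<close>.\<close>

definition continuity_integrand ::
    "(real \<times> (real^'d) \<Rightarrow> real) \<Rightarrow> (real \<times> (real^'d) \<Rightarrow> real^'d) \<Rightarrow>
     (real \<times> (real^'d) \<Rightarrow> real) \<Rightarrow> real \<times> (real^'d) \<Rightarrow> real"
  where "continuity_integrand \<rho> m \<phi> z = \<rho> z * d_t \<phi> z + m z \<bullet> grad_x \<phi> z"

definition momentum_integrand ::
    "real \<Rightarrow> (real \<times> (real^'d) \<Rightarrow> real) \<Rightarrow> (real \<times> (real^'d) \<Rightarrow> real^'d) \<Rightarrow> (real \<times> (real^'d) \<Rightarrow> real) \<Rightarrow>
     (real \<times> (real^'d) \<Rightarrow> real^'d) \<Rightarrow> real \<times> (real^'d) \<Rightarrow> real"
  where "momentum_integrand \<gamma> \<rho> m S \<phi> z =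
     m z \<bullet> d_t \<phi> z
     + (if \<rho> z > 0 then ((1 / \<rho> z) *\<^sub>R outer (m z) (m z)) \<bullet> jacobian_x \<phi> z else 0)
     + (if \<rho> z > 0 then pressure \<gamma> (\<rho> z) (S z) * div_x \<phi> z else 0)"

definition entropy_integrand ::
    "(real \<times> (real^'d) \<Rightarrow> real) \<Rightarrow> (real \<times> (real^'d) \<Rightarrow> real^'d) \<Rightarrow> (real \<times> (real^'d) \<Rightarrow> real) \<Rightarrow>
     (real \<times> (real^'d) \<Rightarrow> real) \<Rightarrow> real \<times> (real^'d) \<Rightarrow> real"
  where "entropy_integrand \<rho> m S \<phi> z =
     S z * d_t \<phi> z + (if \<rho> z > 0 then (S z / \<rho> z) *\<^sub>R m z \<bullet> grad_x \<phi> z else 0)"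

text \<open>Since the Bochner integral of a non-integrable function is 0 by convention, integrability of the
  integrands is stated alongside each integral relation. The energy inequality at time \<open>\<tau> = 0\<close> refers
  to the initial data.\<close>

definition admissible_weak_solution ::
    "real \<Rightarrow> real \<Rightarrow> real \<times> (real^'d) \<times> real \<Rightarrow>
     (real \<times> (real^'d) \<Rightarrow> real) \<Rightarrow> (real \<times> (real^'d) \<Rightarrow> real^'d) \<Rightarrow> (real \<times> (real^'d) \<Rightarrow> real) \<Rightarrow>
     (real^'d \<Rightarrow> real) \<Rightarrow> (real^'d \<Rightarrow> real^'d) \<Rightarrow> (real^'d \<Rightarrow> real) \<Rightarrow> bool"
  where "admissible_weak_solution \<gamma> T w\<^sub>i \<rho> m S \<rho>\<^sub>0 m\<^sub>0 S\<^sub>0 \<longleftrightarrow>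
     \<rho> \<in> borel_measurable (lebesgue_on (cylinder T)) \<and>
     m \<in> borel_measurable (lebesgue_on (cylinder T)) \<and>
     S \<in> borel_measurable (lebesgue_on (cylinder T)) \<and>
     \<rho>\<^sub>0 \<in> borel_measurable lebesgue \<and> m\<^sub>0 \<in> borel_measurable lebesgue \<and> S\<^sub>0 \<in> borel_measurable lebesgue \<and>
     (AE z in lebesgue_on (cylinder T). 0 \<le> \<rho> z) \<and>
     (\<forall>\<phi> \<in> C1c (cylinder0 T).
        integrable (lebesgue_on (cylinder T)) (continuity_integrand \<rho> m \<phi>) \<and>
        integrable lebesgue (\<lambda>x. \<rho>\<^sub>0 x * \<phi> (0, x)) \<and>
        (LINT z|lebesgue_on (cylinder T). continuity_integrand \<rho> m \<phi> z)
          = - (LINT x|lebesgue. \<rho>\<^sub>0 x * \<phi> (0, x))) \<and>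
     (\<forall>\<phi> \<in> C1c (cylinder0 T).
        integrable (lebesgue_on (cylinder T)) (momentum_integrand \<gamma> \<rho> m S \<phi>) \<and>
        integrable lebesgue (\<lambda>x. m\<^sub>0 x \<bullet> \<phi> (0, x)) \<and>
        (LINT z|lebesgue_on (cylinder T). momentum_integrand \<gamma> \<rho> m S \<phi> z)
          = - (LINT x|lebesgue. m\<^sub>0 x \<bullet> \<phi> (0, x))) \<and>
     (AE t in lebesgue_on {0<..<T}.
        total_relative_energy \<gamma> w\<^sub>i (\<lambda>x. \<rho> (t, x)) (\<lambda>x. m (t, x)) (\<lambda>x. S (t, x))
          \<le> total_relative_energy \<gamma> w\<^sub>i \<rho>\<^sub>0 m\<^sub>0 S\<^sub>0) \<and>
     (\<forall>\<phi> \<in> C1c (cylinder T). (\<forall>z\<in>cylinder T. 0 \<le> \<phi> z) \<longrightarrow>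
        integrable (lebesgue_on (cylinder T)) (entropy_integrand \<rho> m S \<phi>) \<and>
        (LINT z|lebesgue_on (cylinder T). entropy_integrand \<rho> m S \<phi> z) \<le> 0)"

text \<open>The errors \<open>E1\<close>, \<open>E2\<close>, \<open>E4\<close> are, for each \<open>n\<close> and each test function, integrable functions of
  time; \<open>E1 n \<phi> \<rightarrow> 0\<close> for fixed \<open>\<phi>\<close> is convergence in \<open>L\<^sup>1(0,T)\<close>. Only the time integrals of the errors
  enter the relations, so taking the errors constant in time yields the same class of approximations.\<close>

definition vanishing_error :: "real \<Rightarrow> (nat \<Rightarrow> real \<Rightarrow> real) \<Rightarrow> bool"
  where "vanishing_error T E \<longleftrightarrow>
     (\<forall>n. integrable (lebesgue_on {0<..<T}) (E n)) \<and>
     (\<lambda>n. LINT t|lebesgue_on {0<..<T}. \<bar>E n t\<bar>) \<longlonglongrightarrow> 0"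

definition consistent_approximation ::
    "real \<Rightarrow> real \<Rightarrow> real \<times> (real^'d) \<times> real \<Rightarrow>
     (nat \<Rightarrow> real \<times> (real^'d) \<Rightarrow> real) \<Rightarrow> (nat \<Rightarrow> real \<times> (real^'d) \<Rightarrow> real^'d) \<Rightarrow>
     (nat \<Rightarrow> real \<times> (real^'d) \<Rightarrow> real) \<Rightarrow>
     (nat \<Rightarrow> real^'d \<Rightarrow> real) \<Rightarrow> (nat \<Rightarrow> real^'d \<Rightarrow> real^'d) \<Rightarrow> (nat \<Rightarrow> real^'d \<Rightarrow> real) \<Rightarrow> bool"
  where "consistent_approximation \<gamma> T w\<^sub>i \<rho> m S \<rho>\<^sub>0 m\<^sub>0 S\<^sub>0 \<longleftrightarrow>
     (\<forall>n. \<rho> n \<in> borel_measurable (lebesgue_on (cylinder T)) \<and>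
          m n \<in> borel_measurable (lebesgue_on (cylinder T)) \<and>
          S n \<in> borel_measurable (lebesgue_on (cylinder T)) \<and>
          \<rho>\<^sub>0 n \<in> borel_measurable lebesgue \<and> m\<^sub>0 n \<in> borel_measurable lebesgue \<and>
          S\<^sub>0 n \<in> borel_measurable lebesgue \<and>
          (AE z in lebesgue_on (cylinder T). 0 \<le> \<rho> n z)) \<and>
     (\<exists>E1 E2 E3 E4.
        (\<forall>\<phi> \<in> C1c (cylinder0 T). vanishing_error T (\<lambda>n. E1 n \<phi>) \<and> (\<forall>n.
           integrable (lebesgue_on (cylinder T)) (continuity_integrand (\<rho> n) (m n) \<phi>) \<and>
           integrable lebesgue (\<lambda>x. \<rho>\<^sub>0 n x * \<phi> (0, x)) \<and>
           - (LINT x|lebesgue. \<rho>\<^sub>0 n x * \<phi> (0, x))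
             = (LINT z|lebesgue_on (cylinder T). continuity_integrand (\<rho> n) (m n) \<phi> z)
               + (LINT t|lebesgue_on {0<..<T}. E1 n \<phi> t))) \<and>
        (\<forall>\<phi> \<in> C1c (cylinder0 T). vanishing_error T (\<lambda>n. E2 n \<phi>) \<and> (\<forall>n.
           integrable (lebesgue_on (cylinder T)) (momentum_integrand \<gamma> (\<rho> n) (m n) (S n) \<phi>) \<and>
           integrable lebesgue (\<lambda>x. m\<^sub>0 n x \<bullet> \<phi> (0, x)) \<and>
           - (LINT x|lebesgue. m\<^sub>0 n x \<bullet> \<phi> (0, x))
             = (LINT z|lebesgue_on (cylinder T). momentum_integrand \<gamma> (\<rho> n) (m n) (S n) \<phi> z)
               + (LINT t|lebesgue_on {0<..<T}. E2 n \<phi> t))) \<and>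
        (\<forall>n. 0 \<le> E3 n) \<and> E3 \<longlonglongrightarrow> 0 \<and>
        (\<forall>n. AE \<tau> in lebesgue_on {0<..<T}.
           total_relative_energy \<gamma> w\<^sub>i (\<lambda>x. \<rho> n (\<tau>, x)) (\<lambda>x. m n (\<tau>, x)) (\<lambda>x. S n (\<tau>, x))
             \<le> total_relative_energy \<gamma> w\<^sub>i (\<rho>\<^sub>0 n) (m\<^sub>0 n) (S\<^sub>0 n) + ennreal (E3 n)) \<and>
        (\<forall>\<psi> \<in> C1c (cylinder0 T). (\<forall>z\<in>cylinder0 T. 0 \<le> \<psi> z) \<longrightarrow>
           vanishing_error T (\<lambda>n. E4 n \<psi>) \<and> (\<forall>n.
           (AE t in lebesgue_on {0<..<T}. 0 \<le> E4 n \<psi> t) \<and>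
           integrable (lebesgue_on (cylinder T)) (entropy_integrand (\<rho> n) (m n) (S n) \<psi>) \<and>
           integrable lebesgue (\<lambda>x. S\<^sub>0 n x * \<psi> (0, x)) \<and>
           (LINT z|lebesgue_on (cylinder T). entropy_integrand (\<rho> n) (m n) (S n) \<psi> z)
             \<le> - (LINT x|lebesgue. S\<^sub>0 n x * \<psi> (0, x))
               + (LINT t|lebesgue_on {0<..<T}. E4 n \<psi> t))))"

section \<open>Function spaces, modes of convergence and Young measures\<close>

definition in_L2_plus_L1 :: "(real^'d \<Rightarrow> real) \<Rightarrow> bool"
  where "in_L2_plus_L1 h \<longleftrightarrow> (\<exists>f g.
     f \<in> borel_measurable lebesgue \<and> integrable lebesgue (\<lambda>x. (f x)\<^sup>2) \<and>
     integrable lebesgue g \<and>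
     (AE x in lebesgue. h x = f x + g x))"

text \<open>Every locally finite Borel measure on a Euclidean space is regular. Larger \<open>\<sigma>\<close>-algebras than the
  Borel one are admitted so that Lebesgue measurable densities are covered.\<close>

definition radon_measure :: "'a::euclidean_space measure \<Rightarrow> bool"
  where "radon_measure \<mu> \<longleftrightarrow> space \<mu> = UNIV \<and> sets borel \<subseteq> sets \<mu> \<and> (\<forall>K. compact K \<longrightarrow> emeasure \<mu> K < \<infinity>)"

definition converges_in_Mloc :: "(nat \<Rightarrow> 'a::euclidean_space measure) \<Rightarrow> 'a measure \<Rightarrow> bool"
  where "converges_in_Mloc \<mu> \<nu> \<longleftrightarrow>
     (\<forall>n. radon_measure (\<mu> n)) \<and> radon_measure \<nu> \<and>
     (\<forall>b \<in> Cc. (\<lambda>n. LINT x|\<mu> n. b x) \<longlonglongrightarrow> (LINT x|\<nu>. b x))"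

definition generates_young_measure ::
    "'a::euclidean_space set \<Rightarrow> (nat \<Rightarrow> 'a \<Rightarrow> 'w::euclidean_space) \<Rightarrow> ('a \<Rightarrow> 'w measure) \<Rightarrow> bool"
  where "generates_young_measure Q Z V \<longleftrightarrow>
     (\<forall>z\<in>Q. prob_space (V z) \<and> sets (V z) = sets borel) \<and>
     (\<forall>n. Z n \<in> borel_measurable (lebesgue_on Q)) \<and>
     (\<forall>b \<in> Cc.
        (\<lambda>z. LINT w|V z. b w) \<in> borel_measurable (lebesgue_on Q) \<and>
        (\<forall>g. integrable (lebesgue_on Q) g \<longrightarrow>
           (\<lambda>n. LINT z|lebesgue_on Q. b (Z n z) * g z)
             \<longlonglongrightarrow> (LINT z|lebesgue_on Q. (LINT w|V z. b w) * g z)))"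

definition in_Lq_L1 ::
    "real \<Rightarrow> real \<Rightarrow> (real^'d) set \<Rightarrow> (real \<times> (real^'d) \<Rightarrow> 'b::euclidean_space) \<Rightarrow> bool"
  where "in_Lq_L1 q T K f \<longleftrightarrow>
     f \<in> borel_measurable (lebesgue_on ({0<..<T} \<times> K)) \<and>
     (AE t in lebesgue_on {0<..<T}. integrable (lebesgue_on K) (\<lambda>x. f (t, x))) \<and>
     integrable (lebesgue_on {0<..<T}) (\<lambda>t. (LINT x|lebesgue_on K. norm (f (t, x))) powr q)"

definition Lq_L1_norm ::
    "real \<Rightarrow> real \<Rightarrow> (real^'d) set \<Rightarrow> (real \<times> (real^'d) \<Rightarrow> 'b::euclidean_space) \<Rightarrow> real"
  where "Lq_L1_norm q T K f =
     (LINT t|lebesgue_on {0<..<T}. (LINT x|lebesgue_on K. norm (f (t, x))) powr q) powr (1 / q)"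

definition converges_in_Lq_L1loc ::
    "real \<Rightarrow> real \<Rightarrow> (nat \<Rightarrow> real \<times> (real^'d) \<Rightarrow> 'b::euclidean_space) \<Rightarrow> (real \<times> (real^'d) \<Rightarrow> 'b) \<Rightarrow> bool"
  where "converges_in_Lq_L1loc q T f g \<longleftrightarrow>
     (\<forall>K. compact K \<longrightarrow>
        (\<forall>n. in_Lq_L1 q T K (f n)) \<and> in_Lq_L1 q T K g \<and>
        (\<lambda>n. Lq_L1_norm q T K (\<lambda>z. f n z - g z)) \<longlonglongrightarrow> 0)"

definition converges_ae :: "'a::euclidean_space set \<Rightarrow> (nat \<Rightarrow> 'a \<Rightarrow> 'b::topological_space) \<Rightarrow> ('a \<Rightarrow> 'b) \<Rightarrow> bool"
  where "converges_ae Q f g \<longleftrightarrow> (AE z in lebesgue_on Q. (\<lambda>n. f n z) \<longlonglongrightarrow> g z)"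

text \<open>Almost everywhere convergence of a sequence, up to the extraction of subsequences. For the
  entropies of a consistent approximation, almost everywhere convergence of the whole sequence cannot
  be expected: with \<open>w\<^sub>i = (1, 0, 0)\<close>, \<open>\<rho>\<^sub>n = 1\<close>, \<open>m\<^sub>n = 0\<close> and \<open>S\<^sub>n(t,x) = 1\<close> if \<open>x \<in> B\<^sub>n\<close>,
  \<open>S\<^sub>n(t,x) = 0\<close> otherwise, where the sets \<open>B\<^sub>n\<close> sweep the unit cube repeatedly while their measures
  tend to 0, one has a consistent approximation generating the Dirac masses at \<open>(1, 0, 0)\<close>, which is a
  weak solution, but \<open>S\<^sub>n(t,x)\<close> diverges for every \<open>x\<close> in the cube.\<close>

definition converges_ae_up_to_subsequences ::
    "'a::euclidean_space set \<Rightarrow> (nat \<Rightarrow> 'a \<Rightarrow> 'b::topological_space) \<Rightarrow> ('a \<Rightarrow> 'b) \<Rightarrow> bool"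
  where "converges_ae_up_to_subsequences Q f g \<longleftrightarrow>
     (\<forall>r::nat \<Rightarrow> nat. strict_mono r \<longrightarrow>
        (\<exists>k::nat \<Rightarrow> nat. strict_mono k \<and> converges_ae Q (\<lambda>n. f (r (k n))) g))"

end

theory Submission
  imports Defs
begin

text \<open>Write \<open>u = (\<rho>, m, S)\<close>. The momentum flux \<open>m \<otimes> m / \<rho> + p I\<close> is, in the sense of quadratic forms, a
convex function of \<open>u\<close>. Along the sequence its weak limit therefore exceeds its value at the
barycenter by a defect that is a nonnegative matrix, and the trace of this defect is comparable to the
defect of the energy. Both the consistent approximation, in the limit, and the barycenter satisfy the
momentum equation; hence the defect is divergence free. A nonnegative divergence free matrix field of
finite mass on the whole space vanishes: tested with the field \<open>x\<close>, whose gradient is the identity, it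
gives the integral of its trace. This is the place where the barycenter being a solution is used, and
where the whole space, without a boundary, is used.

The field \<open>x\<close> has to be cut off. With the cutoff \<open>log_cutoff\<close>, a function of \<open>\<epsilon> ln (1 + |x|\<^sup>2)\<close>, the
derivative of the cutoff contributes to the gradient of the field only a rank-one matrix of size at most
\<open>4 \<epsilon>\<close>, uniformly in space, so that the error is \<open>\<epsilon>\<close> times the total relative energy. No defect
measure is constructed. Instead the flux is perturbed by \<open>\<epsilon>\<close> times the relative energy
(\<open>convexified_flux\<close>), which makes it nonnegative and convex in spite of the rank-one term. The lower
semicontinuity of its integral along the Young measure and Jensen's inequality then show that the
convexity gap of the flux, averaged against the Young measure, has integral of order \<open>\<epsilon>\<close>
(\<open>flux_energy_limit\<close>, \<open>jensen_defect\<close>).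

The negative parts of the entropies are bounded in \<open>L\<^sup>1\<close> only and may concentrate. The tangents of
the energy have positive slope in the entropy variable, hence such concentrations can only increase the
limit of the relative energies and do not disturb the inequality.

As \<open>\<epsilon>\<close> tends to \<open>0\<close>, the gap vanishes. Where the barycenter has positive density the energy is strictly
convex, so the Young measure is the Dirac mass at the barycenter. On the vacuum set the density vanishes
for almost every value of the Young measure; the energy bound then forces zero momentum and nonpositive
entropy, and the entropy vanishes since its mean does (\<open>young_measure_is_dirac\<close>).

Once the Young measure consists of Dirac masses, the sequence converges in measure. The relative energy
controls \<open>\<rho> ln \<rho>\<close>, so that densities and momenta are equi-integrable, which turns this into convergence
in \<open>L\<^sup>1\<close> (\<open>dirac_equi\<close>); the bounds uniform in time give the spaces \<open>L\<^sup>q(0,T;L\<^sup>1)\<close>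
(\<open>Lq_L1_bounded_slices\<close>).\<close>

section \<open>Tangents of the energy\<close>

text \<open>The states of finite energy.\<close>

definition energy_domain :: "(real \<times> (real^'d) \<times> real) set"
  where "energy_domain = {(\<rho>, m, S). \<rho> > 0 \<or> (\<rho> = 0 \<and> m = 0 \<and> S \<le> 0)}"

text \<open>The first order Taylor polynomials at \<open>(r, \<sigma>)\<close> of the pressure and, below, at \<open>(r, n)\<close> of the
kinetic terms. All convexity arguments compare a function with such a polynomial.\<close>

definition pressure_tangent :: "real \<Rightarrow> real \<Rightarrow> real \<Rightarrow> real \<Rightarrow> real \<Rightarrow> real"
  where "pressure_tangent \<gamma> r \<sigma> \<rho> S =
     pressure \<gamma> r \<sigma> * ((\<gamma> - (\<gamma> - 1) * \<sigma> / r) * \<rho> / r + (\<gamma> - 1) * S / r - (\<gamma> - 1))"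

text \<open>For \<open>|y| \<le> 1\<close> the quadratic form \<open>|m|\<^sup>2 - (m \<bullet> y)\<^sup>2\<close> is nonnegative. The direction \<open>y\<close> is there for
the rank-one part of the gradient of the test field; \<open>y = 0\<close> is twice the kinetic energy. Division by
\<open>0\<close> yields the value \<open>0\<close> that the states of the energy domain have at vacuum.\<close>

definition kinetic :: "real^'d \<Rightarrow> real \<Rightarrow> real^'d \<Rightarrow> real"
  where "kinetic y \<rho> m = (m \<bullet> m - (m \<bullet> y)\<^sup>2) / \<rho>"

definition kinetic_tangent :: "real^'d \<Rightarrow> real \<Rightarrow> real^'d \<Rightarrow> real \<Rightarrow> real^'d \<Rightarrow> real"
  where "kinetic_tangent y r n \<rho> m =
     2 * (n \<bullet> m - (n \<bullet> y) * (m \<bullet> y)) / r - \<rho> * (n \<bullet> n - (n \<bullet> y)\<^sup>2) / r\<^sup>2"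

text \<open>The relative energy as a real number. Unlike the gradient, the tangents are explicit, and the
formula makes sense at every state.\<close>

definition bregman_energy ::
    "real \<Rightarrow> real \<times> (real^'d) \<times> real \<Rightarrow> real \<times> (real^'d) \<times> real \<Rightarrow> real"
  where "bregman_energy \<gamma> u v =
     1/2 * (kinetic 0 (fst v) (fst (snd v)) - kinetic_tangent 0 (fst u) (fst (snd u)) (fst v) (fst (snd v)))
     + c_v \<gamma> * (pressure \<gamma> (fst v) (snd (snd v)) - pressure_tangent \<gamma> (fst u) (snd (snd u)) (fst v) (snd (snd v)))"

lemma c_v_pos: "\<gamma> > 1 \<Longrightarrow> c_v \<gamma> > 0" by (simp add: c_v_def)

lemma pressure_eq_exp:
  assumes "\<rho> > 0"
  shows "pressure \<gamma> \<rho> S = exp (\<gamma> * ln \<rho> + (\<gamma> - 1) * S / \<rho>)"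
  using assms by (simp add: pressure_def c_v_def powr_def exp_add mult.commute)

lemma pressure_pos: "\<rho> > 0 \<Longrightarrow> pressure \<gamma> \<rho> S > 0"
  by (simp add: pressure_eq_exp)

lemma pressure_zero [simp]: "pressure \<gamma> 0 S = 0" by (simp add: pressure_def)

text \<open>In the variables \<open>x\<close>, the ratio of the densities, and \<open>y\<close>, the logarithm of the ratio of the values of
\<open>p / \<rho>\<close>, the pressure is \<open>x exp y\<close> up to a factor, and its convexity gap is a combination of the gaps of \<open>exp\<close>
at \<open>0\<close> and of \<open>x ln x\<close> at \<open>1\<close>. This shows convexity and strictness at once, without second derivatives.\<close>

lemma pressure_bregman:
  fixes \<gamma> \<rho> r S \<sigma> :: real
  assumes "r > 0" "\<rho> > 0"
  defines "x \<equiv> \<rho> / r" and "y \<equiv> (\<gamma> - 1) * (ln (\<rho> / r) + S / \<rho> - \<sigma> / r)"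
  shows "pressure \<gamma> \<rho> S - pressure_tangent \<gamma> r \<sigma> \<rho> S
    = pressure \<gamma> r \<sigma> * (x * (exp y - 1 - y) + (\<gamma> - 1) * (x * ln x - x + 1))"
proof -
  have x: "x > 0" "\<rho> = x * r" using assms by (auto simp: x_def)
  have "pressure \<gamma> \<rho> S = exp ((\<gamma> * ln r + (\<gamma> - 1) * \<sigma> / r) + (ln x + y))"
    using assms(1,2) unfolding pressure_eq_exp[OF assms(2)] y_def x_def
    by (simp add: ln_div algebra_simps)
  also have "\<dots> = pressure \<gamma> r \<sigma> * (x * exp y)"
    using x(1) assms(1) by (simp add: pressure_eq_exp exp_add)
  finally have 1: "pressure \<gamma> \<rho> S = pressure \<gamma> r \<sigma> * (x * exp y)" .
  define A where "A = (\<gamma> - 1) * \<sigma> / r"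
  define B where "B = (\<gamma> - 1) * S / r"
  have y: "x * y = (\<gamma> - 1) * (x * ln x) + B - A * x"
    unfolding y_def x_def A_def B_def using assms(1,2) by (simp add: field_simps)
  have t: "pressure_tangent \<gamma> r \<sigma> \<rho> S = pressure \<gamma> r \<sigma> * ((\<gamma> - A) * x + B - (\<gamma> - 1))"
    by (simp add: pressure_tangent_def A_def B_def x_def)
  have "x * exp y - ((\<gamma> - A) * x + B - (\<gamma> - 1)) = x * (exp y - 1 - y) + (\<gamma> - 1) * (x * ln x - x + 1)"
    using y by (simp add: algebra_simps)
  thus ?thesis unfolding 1 t by (simp add: right_diff_distrib[symmetric])
qed

lemma exp_sub_nonneg: "exp y - 1 - y \<ge> (0::real)"
  using exp_ge_add_one_self[of y] by linarith

lemma x_ln_x_nonneg: "x > 0 \<Longrightarrow> x * ln x - x + 1 \<ge> (0::real)"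
proof -
  assume x: "x > 0"
  have "ln (1/x) \<le> 1/x - 1" using x by (intro ln_le_minus_one) auto
  hence "x * ln (1/x) \<le> x * (1/x - 1)" using x by (intro mult_left_mono) auto
  thus ?thesis using x by (simp add: ln_div algebra_simps)
qed

lemma x_ln_x_zero:
  assumes "x > 0" "x * ln x - x + 1 = (0::real)" shows "x = 1"
proof -
  have "ln (1/x) = 1/x - 1" using assms by (simp add: ln_div field_simps)
  hence "1/x = 1" using assms by (intro ln_eq_minus_one) auto
  thus ?thesis using assms by simp
qed

lemma exp_sub_zero:
  assumes "exp y - 1 - y = (0::real)" shows "y = 0"
proof -
  have "ln (exp y) = exp y - 1" using assms by simp
  hence "exp y = 1" by (intro ln_eq_minus_one) auto
  thus ?thesis by simp
qed

text \<open>At a vacuum state the inequality is strict because of the constant term of the tangent.\<close>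

lemma pressure_tangent_le:
  assumes \<gamma>: "\<gamma> > 1" and r: "r > 0" and v: "(\<rho>, m :: real^'d, S) \<in> energy_domain"
  shows "pressure_tangent \<gamma> r \<sigma> \<rho> S \<le> pressure \<gamma> \<rho> S"
    and "pressure_tangent \<gamma> r \<sigma> \<rho> S = pressure \<gamma> \<rho> S \<Longrightarrow> \<rho> = r \<and> S = \<sigma>"
proof -
  have p: "pressure \<gamma> r \<sigma> > 0" using r by (rule pressure_pos)
  have "pressure_tangent \<gamma> r \<sigma> \<rho> S \<le> pressure \<gamma> \<rho> S
    \<and> (pressure_tangent \<gamma> r \<sigma> \<rho> S = pressure \<gamma> \<rho> S \<longrightarrow> \<rho> = r \<and> S = \<sigma>)"
  proof (cases "\<rho> > 0")
    case True
    define x where "x = \<rho> / r"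
    define y where "y = (\<gamma> - 1) * (ln (\<rho> / r) + S / \<rho> - \<sigma> / r)"
    have x: "x > 0" using True r by (simp add: x_def)
    let ?a = "x * (exp y - 1 - y)" and ?b = "(\<gamma> - 1) * (x * ln x - x + 1)"
    have B: "pressure \<gamma> \<rho> S - pressure_tangent \<gamma> r \<sigma> \<rho> S = pressure \<gamma> r \<sigma> * (?a + ?b)"
      unfolding x_def y_def by (rule pressure_bregman[OF r True])
    have a: "?a \<ge> 0" using x exp_sub_nonneg by (intro mult_nonneg_nonneg) auto
    have b: "?b \<ge> 0" using \<gamma> x_ln_x_nonneg[OF x] by (intro mult_nonneg_nonneg) auto
    have "pressure \<gamma> r \<sigma> * (?a + ?b) \<ge> 0" using p a b by (intro mult_nonneg_nonneg) auto
    moreover {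
      assume "pressure_tangent \<gamma> r \<sigma> \<rho> S = pressure \<gamma> \<rho> S"
      hence "?a + ?b = 0" using B p by simp
      hence ab: "?a = 0" "?b = 0" using a b by linarith+
      have x1: "x = 1" using ab(2) \<gamma> x by (intro x_ln_x_zero) auto
      have "exp y - 1 - y = 0" using ab(1) x by (metis less_irrefl mult_eq_0_iff)
      hence y0: "y = 0" by (rule exp_sub_zero)
      have "\<rho> = r" using x1 r by (simp add: x_def)
      moreover have "S = \<sigma>" using y0 \<gamma> \<open>\<rho> = r\<close> r by (simp add: y_def)
      ultimately have "\<rho> = r \<and> S = \<sigma>" by simp
    }
    ultimately show ?thesis using B by auto
  next
    case False
    hence 0: "\<rho> = 0" "S \<le> 0" using v by (auto simp: energy_domain_def)
    have "(\<gamma> - 1) * S / r \<le> 0" using 0 \<gamma> r by (simp add: divide_nonpos_pos mult_nonneg_nonpos)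
    hence "pressure \<gamma> r \<sigma> * ((\<gamma> - 1) * S / r - (\<gamma> - 1)) < 0"
      using \<gamma> by (intro mult_pos_neg p) linarith
    hence "pressure_tangent \<gamma> r \<sigma> \<rho> S < pressure \<gamma> \<rho> S"
      unfolding 0(1) pressure_tangent_def by simp
    thus ?thesis by simp
  qed
  thus "pressure_tangent \<gamma> r \<sigma> \<rho> S \<le> pressure \<gamma> \<rho> S"
    and "pressure_tangent \<gamma> r \<sigma> \<rho> S = pressure \<gamma> \<rho> S \<Longrightarrow> \<rho> = r \<and> S = \<sigma>" by auto
qed

text \<open>A quadratic form divided by the density is a perspective function: its convexity gap is the density
times the form of the difference of the velocities.\<close>

lemma kinetic_bregman:
  assumes "r > 0" "(\<rho>, m :: real^'d, S) \<in> energy_domain"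
  shows "kinetic y \<rho> m - kinetic_tangent y r n \<rho> m
    = \<rho> * (let w = m /\<^sub>R \<rho> - n /\<^sub>R r in w \<bullet> w - (w \<bullet> y)\<^sup>2)"
proof (cases "\<rho> = 0")
  case True
  then have "m = 0" using assms by (auto simp: energy_domain_def)
  then show ?thesis using True by (simp add: kinetic_def kinetic_tangent_def)
next
  case False
  with assms(1) show ?thesis
    by (simp add: kinetic_def kinetic_tangent_def Let_def inner_diff_left inner_diff_right inner_commute
        field_simps power2_eq_square)
qed

lemma kinetic_tangent_le:
  assumes "r > 0" "(\<rho>, m :: real^'d, S) \<in> energy_domain" "norm y \<le> 1"
  shows "kinetic_tangent y r n \<rho> m \<le> kinetic y \<rho> m"
proof -
  define w where "w = m /\<^sub>R \<rho> - n /\<^sub>R r"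
  have "(w \<bullet> y)\<^sup>2 \<le> (w \<bullet> w) * (y \<bullet> y)" by (rule Cauchy_Schwarz_ineq)
  also have "\<dots> \<le> (w \<bullet> w) * 1"
    using assms(3) by (intro mult_left_mono) (auto simp: dot_square_norm power_le_one)
  finally have "w \<bullet> w - (w \<bullet> y)\<^sup>2 \<ge> 0" by simp
  moreover have "\<rho> \<ge> 0" using assms by (auto simp: energy_domain_def)
  ultimately have "\<rho> * (w \<bullet> w - (w \<bullet> y)\<^sup>2) \<ge> 0" by simp
  thus ?thesis using kinetic_bregman[OF assms(1,2), of y n] by (simp add: Let_def w_def)
qed

lemma bregman_energy_nonneg:
  assumes "\<gamma> > 1" "fst u > 0" "v \<in> energy_domain"
  shows "bregman_energy \<gamma> u v \<ge> 0"
proof -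
  obtain \<rho> m S where v: "v = (\<rho>, m, S)" by (cases v)
  show ?thesis
    using kinetic_tangent_le[of "fst u" \<rho> m S 0 "fst (snd u)"] assms
      pressure_tangent_le(1)[of \<gamma> "fst u" \<rho> m S "snd (snd u)"] c_v_pos[of \<gamma>]
    by (simp add: v bregman_energy_def)
qed

lemma bregman_energy_zero:
  assumes "\<gamma> > 1" "fst u > 0" "v \<in> energy_domain" "bregman_energy \<gamma> u v = 0"
  shows "v = u"
proof -
  obtain \<rho> m S where v: "v = (\<rho>, m, S)" by (cases v)
  obtain r n \<sigma> where u: "u = (r, n, \<sigma>)" by (cases u)
  define K where "K = kinetic 0 \<rho> m - kinetic_tangent 0 r n \<rho> m"
  define P where "P = pressure \<gamma> \<rho> S - pressure_tangent \<gamma> r \<sigma> \<rho> S"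
  have r: "r > 0" and v': "(\<rho>, m, S) \<in> energy_domain" using assms(2,3) by (auto simp: u v)
  have K: "K \<ge> 0" using kinetic_tangent_le[OF r v', of 0 n] by (simp add: K_def)
  have P: "P \<ge> 0" using pressure_tangent_le(1)[OF assms(1) r v', of \<sigma>] by (simp add: P_def)
  have c: "c_v \<gamma> > 0" using assms(1) by (rule c_v_pos)
  have sum: "K / 2 + c_v \<gamma> * P = 0" using assms(4) by (simp add: u v bregman_energy_def K_def P_def)
  have "c_v \<gamma> * P \<ge> 0" using P c by simp
  with sum K have K0: "K = 0" and "c_v \<gamma> * P = 0" by linarith+
  with c have P0: "P = 0" by simp
  have \<rho>S: "\<rho> = r" "S = \<sigma>"
    using pressure_tangent_le(2)[OF assms(1) r v', of \<sigma>] P0 by (simp_all add: P_def)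
  moreover have "m = n"
  proof -
    have "\<rho> * ((m /\<^sub>R \<rho> - n /\<^sub>R r) \<bullet> (m /\<^sub>R \<rho> - n /\<^sub>R r)) = 0"
      using K0 kinetic_bregman[OF r v', of 0 n] by (simp only: K_def Let_def inner_zero_right) simp
    hence "(m /\<^sub>R r - n /\<^sub>R r) \<bullet> (m /\<^sub>R r - n /\<^sub>R r) = 0" using r \<rho>S by simp
    hence "m /\<^sub>R r = n /\<^sub>R r" by simp
    thus ?thesis using r by simp
  qed
  ultimately show ?thesis by (simp add: u v)
qed

section \<open>Relative energy and its growth\<close>

lemma has_derivative_real_energy:
  fixes n :: "real^'d"
  assumes \<gamma>: "\<gamma> > 1" and r: "r > 0"
  shows "((\<lambda>v. enn2real (energy \<gamma> v)) has_derivative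
    (\<lambda>h. (n \<bullet> fst (snd h)) / r - fst h * (n \<bullet> n) / (2 * r\<^sup>2)
       + c_v \<gamma> * (pressure \<gamma> r \<sigma> *
          ((\<gamma> / r - (\<gamma> - 1) * \<sigma> / r\<^sup>2) * fst h + (\<gamma> - 1) * snd (snd h) / r))))
    (at (r, n, \<sigma>))"
proof -
  let ?g = "\<lambda>v :: real \<times> (real^'d) \<times> real. (fst (snd v) \<bullet> fst (snd v)) / (2 * fst v)
     + c_v \<gamma> * exp (\<gamma> * ln (fst v) + (\<gamma> - 1) * snd (snd v) / fst v)"
  let ?U = "{v :: real \<times> (real^'d) \<times> real. fst v > 0}"
  have U: "open ?U" by (intro open_Collect_less continuous_intros)
  have eq: "?g v = enn2real (energy \<gamma> v)" if "v \<in> ?U" for v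
  proof -
    obtain \<rho> m S where v: "v = (\<rho>, m, S)" by (cases v)
    have \<rho>: "\<rho> > 0" using that v by simp
    have c: "c_v \<gamma> > 0" using \<gamma> by (rule c_v_pos)
    have "energy \<gamma> v = ennreal (1/2 * (norm m)\<^sup>2 / \<rho> + c_v \<gamma> * pressure \<gamma> \<rho> S)"
      using \<rho> by (simp add: energy_def v pressure_def mult.assoc)
    moreover have "1/2 * (norm m)\<^sup>2 / \<rho> + c_v \<gamma> * pressure \<gamma> \<rho> S \<ge> 0"
      using \<rho> c pressure_pos[OF \<rho>, of \<gamma> S] by (intro add_nonneg_nonneg mult_nonneg_nonneg divide_nonneg_pos) auto
    ultimately show ?thesis using \<rho>
      by (simp add: v pressure_eq_exp dot_square_norm)
  qed
  have "(?g has_derivative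
    (\<lambda>h. (n \<bullet> fst (snd h)) / r - fst h * (n \<bullet> n) / (2 * r\<^sup>2)
       + c_v \<gamma> * (pressure \<gamma> r \<sigma> *
          ((\<gamma> / r - (\<gamma> - 1) * \<sigma> / r\<^sup>2) * fst h + (\<gamma> - 1) * snd (snd h) / r)))) (at (r, n, \<sigma>))"
    apply (rule derivative_eq_intros refl | use r in simp; fail)+
    using r
    apply (simp add: pressure_eq_exp fun_eq_iff power2_eq_square inner_commute field_simps)
    done
  from has_derivative_transform_within_open[OF this U _ eq] r show ?thesis by simp
qed

lemma relative_energy_eq:
  fixes u :: "real \<times> (real^'d) \<times> real"
  assumes \<gamma>: "\<gamma> > 1" and u: "fst u > 0"
  shows "relative_energy \<gamma> u v = (if v \<in> energy_domain then ereal (bregman_energy \<gamma> u v) else \<infinity>)"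
proof -
  obtain r n \<sigma> where u': "u = (r, n, \<sigma>)" by (cases u)
  obtain \<rho> m S where v: "v = (\<rho>, m, S)" by (cases v)
  have r: "r > 0" using u u' by simp
  have c: "c_v \<gamma> > 0" using \<gamma> by (rule c_v_pos)
  have en: "enn2ereal (energy \<gamma> (\<rho>, m, S)) = ereal ((m \<bullet> m) / (2 * \<rho>) + c_v \<gamma> * pressure \<gamma> \<rho> S)"
    if "(\<rho>, m, S) \<in> energy_domain" for \<rho> S and m :: "real^'d"
  proof (cases "\<rho> > 0")
    case True
    have "energy \<gamma> (\<rho>, m, S) = ennreal (1/2 * (norm m)\<^sup>2 / \<rho> + c_v \<gamma> * pressure \<gamma> \<rho> S)"
      using True by (simp add: energy_def pressure_def mult.assoc)
    moreover have "1/2 * (norm m)\<^sup>2 / \<rho> + c_v \<gamma> * pressure \<gamma> \<rho> S \<ge> 0"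
      using True c pressure_pos[OF True, of \<gamma> S] by (intro add_nonneg_nonneg mult_nonneg_nonneg divide_nonneg_pos) auto
    ultimately show ?thesis by (simp add: dot_square_norm enn2ereal_ennreal)
  next
    case False
    with that show ?thesis by (auto simp: energy_domain_def energy_def zero_ereal_def zero_ennreal.rep_eq)
  qed
  have un: "u \<in> energy_domain" using r by (simp add: u' energy_domain_def)
  note D = frechet_derivative_at[OF has_derivative_real_energy[OF \<gamma> r, of n \<sigma>], symmetric]
  show ?thesis
  proof (cases "v \<in> energy_domain")
    case True
    show ?thesis using True un r en[of \<rho> m S] en[of r n \<sigma>]
      unfolding relative_energy_def u' v D
      apply simp
      apply (simp add: bregman_energy_def kinetic_def kinetic_tangent_def pressure_tangent_def)
      apply (simp add: inner_diff_right field_simps power2_eq_square)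
      done
  next
    case False
    have "enn2ereal (energy \<gamma> v) = \<infinity>" using False by (auto simp: v energy_def energy_domain_def)
    moreover have "\<bar>enn2ereal (energy \<gamma> u)\<bar> \<noteq> \<infinity>" using un en[of r n \<sigma>] by (simp add: u')
    ultimately show ?thesis using False unfolding relative_energy_def by simp
  qed
qed

text \<open>Among the tangents of the pressure with a prescribed slope \<open>s\<close> in the entropy, the slope in the
density grows like the logarithm of the density at the point of contact, so it can be made as large as
desired. This is the \<open>\<rho> ln \<rho>\<close> control hidden in the relative energy.\<close>

lemma pressure_superlinear:
  assumes \<gamma>: "\<gamma> > 1" and s: "s > 0"
  shows "\<exists>C\<ge>0. \<forall>\<rho> (m :: real^'d) S. (\<rho>, m, S) \<in> energy_domain \<longrightarrow> s * S + A * \<rho> - C \<le> pressure \<gamma> \<rho> S"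
proof -
  define \<kappa> where "\<kappa> = ln (s / (\<gamma> - 1))"
  define r where "r = exp ((A * (\<gamma> - 1) / s - \<gamma> + \<kappa>) / (\<gamma> - 1))"
  \<comment> \<open>The slope in the entropy is \<open>s\<close> for this choice, and \<open>r\<close> is adjusted so that the slope in the density is \<open>A\<close>.\<close>
  define \<sigma> where "\<sigma> = r * (\<kappa> / (\<gamma> - 1) - ln r)"
  have r: "r > 0" by (simp add: r_def)
  have \<sigma>: "(\<gamma> - 1) * \<sigma> / r = \<kappa> - (\<gamma> - 1) * ln r"
    using r \<gamma> by (simp add: \<sigma>_def field_simps)
  have "pressure \<gamma> r \<sigma> = exp (ln r + \<kappa>)"
    unfolding pressure_eq_exp[OF r] \<sigma> by (simp add: algebra_simps)
  also have "\<dots> = r * (s / (\<gamma> - 1))" using r s \<gamma> by (simp add: exp_add \<kappa>_def)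
  finally have p: "pressure \<gamma> r \<sigma> = r * (s / (\<gamma> - 1))" .
  have lnr: "(\<gamma> - 1) * ln r = A * (\<gamma> - 1) / s - \<gamma> + \<kappa>" using \<gamma> by (simp add: r_def)
  have "pressure_tangent \<gamma> r \<sigma> \<rho> S = s * S + A * \<rho> - s * r" for \<rho> S
    unfolding pressure_tangent_def \<sigma> lnr p using r s \<gamma> by (simp add: field_simps)
  thus ?thesis using pressure_tangent_le(1)[OF \<gamma> r, of _ _ _ \<sigma>] s r
    by (intro exI[of _ "s * r"]) (auto simp: less_imp_le)
qed

text \<open>The tangent at a point of small density \<open>r\<close> and pressure \<open>1\<close> has a slope of order \<open>1 / r\<close> in the
entropy.\<close>

lemma entropy_le_pressure_density:
  assumes \<gamma>: "\<gamma> > 1" and \<delta>: "\<delta> > 0"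
  shows "\<exists>C\<ge>0. \<forall>\<rho> (m :: real^'d) S. (\<rho>, m, S) \<in> energy_domain
      \<longrightarrow> max 0 S \<le> \<delta> * (1 + pressure \<gamma> \<rho> S) + C * \<rho>"
proof -
  define r where "r = min \<delta> (\<delta> * (\<gamma> - 1))"
  have r: "r > 0" "r \<le> \<delta>" "r \<le> \<delta> * (\<gamma> - 1)" using \<gamma> \<delta> by (auto simp: r_def)
  \<comment> \<open>This choice gives pressure \<open>1\<close> at the point of contact.\<close>
  define \<sigma> where "\<sigma> = - r * \<gamma> * ln r / (\<gamma> - 1)"
  have \<sigma>: "(\<gamma> - 1) * \<sigma> / r = - \<gamma> * ln r"
    using r \<gamma> by (simp add: \<sigma>_def field_simps)
  have p: "pressure \<gamma> r \<sigma> = 1"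
    unfolding pressure_eq_exp[OF r(1)] \<sigma> by simp
  define B where "B = \<bar>\<gamma> + \<gamma> * ln r\<bar> / (\<gamma> - 1)"
  have "max 0 S \<le> \<delta> * (1 + pressure \<gamma> \<rho> S) + B * \<rho>" if v: "(\<rho>, m :: real^'d, S) \<in> energy_domain" for \<rho> m S
  proof -
    have \<rho>: "\<rho> \<ge> 0" using v by (auto simp: energy_domain_def)
    have P: "pressure \<gamma> \<rho> S \<ge> 0" using \<rho> pressure_pos[of \<rho> \<gamma> S] by (cases "\<rho> = 0") auto
    have "(\<gamma> + \<gamma> * ln r) * \<rho> / r + (\<gamma> - 1) * S / r - (\<gamma> - 1) \<le> pressure \<gamma> \<rho> S"
      using pressure_tangent_le(1)[OF \<gamma> r(1) v, of \<sigma>] unfolding pressure_tangent_def p \<sigma> by simp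
    hence "S \<le> r / (\<gamma> - 1) * pressure \<gamma> \<rho> S + r - (\<gamma> + \<gamma> * ln r) / (\<gamma> - 1) * \<rho>"
    proof -
      have aux: "S \<le> r / g * P + r - K / g * \<rho>" if "K * \<rho> / r + g * S / r - g \<le> P" "g > 0" for K g P :: real
      proof -
        have "K * \<rho> + g * S \<le> (P + g) * r" using that(1) r(1) by (simp add: field_simps)
        hence "S \<le> ((P + g) * r - K * \<rho>) / g" using that(2) by (simp add: field_simps)
        also have "((P + g) * r - K * \<rho>) / g = r / g * P + r - K / g * \<rho>"
          using that(2) by (simp add: diff_divide_distrib add_divide_distrib distrib_right)
        finally show ?thesis .
      qed
      show ?thesis if "(\<gamma> + \<gamma> * ln r) * \<rho> / r + (\<gamma> - 1) * S / r - (\<gamma> - 1) \<le> pressure \<gamma> \<rho> S"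
        using aux[OF that] \<gamma> by simp
    qed
    moreover have "r / (\<gamma> - 1) * pressure \<gamma> \<rho> S \<le> \<delta> * pressure \<gamma> \<rho> S"
      using r \<gamma> P by (intro mult_right_mono) (auto simp: field_simps)
    moreover have "- ((\<gamma> + \<gamma> * ln r) / (\<gamma> - 1) * \<rho>) \<le> B * \<rho>"
      unfolding B_def mult_minus_left[symmetric] minus_divide_left using \<gamma> \<rho> by (intro mult_right_mono divide_right_mono) auto
    moreover have "\<delta> * (1 + pressure \<gamma> \<rho> S) = \<delta> + \<delta> * pressure \<gamma> \<rho> S" by (simp add: distrib_left)
    ultimately have "S \<le> \<delta> * (1 + pressure \<gamma> \<rho> S) + B * \<rho>" using r by linarith
    moreover have "0 \<le> \<delta> * (1 + pressure \<gamma> \<rho> S) + B * \<rho>"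
      using \<delta> P \<rho> \<gamma> by (auto simp: B_def intro!: add_nonneg_nonneg)
    ultimately show ?thesis by simp
  qed
  moreover have "B \<ge> 0" using \<gamma> by (simp add: B_def)
  ultimately show ?thesis by blast
qed

text \<open>Young's inequality, from the nonnegativity of a square.\<close>

lemma inner_le_kinetic:
  assumes "(\<rho>, m :: real^'d, S) \<in> energy_domain" "\<delta> > 0"
  shows "m \<bullet> b \<le> \<delta> * kinetic 0 \<rho> m + \<rho> * (b \<bullet> b) / (4 * \<delta>)"
proof (cases "\<rho> > 0")
  case True
  have "0 \<le> ((2 * \<delta> / \<rho>) *\<^sub>R m - b) \<bullet> ((2 * \<delta> / \<rho>) *\<^sub>R m - b)" by (rule inner_ge_zero)
  also have "\<dots> = 4 * \<delta> / \<rho> * (\<delta> * kinetic 0 \<rho> m + \<rho> * (b \<bullet> b) / (4 * \<delta>) - m \<bullet> b)"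
    using True assms(2)
    by (simp add: kinetic_def inner_diff_left inner_diff_right inner_commute field_simps power2_eq_square)
  finally have X: "0 \<le> 4 * \<delta> / \<rho> * (\<delta> * kinetic 0 \<rho> m + \<rho> * (b \<bullet> b) / (4 * \<delta>) - m \<bullet> b)" .
  have "4 * \<delta> / \<rho> > 0" using True assms(2) by simp
  with X[unfolded zero_le_mult_iff] show ?thesis by linarith
next
  case False
  with assms show ?thesis by (auto simp: energy_domain_def kinetic_def)
qed

lemma kinetic_nonneg: "(\<rho>, m :: real^'d, S) \<in> energy_domain \<Longrightarrow> kinetic 0 \<rho> m \<ge> 0"
  by (auto simp: energy_domain_def kinetic_def)

lemma pressure_nonneg: "(\<rho>, m :: real^'d, S) \<in> energy_domain \<Longrightarrow> pressure \<gamma> \<rho> S \<ge> 0"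
  using pressure_pos[of \<rho> \<gamma> S] by (fastforce simp: energy_domain_def)

text \<open>The tangent at \<open>u\<close> is affine with a positive slope \<open>c\<close> in the entropy, so subtracting it can only cost
where the entropy is positive or the density is large. Half of the pressure pays for both, by
\<open>pressure_superlinear\<close> with the slopes \<open>2 c / c_v\<close> if \<open>S \<ge> 0\<close> and \<open>c / c_v\<close> if \<open>S < 0\<close>; in the latter
case half of the gain from the negative entropy is left over. So the bound on the negative
entropy is only linear.\<close>

lemma bregman_energy_growth:
  fixes u :: "real \<times> (real^'d) \<times> real"
  assumes \<gamma>: "\<gamma> > 1" and u: "fst u > 0"
  shows "\<exists>c>0. \<forall>A. \<exists>C\<ge>0. \<forall>\<rho> m S. (\<rho>, m, S) \<in> energy_domain \<longrightarrow>
    kinetic 0 \<rho> m / 4 + c_v \<gamma> / 2 * pressure \<gamma> \<rho> S + A * \<rho> + c * max 0 (- S) - C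
      \<le> bregman_energy \<gamma> u (\<rho>, m, S)"
proof -
  obtain r n \<sigma> where u': "u = (r, n, \<sigma>)" by (cases u)
  have r: "r > 0" using u u' by simp
  have cv: "c_v \<gamma> > 0" using \<gamma> by (rule c_v_pos)
  have cv1: "c_v \<gamma> * (\<gamma> - 1) = 1" using \<gamma> by (simp add: c_v_def)
  define p where "p = pressure \<gamma> r \<sigma>"
  have p: "p > 0" unfolding p_def by (rule pressure_pos[OF r])
  define b where "b = n /\<^sub>R r"
  define a where "a = c_v \<gamma> * p * (\<gamma> - (\<gamma> - 1) * \<sigma> / r) / r"
  define c where "c = p / r"
  have c: "c > 0" using p r by (simp add: c_def)
  have tang: "c_v \<gamma> * pressure_tangent \<gamma> r \<sigma> \<rho> S = a * \<rho> + c * S - p" for \<rho> S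
  proof -
    have "c_v \<gamma> * pressure_tangent \<gamma> r \<sigma> \<rho> S = a * \<rho> + (c_v \<gamma> * (\<gamma> - 1)) * (p / r) * S - (c_v \<gamma> * (\<gamma> - 1)) * p"
    proof -
      have "c * (p * (A * \<rho> / r + g * S / r - g)) = c * p * A / r * \<rho> + (c * g) * (p / r) * S - (c * g) * p"
        for c p A g :: real by (simp add: algebra_simps)
      thus ?thesis unfolding pressure_tangent_def a_def p_def by simp
    qed
    thus ?thesis by (simp add: cv1 c_def)
  qed
  \<comment> \<open>Half of the kinetic energy absorbs the part of the tangent that is linear in the momentum.\<close>
  have low: "kinetic 0 \<rho> m / 4 + c_v \<gamma> * pressure \<gamma> \<rho> S - (a + b \<bullet> b) * \<rho> - c * S
      \<le> bregman_energy \<gamma> u (\<rho>, m, S)" if v: "(\<rho>, m, S) \<in> energy_domain" for \<rho> m S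
  proof -
    have "m \<bullet> b \<le> 1/4 * kinetic 0 \<rho> m + \<rho> * (b \<bullet> b) / (4 * (1/4))"
      by (rule inner_le_kinetic[OF v]) simp
    moreover have "kinetic_tangent 0 r n \<rho> m = 2 * (m \<bullet> b) - \<rho> * (b \<bullet> b)"
      using r by (simp add: kinetic_tangent_def b_def inner_commute field_simps power2_eq_square)
    moreover have "\<rho> * (b \<bullet> b) \<ge> 0" using v by (auto simp: energy_domain_def)
    moreover have "bregman_energy \<gamma> u (\<rho>, m, S) = 1/2 * (kinetic 0 \<rho> m - kinetic_tangent 0 r n \<rho> m)
       + c_v \<gamma> * pressure \<gamma> \<rho> S - (a * \<rho> + c * S - p)"
      unfolding tang[symmetric] by (simp add: bregman_energy_def u' right_diff_distrib)
    ultimately show ?thesis using p by (simp add: algebra_simps)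
  qed
  show ?thesis
  proof (rule exI[of _ "c / 2"], intro conjI allI)
    show "c / 2 > 0" using c by simp
    fix A
    define A' where "A' = 2 / c_v \<gamma> * (A + a + b \<bullet> b)"
    obtain C1 where C1: "C1 \<ge> 0" "\<And>\<rho> m S. (\<rho>, m :: real^'d, S) \<in> energy_domain
        \<Longrightarrow> 2 * c / c_v \<gamma> * S + A' * \<rho> - C1 \<le> pressure \<gamma> \<rho> S"
      using pressure_superlinear[OF \<gamma>, of "2 * c / c_v \<gamma>" A', where 'd='d] c cv by auto
    obtain C2 where C2: "C2 \<ge> 0" "\<And>\<rho> m S. (\<rho>, m :: real^'d, S) \<in> energy_domain
        \<Longrightarrow> c / c_v \<gamma> * S + A' * \<rho> - C2 \<le> pressure \<gamma> \<rho> S"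
      using pressure_superlinear[OF \<gamma>, of "c / c_v \<gamma>" A', where 'd='d] c cv by auto
    define C where "C = c_v \<gamma> / 2 * max C1 C2"
    have scale: "c_v \<gamma> / 2 * (s * S + A' * \<rho> - D) = (c_v \<gamma> / 2 * s) * S + (A + a + b \<bullet> b) * \<rho> - c_v \<gamma> / 2 * D"
      for s S \<rho> D
    proof -
      have "c_v \<gamma> / 2 * A' = A + a + b \<bullet> b" using cv by (simp add: A'_def)
      thus ?thesis by (simp add: right_diff_distrib distrib_left mult.assoc[symmetric])
    qed
    have s1: "c_v \<gamma> / 2 * (2 * c / c_v \<gamma>) = c" and s2: "c_v \<gamma> / 2 * (c / c_v \<gamma>) = c / 2" using cv by auto
    have "kinetic 0 \<rho> m / 4 + c_v \<gamma> / 2 * pressure \<gamma> \<rho> S + A * \<rho> + c / 2 * max 0 (- S) - C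
      \<le> bregman_energy \<gamma> u (\<rho>, m, S)" if v: "(\<rho>, m, S) \<in> energy_domain" for \<rho> m S
    proof -
      have CC: "c_v \<gamma> / 2 * C1 \<le> C" "c_v \<gamma> / 2 * C2 \<le> C"
        using cv by (auto simp: C_def intro!: mult_left_mono)
      have "c_v \<gamma> / 2 * (2 * c / c_v \<gamma> * S + A' * \<rho> - C1) \<le> c_v \<gamma> / 2 * pressure \<gamma> \<rho> S"
        using C1(2)[OF v] cv by (intro mult_left_mono) auto
      hence 1: "c * S + (A + a + b \<bullet> b) * \<rho> - c_v \<gamma> / 2 * C1 \<le> c_v \<gamma> / 2 * pressure \<gamma> \<rho> S"
        unfolding scale s1 s2 by simp
      have "c_v \<gamma> / 2 * (c / c_v \<gamma> * S + A' * \<rho> - C2) \<le> c_v \<gamma> / 2 * pressure \<gamma> \<rho> S"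
        using C2(2)[OF v] cv by (intro mult_left_mono) auto
      hence 2: "c / 2 * S + (A + a + b \<bullet> b) * \<rho> - c_v \<gamma> / 2 * C2 \<le> c_v \<gamma> / 2 * pressure \<gamma> \<rho> S"
        unfolding scale s1 s2 by simp
      have split: "(A + a + b \<bullet> b) * \<rho> = A * \<rho> + (a + b \<bullet> b) * \<rho>" by (simp add: algebra_simps)
      show ?thesis
      proof (cases "S \<ge> 0")
        case True
        thus ?thesis using low[OF v] 1 CC split by simp
      next
        case False
        hence "c / 2 * max 0 (- S) = - (c / 2 * S)" by simp
        thus ?thesis using low[OF v] 2 CC split by linarith
      qed
    qed
    moreover have "C \<ge> 0" using C1(1) cv by (simp add: C_def)
    ultimately show "\<exists>C\<ge>0. \<forall>\<rho> m S. (\<rho>, m, S) \<in> energy_domain \<longrightarrow>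
      kinetic 0 \<rho> m / 4 + c_v \<gamma> / 2 * pressure \<gamma> \<rho> S + A * \<rho> + c / 2 * max 0 (- S) - C
      \<le> bregman_energy \<gamma> u (\<rho>, m, S)" by blast
  qed
qed

text \<open>Since \<open>\<epsilon>\<close> is arbitrary, a bound on the integrals of the relative energy makes densities
equi-integrable.\<close>

lemma density_le_energy:
  fixes u :: "real \<times> (real^'d) \<times> real"
  assumes \<gamma>: "\<gamma> > 1" and u: "fst u > 0" and \<epsilon>: "\<epsilon> > 0"
  shows "\<exists>M\<ge>0. \<forall>v\<in>energy_domain. fst v \<le> M + \<epsilon> * bregman_energy \<gamma> u v"
proof -
  from bregman_energy_growth[OF \<gamma> u] obtain c C where c: "c > 0" "C \<ge> 0"
    "\<And>\<rho> m S. (\<rho>, m, S) \<in> energy_domain \<Longrightarrow>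
    kinetic 0 \<rho> m / 4 + c_v \<gamma> / 2 * pressure \<gamma> \<rho> S + 1/\<epsilon> * \<rho> + c * max 0 (- S) - C
      \<le> bregman_energy \<gamma> u (\<rho>, m, S)" by metis
  have "\<rho> \<le> \<epsilon> * C + \<epsilon> * bregman_energy \<gamma> u (\<rho>, m, S)" if v: "(\<rho>, m, S) \<in> energy_domain" for \<rho> m S
  proof -
    have "0 \<le> c_v \<gamma> / 2 * pressure \<gamma> \<rho> S" using pressure_nonneg[OF v] c_v_pos[OF \<gamma>] by simp
    moreover have "0 \<le> c * max 0 (- S)" using c(1) by simp
    ultimately have "1/\<epsilon> * \<rho> - C \<le> bregman_energy \<gamma> u (\<rho>, m, S)"
      using c(3)[OF v] kinetic_nonneg[OF v] by linarith
    thus ?thesis using \<epsilon> by (simp add: field_simps)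
  qed
  thus ?thesis using c(2) \<epsilon> by (intro exI[of _ "\<epsilon> * C"]) auto
qed

lemma norm_le_energy:
  fixes u :: "real \<times> (real^'d) \<times> real"
  assumes \<gamma>: "\<gamma> > 1" and u: "fst u > 0"
  shows "\<exists>B\<ge>0. \<forall>v\<in>energy_domain. kinetic 0 (fst v) (fst (snd v)) \<le> B * (1 + bregman_energy \<gamma> u v)
     \<and> pressure \<gamma> (fst v) (snd (snd v)) \<le> B * (1 + bregman_energy \<gamma> u v)
     \<and> \<bar>snd (snd v)\<bar> \<le> B * (1 + bregman_energy \<gamma> u v)
     \<and> norm v \<le> B * (1 + bregman_energy \<gamma> u v)"
proof -
  from bregman_energy_growth[OF \<gamma> u] obtain c C where c: "c > 0" "C \<ge> 0"
    "\<And>\<rho> m S. (\<rho>, m, S) \<in> energy_domain \<Longrightarrow>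
    kinetic 0 \<rho> m / 4 + c_v \<gamma> / 2 * pressure \<gamma> \<rho> S + 1 * \<rho> + c * max 0 (- S) - C
      \<le> bregman_energy \<gamma> u (\<rho>, m, S)" by metis
  obtain D where D: "D \<ge> 0" "\<And>\<rho> m S. (\<rho>, m :: real^'d, S) \<in> energy_domain
      \<Longrightarrow> max 0 S \<le> 1 * (1 + pressure \<gamma> \<rho> S) + D * \<rho>"
    using entropy_le_pressure_density[OF \<gamma>, of 1, where 'd='d] by auto
  have cv: "c_v \<gamma> > 0" using \<gamma> by (rule c_v_pos)
  define P where "P = 2 / c_v \<gamma>"
  define B where "B = (4 + 4 + P + 1 + P + D + 1 + 1 / c) * (1 + C)"
  have P: "P > 0" using cv by (simp add: P_def)
  have "kinetic 0 \<rho> m \<le> B * (1 + X) \<and> pressure \<gamma> \<rho> S \<le> B * (1 + X) \<and> \<bar>S\<bar> \<le> B * (1 + X) \<and> norm (\<rho>, m, S) \<le> B * (1 + X)"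
    if v: "(\<rho>, m, S) \<in> energy_domain" and X: "X = bregman_energy \<gamma> u (\<rho>, m, S)" for \<rho> m S X
  proof -
    define Y where "Y = (1 + C) * (1 + X)"
    have X0: "X \<ge> 0" unfolding X by (rule bregman_energy_nonneg[OF \<gamma> u v])
    have Y: "X + C \<le> Y" "1 \<le> Y" using X0 c(2) by (auto simp: Y_def algebra_simps add_nonneg_nonneg)
    have p: "0 \<le> c_v \<gamma> / 2 * pressure \<gamma> \<rho> S" using pressure_nonneg[OF v] cv by simp
    have s: "0 \<le> c * max 0 (- S)" using c(1) by simp
    have k: "0 \<le> kinetic 0 \<rho> m" by (rule kinetic_nonneg[OF v])
    have r: "\<rho> \<ge> 0" using v by (auto simp: energy_domain_def)
    note L = c(3)[OF v, folded X]
    have k': "kinetic 0 \<rho> m \<le> 4 * Y" using L Y p s r k by linarith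
    have r': "\<rho> \<le> Y" using L Y p s r k by linarith
    have "c_v \<gamma> / 2 * pressure \<gamma> \<rho> S \<le> Y" using L Y p s r k by linarith
    hence p': "pressure \<gamma> \<rho> S \<le> P * Y" using cv by (simp add: P_def field_simps)
    have "c * max 0 (- S) \<le> Y" using L Y p s r k by linarith
    moreover have "t \<le> 1 / c * Y" if "c * t \<le> Y" for t using that c(1) by (simp add: field_simps)
    ultimately have s': "max 0 (- S) \<le> 1 / c * Y" by blast
    have "max 0 S \<le> 1 + pressure \<gamma> \<rho> S + D * \<rho>" using D(2)[OF v] by simp
    also have "D * \<rho> \<le> D * Y" using r' D(1) by (rule mult_left_mono)
    finally have s'': "max 0 S \<le> Y + P * Y + D * Y" using p' Y by linarith
    have DY: "0 \<le> D * Y" "0 \<le> P * Y" "0 \<le> 1 / c * Y" using D(1) P c(1) Y by auto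
    have "m \<bullet> sgn m \<le> 1 * kinetic 0 \<rho> m + \<rho> * (sgn m \<bullet> sgn m) / (4 * 1)"
      by (rule inner_le_kinetic[OF v]) simp
    moreover have "m \<bullet> sgn m = norm m" by (cases "m = 0") (simp_all add: sgn_div_norm dot_square_norm power2_eq_square)
    moreover have "sgn m \<bullet> sgn m \<le> 1" by (simp add: dot_square_norm norm_sgn)
    hence "\<rho> * (sgn m \<bullet> sgn m) \<le> \<rho>" using r by (simp add: mult_left_le)
    ultimately have m': "norm m \<le> kinetic 0 \<rho> m + \<rho>" using r by linarith
    have BY: "B * (1 + X) = 4 * Y + 4 * Y + P * Y + Y + P * Y + D * Y + Y + 1 / c * Y"
    proof -
      have "B * (1 + X) = (4 + 4 + P + 1 + P + D + 1 + 1 / c) * Y" by (simp only: B_def Y_def mult.assoc)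
      thus ?thesis by (simp only: distrib_right mult_1_left)
    qed
    have S: "\<bar>S\<bar> \<le> Y + P * Y + D * Y + 1 / c * Y" using s' s'' DY by linarith
    have "norm (\<rho>, m, S) \<le> \<rho> + (norm m + \<bar>S\<bar>)"
      using norm_Pair_le[of \<rho> "(m, S)"] norm_Pair_le[of m S] r by simp
    also have "\<dots> \<le> B * (1 + X)" using m' k' r' S BY Y DY by linarith
    finally show ?thesis using k' p' S BY Y DY by linarith
  qed
  moreover have "B \<ge> 0" using P D(1) c by (simp add: B_def)
  ultimately show ?thesis by (intro exI[of _ B]) auto
qed

text \<open>Momentum and positive entropy are absorbed by the energy up to a multiple of the density. Hence they
inherit equi-integrability from the density, and they vanish wherever the density does
(\<open>young_in_energy_domain\<close>).\<close>

lemma momentum_entropy_le_energy_density: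
  fixes u :: "real \<times> (real^'d) \<times> real"
  assumes \<gamma>: "\<gamma> > 1" and u: "fst u > 0" and \<delta>: "\<delta> > 0"
  shows "\<exists>C\<ge>0. \<forall>v\<in>energy_domain. norm (fst (snd v)) + max 0 (snd (snd v)) \<le> \<delta> * (1 + bregman_energy \<gamma> u v) + C * fst v"
proof -
  obtain B where B: "B \<ge> 0" "\<And>v. v \<in> energy_domain \<Longrightarrow> kinetic 0 (fst v) (fst (snd v)) \<le> B * (1 + bregman_energy \<gamma> u v)"
    "\<And>v. v \<in> energy_domain \<Longrightarrow> pressure \<gamma> (fst v) (snd (snd v)) \<le> B * (1 + bregman_energy \<gamma> u v)"
    using norm_le_energy[OF \<gamma> u] by blast
  define d where "d = \<delta> / (2 * B + 1)"
  have d: "d > 0" using \<delta> B(1) by (simp add: d_def)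
  have "d * (2 * B + 1) = \<delta>" using B(1) by (simp add: d_def)
  hence d\<delta>: "d * B + d * B + d = \<delta>" by (simp add: algebra_simps)
  obtain D where D: "D \<ge> 0" "\<And>\<rho> m S. (\<rho>, m :: real^'d, S) \<in> energy_domain
      \<Longrightarrow> max 0 S \<le> d * (1 + pressure \<gamma> \<rho> S) + D * \<rho>"
    using entropy_le_pressure_density[OF \<gamma> d, where 'd='d] by auto
  have "norm m + max 0 S \<le> \<delta> * (1 + X) + (D + 1 / (4 * d)) * \<rho>"
    if v: "(\<rho>, m, S) \<in> energy_domain" and X: "X = bregman_energy \<gamma> u (\<rho>, m, S)" for \<rho> m S X
  proof -
    have X0: "X \<ge> 0" unfolding X by (rule bregman_energy_nonneg[OF \<gamma> u v])
    have r: "\<rho> \<ge> 0" using v by (auto simp: energy_domain_def)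
    have "m \<bullet> sgn m \<le> d * kinetic 0 \<rho> m + \<rho> * (sgn m \<bullet> sgn m) / (4 * d)"
      by (rule inner_le_kinetic[OF v d])
    moreover have "m \<bullet> sgn m = norm m" by (cases "m = 0") (simp_all add: sgn_div_norm dot_square_norm power2_eq_square)
    moreover have "sgn m \<bullet> sgn m \<le> 1" by (simp add: dot_square_norm norm_sgn)
    hence "\<rho> * (sgn m \<bullet> sgn m) / (4 * d) \<le> \<rho> / (4 * d)" using r d by (intro divide_right_mono) (auto simp: mult_left_le)
    moreover have "d * kinetic 0 \<rho> m \<le> d * (B * (1 + X))"
      using B(2)[OF v] d X by (intro mult_left_mono) auto
    moreover have "d * pressure \<gamma> \<rho> S \<le> d * (B * (1 + X))"
      using B(3)[OF v] d X by (intro mult_left_mono) auto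
    moreover have "d \<le> d * (1 + X)" using d X0 by simp
    moreover have "max 0 S \<le> d + d * pressure \<gamma> \<rho> S + D * \<rho>" using D(2)[OF v] by (simp add: distrib_left)
    ultimately have "norm m + max 0 S \<le> d * (B * (1 + X)) + d * (B * (1 + X)) + d * (1 + X) + D * \<rho> + \<rho> / (4 * d)"
      by linarith
    also have "\<dots> = (d * B + d * B + d) * (1 + X) + D * \<rho> + \<rho> / (4 * d)" by (simp add: algebra_simps)
    finally show ?thesis unfolding d\<delta> by (simp add: algebra_simps)
  qed
  thus ?thesis using D(1) d by (intro exI[of _ "D + 1 / (4 * d)"]) auto
qed

section \<open>Young measures of sequences with bounded energy\<close>

definition cutoff :: "nat \<Rightarrow> 'w::euclidean_space \<Rightarrow> real"
  where "cutoff k v = max 0 (min 1 (real k + 1 - norm v))"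

lemma cutoff_bounds: "0 \<le> cutoff k v" "cutoff k v \<le> 1"
  by (auto simp: cutoff_def)

lemma cutoff_eq_1: "norm v \<le> real k \<Longrightarrow> cutoff k v = 1"
  by (auto simp: cutoff_def)

lemma cutoff_mono: "k \<le> l \<Longrightarrow> cutoff k v \<le> cutoff l v"
  by (auto simp: cutoff_def max_def min_def)

lemma cutoff_eventually: "\<forall>\<^sub>F k in sequentially. cutoff k v = 1"
proof -
  obtain n where "norm v \<le> real n" using real_arch_simple by blast
  thus ?thesis unfolding eventually_sequentially by (intro exI[of _ n]) (auto intro: cutoff_eq_1)
qed

lemma continuous_cutoff [continuous_intros]: "continuous_on A (cutoff k)"
  unfolding cutoff_def by (intro continuous_intros)

text \<open>The form in which coercivity controls the tails: no superlevel set needs to be measured.\<close>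

lemma one_minus_cutoff_le:
  assumes "k > 0" shows "1 - cutoff k v \<le> norm v / real k"
proof (cases "norm v \<le> real k")
  case True thus ?thesis by (simp add: cutoff_eq_1)
next
  case False
  hence "1 \<le> norm v / real k" using assms by simp
  thus ?thesis using cutoff_bounds(1)[of k v] by linarith
qed

lemma Cc_I:
  fixes f :: "'w::euclidean_space \<Rightarrow> real"
  assumes "continuous_on UNIV f" "\<And>v. norm v > r \<Longrightarrow> f v = 0"
  shows "f \<in> Cc"
proof -
  have "{v. f v \<noteq> 0} \<subseteq> cball 0 r" using assms(2) by (auto simp: not_less[symmetric])
  hence "compact (closure {v. f v \<noteq> 0})" using bounded_subset[OF bounded_cball] by (simp add: compact_closure)
  with assms(1) show ?thesis by (simp add: Cc_def)
qed

lemma cutoff_times_Cc: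
  fixes h :: "'w::euclidean_space \<Rightarrow> real"
  assumes "continuous_on UNIV h" shows "(\<lambda>v. cutoff k v * h v) \<in> Cc"
  using assms by (intro Cc_I[where r = "real k + 1"] continuous_intros) (auto simp: cutoff_def)

lemma Cc_continuous: "b \<in> Cc \<Longrightarrow> continuous_on UNIV b"
  by (simp add: Cc_def)

lemma Cc_bounded:
  fixes b :: "'w::euclidean_space \<Rightarrow> real"
  assumes "b \<in> Cc" obtains K where "K \<ge> 0" "\<And>v. \<bar>b v\<bar> \<le> K"
proof -
  let ?S = "closure {v. b v \<noteq> 0}"
  have "compact (b ` ?S)" using assms
    by (intro compact_continuous_image) (auto simp: Cc_def intro: continuous_on_subset)
  hence "bounded (b ` ?S)" by (rule compact_imp_bounded)
  then obtain K where K: "\<And>y. y \<in> b ` ?S \<Longrightarrow> norm y \<le> K"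
    unfolding bounded_iff by blast
  have "\<bar>b v\<bar> \<le> max K 0" for v
  proof (cases "b v = 0")
    case False
    hence "v \<in> ?S" by (intro subsetD[OF closure_subset]) simp
    thus ?thesis using K[of "b v"] by auto
  qed auto
  thus ?thesis using that[of "max K 0"] by auto
qed

lemma Cc_mult:
  fixes b :: "'w::euclidean_space \<Rightarrow> real"
  assumes "b \<in> Cc" "c \<in> Cc" shows "(\<lambda>v. b v * c v) \<in> Cc"
proof -
  have "bounded {v. b v \<noteq> 0}" using assms(1) by (simp add: Cc_def compact_closure)
  hence "bounded {v. b v * c v \<noteq> 0}" by (rule bounded_subset) auto
  hence "compact (closure {v. b v * c v \<noteq> 0})" by (simp add: compact_closure)
  thus ?thesis using assms by (auto simp: Cc_def intro!: continuous_intros)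
qed

lemma Cc_borel: "b \<in> Cc \<Longrightarrow> (b :: 'w::euclidean_space \<Rightarrow> real) \<in> borel_measurable borel"
  by (intro borel_measurable_continuous_onI Cc_continuous)

text \<open>Statements that hold almost everywhere on a set of infinite measure are obtained by testing with a
strictly positive integrable weight.\<close>

lemma positive_weight:
  fixes Q :: "'a::euclidean_space set"
  assumes "Q \<in> sets lebesgue"
  shows "\<exists>g :: 'a \<Rightarrow> real. integrable (lebesgue_on Q) g \<and> (\<forall>z. 0 < g z \<and> g z \<le> 1)"
proof -
  obtain g :: "'a \<Rightarrow> real" where g: "g \<in> borel_measurable lborel" "\<And>x. g x > 0" "\<And>x. g x \<le> 1" "integrable lborel g"
    using sigma_finite_measure.obtain_positive_integrable_function[OF sigma_finite_lborel] by metis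
  have "integrable lebesgue g" using g by (simp add: integrable_completion)
  hence "integrable (lebesgue_on Q) g"
    using assms by (metis integrable_restrict_space integrable_mult_indicator sets.Int_space_eq2)
  thus ?thesis using g by (intro exI[of _ g]) auto
qed

text \<open>A sequence that generates a Young measure, with values in a set \<open>D\<close> on which a function \<open>R\<close> is
nonnegative and coercive, and with bounded integrals of \<open>R\<close>. The function \<open>R\<close> is a Borel function, since the
energy is discontinuous at vacuum.\<close>

locale bounded_young_sequence =
  fixes Q :: "'a::euclidean_space set"
    and Z :: "nat \<Rightarrow> 'a \<Rightarrow> 'w::euclidean_space"
    and V :: "'a \<Rightarrow> 'w measure"
    and D :: "'w set" and R :: "'w \<Rightarrow> real" and C B :: real
  assumes young: "generates_young_measure Q Z V"
    and Q: "Q \<in> sets lebesgue"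
    and dom: "\<And>n. AE z in lebesgue_on Q. Z n z \<in> D"
    and R_nonneg: "\<And>v. v \<in> D \<Longrightarrow> 0 \<le> R v"
    and R_borel: "R \<in> borel_measurable borel"
    and R_bound: "\<And>n. (\<integral>\<^sup>+z. ennreal (R (Z n z)) \<partial>lebesgue_on Q) \<le> ennreal C"
    and C: "0 \<le> C" and B: "0 \<le> B"
    and norm_le: "\<And>v. v \<in> D \<Longrightarrow> norm v \<le> B * (1 + R v)"
begin

abbreviation M :: "'a measure" where "M \<equiv> lebesgue_on Q"

lemma Z_measurable [measurable]: "Z n \<in> borel_measurable M"
  using young by (simp add: generates_young_measure_def)

lemma V_prob: "z \<in> Q \<Longrightarrow> prob_space (V z)" and V_sets: "z \<in> Q \<Longrightarrow> sets (V z) = sets borel"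
  using young by (auto simp: generates_young_measure_def)

lemma V_borel: "z \<in> Q \<Longrightarrow> f \<in> borel_measurable borel \<Longrightarrow> f \<in> borel_measurable (V z)"
  using measurable_cong_sets[OF V_sets refl] by blast

lemma young_Cc_measurable: "b \<in> Cc \<Longrightarrow> (\<lambda>z. LINT w|V z. b w) \<in> borel_measurable M"
  using young by (auto simp: generates_young_measure_def)

lemma young_Cc_limit:
  "b \<in> Cc \<Longrightarrow> integrable M g \<Longrightarrow>
   (\<lambda>n. LINT z|M. b (Z n z) * g z) \<longlonglongrightarrow> (LINT z|M. (LINT w|V z. b w) * g z)"
  using young by (auto simp: generates_young_measure_def)

lemma R_Z_integrable: "integrable M (\<lambda>z. R (Z n z))" and R_Z_integral: "(LINT z|M. R (Z n z)) \<le> C"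
proof -
  have m: "(\<lambda>z. R (Z n z)) \<in> borel_measurable M" using R_borel by measurable
  have nn: "AE z in M. 0 \<le> R (Z n z)" using dom[of n] R_nonneg by auto
  show i: "integrable M (\<lambda>z. R (Z n z))"
    using m nn le_less_trans[OF R_bound[of n] ennreal_less_top] by (intro integrableI_nonneg) auto
  have "ennreal (LINT z|M. R (Z n z)) \<le> ennreal C"
    using R_bound[of n] nn_integral_eq_integral[OF i nn] by simp
  thus "(LINT z|M. R (Z n z)) \<le> C" using C by (simp add: ennreal_le_iff)
qed

text \<open>Weak convergence for integrands that depend on the base point. The limit is a parameter \<open>I\<close>, since the
measurability of the Young averages is given for compactly supported functions only and other averages
are measurable up to modification on a null set.\<close>

definition young_limit :: "('a \<Rightarrow> 'w \<Rightarrow> real) \<Rightarrow> ('a \<Rightarrow> real) \<Rightarrow> bool"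
  where "young_limit f I \<longleftrightarrow>
     (\<forall>n. integrable M (\<lambda>z. f z (Z n z))) \<and>
     (AE z in M. integrable (V z) (f z) \<and> (LINT v|V z. f z v) = I z) \<and>
     integrable M I \<and>
     (\<lambda>n. LINT z|M. f z (Z n z)) \<longlonglongrightarrow> (LINT z|M. I z)"

lemma young_limit_add:
  assumes f: "young_limit f I" and h: "young_limit h J"
  shows "young_limit (\<lambda>z v. f z v + h z v) (\<lambda>z. I z + J z)"
  using assms unfolding young_limit_def
  by (auto intro!: tendsto_add elim!: eventually_elim2)

lemma young_limit_zero: "young_limit (\<lambda>_ _. 0) (\<lambda>_. 0)"
  by (simp add: young_limit_def)

lemma young_limit_sum:
  assumes "\<And>i. i \<in> A \<Longrightarrow> young_limit (f i) (I i)"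
  shows "young_limit (\<lambda>z v. \<Sum>i\<in>A. f i z v) (\<lambda>z. \<Sum>i\<in>A. I i z)"
  using assms
  by (induction A rule: infinite_finite_induct) (auto intro: young_limit_add young_limit_zero)

lemma Cc_V_integrable: "b \<in> Cc \<Longrightarrow> z \<in> Q \<Longrightarrow> integrable (V z) b"
proof -
  assume b: "b \<in> Cc" and z: "z \<in> Q"
  interpret prob_space "V z" using z by (rule V_prob)
  obtain K where "\<And>v. \<bar>b v\<bar> \<le> K" using Cc_bounded[OF b] by metis
  thus ?thesis using V_borel[OF z Cc_borel[OF b]]
    by (intro integrable_const_bound[of _ K]) auto
qed

lemma young_limit_Cc:
  assumes b: "b \<in> Cc" and g: "integrable M g"
  shows "young_limit (\<lambda>z v. g z * b v) (\<lambda>z. g z * (LINT v|V z. b v))"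
proof -
  obtain K where K: "K \<ge> 0" "\<And>v. \<bar>b v\<bar> \<le> K" using Cc_bounded[OF b] by metis
  note [measurable] = Cc_borel[OF b] young_Cc_measurable[OF b] borel_measurable_integrable[OF g]
  have 1: "integrable M (\<lambda>z. g z * b (Z n z))" for n
    using K by (intro Bochner_Integration.integrable_bound[OF integrable_mult_right[OF g, of K]])
      (auto simp: abs_mult mult.commute[of K] intro!: mult_left_mono AE_I2)
  have bd: "\<bar>LINT v|V z. b v\<bar> \<le> K" if z: "z \<in> Q" for z
  proof -
    interpret prob_space "V z" using z by (rule V_prob)
    have "\<bar>LINT v|V z. b v\<bar> \<le> (LINT v|V z. \<bar>b v\<bar>)" by (rule integral_abs_bound)
    also have "\<dots> \<le> (LINT v|V z. K)"
      using K(2) Cc_V_integrable[OF b z] by (intro integral_mono) auto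
    finally show ?thesis by (simp add: prob_space)
  qed
  have 2: "integrable M (\<lambda>z. g z * (LINT v|V z. b v))"
    using K bd by (intro Bochner_Integration.integrable_bound[OF integrable_mult_right[OF g, of K]])
      (auto simp: abs_mult mult.commute[of K] intro!: mult_left_mono AE_I2)
  show ?thesis unfolding young_limit_def
    using 1 2 young_Cc_limit[OF b g] Cc_V_integrable[OF b]
    by (auto simp: mult.commute)
qed

text \<open>Fatou's lemma for Young measures. The truncations of \<open>f\<close> by cutoffs are admissible test functions, are
below \<open>f\<close>, and increase to \<open>f\<close>; so a bound on the integrals along the sequence is inherited by the Young
averages.\<close>

lemma young_nonneg_bound:
  assumes f: "continuous_on UNIV f" "\<And>v. 0 \<le> f v"
    and fR: "\<And>v. v \<in> D \<Longrightarrow> f v \<le> \<alpha> + \<beta> * R v" and \<alpha>\<beta>: "0 \<le> \<alpha>" "0 \<le> \<beta>"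
    and g: "integrable M g" "\<And>z. z \<in> Q \<Longrightarrow> 0 \<le> g z" "\<And>z. z \<in> Q \<Longrightarrow> g z \<le> G" and G: "0 \<le> G"
  shows "(LINT z|M. g z * f (Z n z)) \<le> \<alpha> * (LINT z|M. g z) + \<beta> * G * C"
    and "integrable M (\<lambda>z. g z * f (Z n z))"
    and "(\<integral>\<^sup>+z. ennreal (g z) * (\<integral>\<^sup>+v. ennreal (f v) \<partial>V z) \<partial>M) \<le> ennreal (\<alpha> * (LINT z|M. g z) + \<beta> * G * C)"
    and "(\<lambda>z. \<integral>\<^sup>+v. ennreal (f v) \<partial>V z) \<in> borel_measurable M"
proof -
  let ?X = "\<alpha> * (LINT z|M. g z) + \<beta> * G * C"
  have fb [measurable]: "f \<in> borel_measurable borel" using f(1) by (rule borel_measurable_continuous_onI)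
  have [measurable]: "g \<in> borel_measurable M" using g(1) by simp
  have gf: "AE z in M. g z * f (Z n z) \<le> \<alpha> * g z + \<beta> * G * R (Z n z)" for n
    using dom[of n]
  proof (rule AE_mp, intro AE_I2 impI)
    fix z assume z: "z \<in> space M" "Z n z \<in> D"
    have "g z * f (Z n z) \<le> g z * (\<alpha> + \<beta> * R (Z n z))"
      using fR[OF z(2)] g(2) z by (intro mult_left_mono) auto
    also have "\<dots> = \<alpha> * g z + g z * (\<beta> * R (Z n z))" by (simp add: algebra_simps)
    also have "g z * (\<beta> * R (Z n z)) \<le> G * (\<beta> * R (Z n z))"
      using g(3) z R_nonneg[OF z(2)] \<alpha>\<beta> by (intro mult_right_mono) auto
    finally show "g z * f (Z n z) \<le> \<alpha> * g z + \<beta> * G * R (Z n z)" by (simp add: mult_ac)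
  qed
  have int: "integrable M (\<lambda>z. g z * f (Z n z))" for n
  proof (rule Bochner_Integration.integrable_bound)
    show "integrable M (\<lambda>z. \<alpha> * g z + \<beta> * G * R (Z n z))" using g(1) R_Z_integrable by auto
    show "AE z in M. norm (g z * f (Z n z)) \<le> norm (\<alpha> * g z + \<beta> * G * R (Z n z))"
      using gf[of n] AE_space by eventually_elim (use g(2) f(2) in \<open>auto simp: abs_mult\<close>)
  qed auto
  show "integrable M (\<lambda>z. g z * f (Z n z))" by (rule int)
  have le: "(LINT z|M. g z * f (Z n z)) \<le> ?X" for n
  proof -
    have "(LINT z|M. g z * f (Z n z)) \<le> (LINT z|M. \<alpha> * g z + \<beta> * G * R (Z n z))"
      using gf int g(1) R_Z_integrable by (intro integral_mono_AE) auto
    also have "\<dots> = \<alpha> * (LINT z|M. g z) + \<beta> * G * (LINT z|M. R (Z n z))"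
      using g(1) R_Z_integrable by simp
    also have "\<dots> \<le> ?X" using R_Z_integral \<alpha>\<beta> G by (intro add_left_mono mult_left_mono) auto
    finally show ?thesis .
  qed
  show "(LINT z|M. g z * f (Z n z)) \<le> ?X" by (rule le)
  define F where "F k = (\<lambda>v. cutoff k v * f v)" for k
  have F: "F k \<in> Cc" "F k v \<ge> 0" "F k v \<le> f v" for k v
    unfolding F_def using f(2)[of v] cutoff_bounds[of k v]
    by (auto intro: cutoff_times_Cc f mult_left_le_one_le)
  have nnV: "(\<integral>\<^sup>+v. ennreal (F k v) \<partial>V z) = ennreal (LINT v|V z. F k v)" if "z \<in> Q" for k z
    using Cc_V_integrable[OF F(1) that] F(2) by (intro nn_integral_eq_integral) auto
  have lim: "(\<integral>\<^sup>+v. ennreal (f v) \<partial>V z) = (SUP k. \<integral>\<^sup>+v. ennreal (F k v) \<partial>V z)" if z: "z \<in> Q" for z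
  proof -
    have "(SUP k. ennreal (F k v)) = ennreal (f v)" for v
    proof (rule antisym)
      show "(SUP k. ennreal (F k v)) \<le> ennreal (f v)" using F(3) by (auto intro!: SUP_least ennreal_leI)
      obtain k where "cutoff k v = 1" using eventually_happens[OF cutoff_eventually] by auto
      hence "ennreal (f v) = ennreal (F k v)" by (simp add: F_def)
      thus "ennreal (f v) \<le> (SUP k. ennreal (F k v))" by (metis SUP_upper UNIV_I)
    qed
    hence "(\<integral>\<^sup>+v. ennreal (f v) \<partial>V z) = (\<integral>\<^sup>+v. (SUP k. ennreal (F k v)) \<partial>V z)" by simp
    also have "\<dots> = (SUP k. \<integral>\<^sup>+v. ennreal (F k v) \<partial>V z)"
    proof (rule nn_integral_monotone_convergence_SUP)
      show "incseq (\<lambda>k v. ennreal (F k v))"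
        by (auto simp: incseq_def le_fun_def F_def intro!: ennreal_leI mult_right_mono cutoff_mono f)
      show "(\<lambda>v. ennreal (F k v)) \<in> borel_measurable (V z)" for k
        using V_borel[OF z Cc_borel[OF F(1)]] by simp
    qed
    finally show ?thesis .
  qed
  have meas: "(\<lambda>z. \<integral>\<^sup>+v. ennreal (F k v) \<partial>V z) \<in> borel_measurable M" for k
  proof -
    have "(\<lambda>z. ennreal (LINT v|V z. F k v)) \<in> borel_measurable M"
      using young_Cc_measurable[OF F(1)] by simp
    thus ?thesis by (subst measurable_cong[OF nnV]) auto
  qed
  show mf: "(\<lambda>z. \<integral>\<^sup>+v. ennreal (f v) \<partial>V z) \<in> borel_measurable M"
    by (subst measurable_cong[OF lim]) (auto intro: borel_measurable_SUP meas)
  have nnF: "(\<integral>\<^sup>+z. ennreal (g z) * (\<integral>\<^sup>+v. ennreal (F k v) \<partial>V z) \<partial>M) \<le> ennreal ?X" for k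
  proof -
    note yl = young_limit_Cc[OF F(1) g(1), of k, unfolded young_limit_def]
    have nn: "0 \<le> g z * (LINT v|V z. F k v)" if "z \<in> Q" for z
      using g(2) that F(2) by (intro mult_nonneg_nonneg integral_nonneg) auto
    have "(LINT z|M. g z * (LINT v|V z. F k v)) \<le> ?X"
    proof (rule LIMSEQ_le_const2)
      show "(\<lambda>n. LINT z|M. g z * F k (Z n z)) \<longlonglongrightarrow> (LINT z|M. g z * (LINT v|V z. F k v))" using yl by auto
      show "\<exists>N. \<forall>n\<ge>N. (LINT z|M. g z * F k (Z n z)) \<le> ?X"
      proof (intro exI allI impI)
        fix n
        have "(LINT z|M. g z * F k (Z n z)) \<le> (LINT z|M. g z * f (Z n z))"
          using yl int g(2) F(3) by (intro integral_mono mult_left_mono) auto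
        also note le
        finally show "(LINT z|M. g z * F k (Z n z)) \<le> ?X" .
      qed
    qed
    moreover have "(\<integral>\<^sup>+z. ennreal (g z) * (\<integral>\<^sup>+v. ennreal (F k v) \<partial>V z) \<partial>M)
        = (\<integral>\<^sup>+z. ennreal (g z * (LINT v|V z. F k v)) \<partial>M)"
      by (rule nn_integral_cong) (use nnV g(2) in \<open>auto simp: ennreal_mult'\<close>)
    moreover have "\<dots> = ennreal (LINT z|M. g z * (LINT v|V z. F k v))"
      using yl nn by (intro nn_integral_eq_integral AE_I2) auto
    ultimately show ?thesis by (simp add: ennreal_leI)
  qed
  have "(\<integral>\<^sup>+z. ennreal (g z) * (\<integral>\<^sup>+v. ennreal (f v) \<partial>V z) \<partial>M)
      = (\<integral>\<^sup>+z. (SUP k. ennreal (g z) * (\<integral>\<^sup>+v. ennreal (F k v) \<partial>V z)) \<partial>M)"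
    by (rule nn_integral_cong) (simp add: lim SUP_mult_left_ennreal)
  also have "\<dots> = (SUP k. \<integral>\<^sup>+z. ennreal (g z) * (\<integral>\<^sup>+v. ennreal (F k v) \<partial>V z) \<partial>M)"
  proof (rule nn_integral_monotone_convergence_SUP)
    show "incseq (\<lambda>k z. ennreal (g z) * (\<integral>\<^sup>+v. ennreal (F k v) \<partial>V z))"
      by (auto simp: incseq_def le_fun_def F_def intro!: mult_left_mono nn_integral_mono ennreal_leI mult_right_mono cutoff_mono f)
    show "(\<lambda>z. ennreal (g z) * (\<integral>\<^sup>+v. ennreal (F k v) \<partial>V z)) \<in> borel_measurable M" for k
      using meas by simp
  qed
  also have "\<dots> \<le> ennreal ?X" by (rule SUP_least) (rule nnF)
  finally show "(\<integral>\<^sup>+z. ennreal (g z) * (\<integral>\<^sup>+v. ennreal (f v) \<partial>V z) \<partial>M) \<le> ennreal ?X" .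
qed

lemma young_AE_finite:
  assumes f: "continuous_on UNIV f" "\<And>v. 0 \<le> f v"
    and fR: "\<And>v. v \<in> D \<Longrightarrow> f v \<le> \<alpha> + \<beta> * R v" and \<alpha>\<beta>: "0 \<le> \<alpha>" "0 \<le> \<beta>"
  shows "AE z in M. integrable (V z) f"
proof -
  obtain g :: "'a \<Rightarrow> real" where g': "integrable M g \<and> (\<forall>z. 0 < g z \<and> g z \<le> 1)" using positive_weight[OF Q] ..
  have g: "integrable M g" "\<And>z. 0 < g z" "\<And>z. g z \<le> 1" using g' by auto
  note b = young_nonneg_bound(3)[OF f fR \<alpha>\<beta> g(1) less_imp_le[OF g(2)] g(3) zero_le_one]
  have "AE z in M. ennreal (g z) * (\<integral>\<^sup>+v. ennreal (f v) \<partial>V z) \<noteq> \<infinity>"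
  proof (rule nn_integral_PInf_AE)
    have [measurable]: "g \<in> borel_measurable M" using g(1) by simp
    show "(\<lambda>z. ennreal (g z) * (\<integral>\<^sup>+v. ennreal (f v) \<partial>V z)) \<in> borel_measurable M"
      using young_nonneg_bound(4)[OF f fR \<alpha>\<beta> g(1) less_imp_le[OF g(2)] g(3) zero_le_one] by simp
    show "(\<integral>\<^sup>+z. ennreal (g z) * (\<integral>\<^sup>+v. ennreal (f v) \<partial>V z) \<partial>M) \<noteq> \<infinity>"
      using b by (auto simp: top_unique)
  qed
  thus ?thesis
  proof (rule AE_mp, intro AE_I2 impI)
    fix z assume z: "z \<in> space M" "ennreal (g z) * (\<integral>\<^sup>+v. ennreal (f v) \<partial>V z) \<noteq> \<infinity>"
    have "(\<integral>\<^sup>+v. ennreal (f v) \<partial>V z) < \<infinity>"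
      using z(2) g(2)[of z] by (auto simp: ennreal_mult_eq_top_iff top.not_eq_extremum)
    thus "integrable (V z) f"
      using V_borel[OF _ borel_measurable_continuous_onI[OF f(1)], of z] z(1) f(2) by (intro integrableI_nonneg) auto
  qed
qed

text \<open>The part of \<open>h\<close> dominated by \<open>K\<close> is small in the tail by coercivity; the rest is dominated by \<open>\<epsilon> R\<close>
anyway.\<close>

lemma cutoff_tail:
  assumes hR: "\<bar>h v\<bar> \<le> K + \<epsilon> * R v" and v: "v \<in> D" and k: "k > 0" and K: "0 \<le> K" "0 \<le> \<epsilon>"
  shows "(1 - cutoff k v) * \<bar>h v\<bar> \<le> K * B / real k + (K * B / real k + \<epsilon>) * R v"
proof -
  have R: "0 \<le> R v" by (rule R_nonneg[OF v])
  have c: "0 \<le> 1 - cutoff k v" "1 - cutoff k v \<le> 1" using cutoff_bounds[of k v] by auto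
  have "1 - cutoff k v \<le> norm v / real k" by (rule one_minus_cutoff_le[OF k])
  also have "\<dots> \<le> B * (1 + R v) / real k" using norm_le[OF v] by (rule divide_right_mono) simp
  finally have 1: "K * (1 - cutoff k v) \<le> K * (B * (1 + R v) / real k)" using K by (intro mult_left_mono)
  have "(1 - cutoff k v) * \<bar>h v\<bar> \<le> (1 - cutoff k v) * (K + \<epsilon> * R v)"
    using hR c by (intro mult_left_mono)
  also have "\<dots> = K * (1 - cutoff k v) + (1 - cutoff k v) * (\<epsilon> * R v)" by (simp add: algebra_simps)
  also have "(1 - cutoff k v) * (\<epsilon> * R v) \<le> 1 * (\<epsilon> * R v)"
    using c K R by (intro mult_right_mono) auto
  finally have "(1 - cutoff k v) * \<bar>h v\<bar> \<le> K * (B * (1 + R v) / real k) + \<epsilon> * R v" using 1 by simp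
  also have "\<dots> = K * B / real k + (K * B / real k + \<epsilon>) * R v" by (simp add: algebra_simps add_divide_distrib)
  finally show ?thesis .
qed

text \<open>For a sequence with bounded integrals of \<open>R\<close> and values in \<open>D\<close> this implies equi-integrability of the
compositions with \<open>h\<close>; the pointwise form avoids any reference to the sequence.\<close>

definition equi_integrable :: "('w \<Rightarrow> real) \<Rightarrow> bool"
  where "equi_integrable h \<longleftrightarrow> continuous_on UNIV h \<and> (\<forall>\<epsilon>>0. \<exists>K\<ge>0. \<forall>v\<in>D. \<bar>h v\<bar> \<le> K + \<epsilon> * R v)"

text \<open>One cutoff serves all members of the sequence and the Young measure.\<close>

lemma uniform_tail:
  assumes h: "equi_integrable h"
    and g: "integrable M g" "\<And>z. z \<in> Q \<Longrightarrow> 0 \<le> g z" "\<And>z. z \<in> Q \<Longrightarrow> g z \<le> G" and G: "0 \<le> G"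
    and \<eta>: "\<eta> > 0"
  obtains k where "\<And>n. (LINT z|M. g z * ((1 - cutoff k (Z n z)) * \<bar>h (Z n z)\<bar>)) \<le> \<eta>"
    and "(\<integral>\<^sup>+z. ennreal (g z) * (\<integral>\<^sup>+v. ennreal ((1 - cutoff k v) * \<bar>h v\<bar>) \<partial>V z) \<partial>M) \<le> ennreal \<eta>"
proof -
  \<comment> \<open>The tail estimate below is \<open>X / k + \<epsilon> G C\<close>; each of the two terms is made at most \<open>\<eta> / 2\<close>.\<close>
  define \<epsilon> where "\<epsilon> = \<eta> / (2 * (G * C + 1))"
  have GC: "0 \<le> G * C" using G C by simp
  have \<epsilon>: "\<epsilon> > 0" using \<eta> GC by (simp add: \<epsilon>_def)
  obtain K where K: "K \<ge> 0" "\<And>v. v \<in> D \<Longrightarrow> \<bar>h v\<bar> \<le> K + \<epsilon> * R v"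
    using h \<epsilon> unfolding equi_integrable_def by blast
  define g0 where "g0 = (LINT z|M. g z)"
  define X where "X = K * B * (g0 + G * C)"
  have g0: "g0 \<ge> 0" unfolding g0_def using g(2) by (intro integral_nonneg_AE) auto
  have X: "X \<ge> 0" using K(1) B g0 GC by (simp add: X_def)
  obtain k :: nat where k: "real k > 2 * X / \<eta> + 1" using reals_Archimedean2 by blast
  have "2 * X / \<eta> \<ge> 0" using X \<eta> by simp
  hence k0: "k > 0" using k by (cases k) (auto simp: add_nonneg_pos not_less)
  have kX: "X / real k \<le> \<eta> / 2"
  proof -
    have "2 * X / \<eta> \<le> real k" using k by simp
    thus ?thesis using \<eta> k0 by (simp add: field_simps)
  qed
  let ?f = "\<lambda>v. (1 - cutoff k v) * \<bar>h v\<bar>"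
  have f: "continuous_on UNIV ?f" using h by (auto simp: equi_integrable_def intro!: continuous_intros)
  have f0: "0 \<le> ?f v" for v using cutoff_bounds[of k v] by simp
  have fR: "?f v \<le> K * B / real k + (K * B / real k + \<epsilon>) * R v" if "v \<in> D" for v
    using cutoff_tail[of h v K \<epsilon> k, OF K(2)[OF that] that k0 K(1)] \<epsilon> by simp
  have n1: "0 \<le> K * B / real k" "0 \<le> K * B / real k + \<epsilon>" using K(1) B \<epsilon> by auto
  have "K * B / real k * g0 + (K * B / real k + \<epsilon>) * G * C = X / real k + \<epsilon> * (G * C)"
    by (simp add: X_def algebra_simps add_divide_distrib)
  also have "\<epsilon> * (G * C) \<le> \<eta> / 2" using GC \<eta> by (simp add: \<epsilon>_def field_simps)
  finally have le: "K * B / real k * g0 + (K * B / real k + \<epsilon>) * G * C \<le> \<eta>" using kX by linarith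
  note nb = young_nonneg_bound[OF f f0 fR n1 g G, folded g0_def]
  show ?thesis
    using nb(1) nb(3) le by (intro that[of k]) (auto intro: order_trans ennreal_leI)
qed

lemma equi_integrable_AE:
  assumes h: "equi_integrable h" shows "AE z in M. integrable (V z) h"
proof -
  obtain K where K: "K \<ge> 0" "\<And>v. v \<in> D \<Longrightarrow> \<bar>h v\<bar> \<le> K + 1 * R v"
    using h zero_less_one unfolding equi_integrable_def by blast
  have hb: "h \<in> borel_measurable borel"
    using h by (auto simp: equi_integrable_def intro: borel_measurable_continuous_onI)
  have "AE z in M. integrable (V z) (\<lambda>v. \<bar>h v\<bar>)"
    using h K by (intro young_AE_finite[of _ K 1]) (auto simp: equi_integrable_def intro!: continuous_intros)
  thus ?thesis
  proof (rule AE_mp, intro AE_I2 impI)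
    fix z assume z: "z \<in> space M" and i: "integrable (V z) (\<lambda>v. \<bar>h v\<bar>)"
    have "h \<in> borel_measurable (V z)" using V_borel[OF _ hb] z by simp
    thus "integrable (V z) h" using i integrable_abs_iff by blast
  qed
qed

text \<open>Truncation reduces to compactly supported functions, at a cost that is uniform along the sequence.\<close>

lemma young_limit_equi:
  assumes h: "equi_integrable h"
    and g: "integrable M g" "\<And>z. z \<in> Q \<Longrightarrow> \<bar>g z\<bar> \<le> G" and G: "0 \<le> G"
  obtains I where "young_limit (\<lambda>z v. g z * h v) I"
proof -
  have hc: "continuous_on UNIV h" using h by (simp add: equi_integrable_def)
  have hb [measurable]: "h \<in> borel_measurable borel" using hc by (rule borel_measurable_continuous_onI)
  have gm [measurable]: "g \<in> borel_measurable M" using g(1) by simp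
  have ga: "integrable M (\<lambda>z. \<bar>g z\<bar>)" using g(1) by simp
  obtain K where K: "K \<ge> 0" "\<And>v. v \<in> D \<Longrightarrow> \<bar>h v\<bar> \<le> K + 1 * R v"
    using h zero_less_one unfolding equi_integrable_def by blast
  have ha: "continuous_on UNIV (\<lambda>v. \<bar>h v\<bar>)" using hc by (intro continuous_intros)
  note nb = young_nonneg_bound[OF ha abs_ge_zero K(2) K(1) zero_le_one ga abs_ge_zero g(2) G]
  have Vi: "AE z in M. integrable (V z) h" by (rule equi_integrable_AE[OF h])
  have i1: "integrable M (\<lambda>z. g z * h (Z n z))" for n
    by (rule Bochner_Integration.integrable_bound[OF nb(2)[of n]]) (auto simp: abs_mult)
  define F where "F k = (\<lambda>v. cutoff k v * h v)" for k
  have F: "F k \<in> Cc" for k unfolding F_def by (rule cutoff_times_Cc[OF hc])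

  define L where "L z = lim (\<lambda>k. LINT v|V z. F k v)" for z
  have Lm [measurable]: "L \<in> borel_measurable M"
    unfolding L_def using young_Cc_measurable[OF F] by (rule borel_measurable_lim_metric)
  have L: "AE z in M. integrable (V z) h \<and> (LINT v|V z. h v) = L z"
    using Vi
  proof (rule AE_mp, intro AE_I2 impI)
    fix z assume z: "z \<in> space M" and i: "integrable (V z) h"
    have "(\<lambda>k. LINT v|V z. F k v) \<longlonglongrightarrow> (LINT v|V z. h v)"
    proof (rule integral_dominated_convergence[where w = "\<lambda>v. \<bar>h v\<bar>"])
      show "AE v in V z. (\<lambda>k. F k v) \<longlonglongrightarrow> h v"
      proof (rule AE_I2)
        fix v show "(\<lambda>k. F k v) \<longlonglongrightarrow> h v"
          by (rule tendsto_eventually) (use cutoff_eventually[of v] in \<open>auto simp: F_def elim: eventually_mono\<close>)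
      qed
      show "AE v in V z. norm (F k v) \<le> \<bar>h v\<bar>" for k
        by (intro AE_I2) (simp add: F_def abs_mult abs_of_nonneg[OF cutoff_bounds(1)] mult_left_le_one_le cutoff_bounds)
    qed (use i V_borel[of z] z Cc_borel[OF F] in auto)
    thus "integrable (V z) h \<and> (LINT v|V z. h v) = L z" using i by (auto simp: L_def limI)
  qed
  have AE2: "AE z in M. integrable (V z) (\<lambda>v. g z * h v) \<and> (LINT v|V z. g z * h v) = g z * L z"
    using L by eventually_elim auto
  have nnL: "AE z in M. ennreal \<bar>g z * L z\<bar> \<le> ennreal \<bar>g z\<bar> * (\<integral>\<^sup>+v. ennreal \<bar>h v\<bar> \<partial>V z)"
    using L
  proof eventually_elim
    fix z assume z: "integrable (V z) h \<and> (LINT v|V z. h v) = L z"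
    hence "ennreal \<bar>L z\<bar> \<le> (\<integral>\<^sup>+v. ennreal \<bar>h v\<bar> \<partial>V z)"
      using integral_norm_bound_ennreal[of "V z" h] by auto
    thus "ennreal \<bar>g z * L z\<bar> \<le> ennreal \<bar>g z\<bar> * (\<integral>\<^sup>+v. ennreal \<bar>h v\<bar> \<partial>V z)"
      by (simp add: abs_mult ennreal_mult mult_left_mono)
  qed
  have i2: "integrable M (\<lambda>z. g z * L z)"
  proof (rule integrableI_bounded)
    have "(\<integral>\<^sup>+z. ennreal (norm (g z * L z)) \<partial>M) \<le> (\<integral>\<^sup>+z. ennreal \<bar>g z\<bar> * (\<integral>\<^sup>+v. ennreal \<bar>h v\<bar> \<partial>V z) \<partial>M)"
      using nnL by (intro nn_integral_mono_AE) auto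
    also note nb(3)
    finally show "(\<integral>\<^sup>+z. ennreal (norm (g z * L z)) \<partial>M) < \<infinity>" using ennreal_less_top le_less_trans by fastforce
  qed simp
  have "(\<lambda>n. LINT z|M. g z * h (Z n z)) \<longlonglongrightarrow> (LINT z|M. g z * L z)"
  proof (rule LIMSEQ_I)
    fix e :: real assume e: "e > 0"
    define \<eta> where "\<eta> = e / 4"
    have \<eta>: "\<eta> > 0" using e by (simp add: \<eta>_def)
    obtain k where k: "\<And>n. (LINT z|M. \<bar>g z\<bar> * ((1 - cutoff k (Z n z)) * \<bar>h (Z n z)\<bar>)) \<le> \<eta>"
      "(\<integral>\<^sup>+z. ennreal \<bar>g z\<bar> * (\<integral>\<^sup>+v. ennreal ((1 - cutoff k v) * \<bar>h v\<bar>) \<partial>V z) \<partial>M) \<le> ennreal \<eta>"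
      using uniform_tail[OF h ga abs_ge_zero g(2) G \<eta>] by blast
    note yl = young_limit_Cc[OF F[of k] g(1), unfolded young_limit_def]
    have iF: "integrable M (\<lambda>z. g z * F k (Z n z))" for n using yl by auto
    have iFV: "integrable M (\<lambda>z. g z * (LINT v|V z. F k v))" using yl by auto
    have d1: "\<bar>(LINT z|M. g z * h (Z n z)) - (LINT z|M. g z * F k (Z n z))\<bar> \<le> \<eta>" for n
    proof -
      have "(LINT z|M. g z * h (Z n z)) - (LINT z|M. g z * F k (Z n z)) = (LINT z|M. g z * h (Z n z) - g z * F k (Z n z))"
        using i1 iF by simp
      also have "\<bar>\<dots>\<bar> \<le> (LINT z|M. \<bar>g z * h (Z n z) - g z * F k (Z n z)\<bar>)" by (rule integral_abs_bound)
      also have "\<dots> = (LINT z|M. \<bar>g z\<bar> * ((1 - cutoff k (Z n z)) * \<bar>h (Z n z)\<bar>))"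
      proof (rule Bochner_Integration.integral_cong[OF refl])
        fix z
        have "g z * h (Z n z) - g z * F k (Z n z) = g z * ((1 - cutoff k (Z n z)) * h (Z n z))"
          by (simp add: F_def algebra_simps)
        thus "\<bar>g z * h (Z n z) - g z * F k (Z n z)\<bar> = \<bar>g z\<bar> * ((1 - cutoff k (Z n z)) * \<bar>h (Z n z)\<bar>)"
          using cutoff_bounds[of k "Z n z"] by (simp add: abs_mult)
      qed
      also note k(1)
      finally show ?thesis .
    qed
    have d2: "\<bar>(LINT z|M. g z * (LINT v|V z. F k v)) - (LINT z|M. g z * L z)\<bar> \<le> \<eta>"
    proof -
      have "AE z in M. ennreal \<bar>g z * (LINT v|V z. F k v) - g z * L z\<bar>
          \<le> ennreal \<bar>g z\<bar> * (\<integral>\<^sup>+v. ennreal ((1 - cutoff k v) * \<bar>h v\<bar>) \<partial>V z)"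
        using L
      proof (rule AE_mp, intro AE_I2 impI)
        fix z assume z: "z \<in> space M" and i: "integrable (V z) h \<and> (LINT v|V z. h v) = L z"
        have iFz: "integrable (V z) (F k)" using Cc_V_integrable[OF F] z by simp
        have "(LINT v|V z. F k v) - L z = (LINT v|V z. F k v - h v)" using i iFz by simp
        hence "ennreal \<bar>(LINT v|V z. F k v) - L z\<bar> \<le> (\<integral>\<^sup>+v. ennreal \<bar>F k v - h v\<bar> \<partial>V z)"
          using integral_norm_bound_ennreal[of "V z" "\<lambda>v. F k v - h v"] i iFz by auto
        also have "\<dots> = (\<integral>\<^sup>+v. ennreal ((1 - cutoff k v) * \<bar>h v\<bar>) \<partial>V z)"
        proof (rule nn_integral_cong)
          fix v
          have "F k v - h v = - ((1 - cutoff k v) * h v)" by (simp add: F_def algebra_simps)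
          thus "ennreal \<bar>F k v - h v\<bar> = ennreal ((1 - cutoff k v) * \<bar>h v\<bar>)"
            using cutoff_bounds[of k v] by (simp add: abs_mult)
        qed
        finally have "ennreal \<bar>g z\<bar> * ennreal \<bar>(LINT v|V z. F k v) - L z\<bar>
            \<le> ennreal \<bar>g z\<bar> * (\<integral>\<^sup>+v. ennreal ((1 - cutoff k v) * \<bar>h v\<bar>) \<partial>V z)" by (rule mult_left_mono) simp
        moreover have "g z * (LINT v|V z. F k v) - g z * L z = g z * ((LINT v|V z. F k v) - L z)" by (simp add: algebra_simps)
        ultimately show "ennreal \<bar>g z * (LINT v|V z. F k v) - g z * L z\<bar>
          \<le> ennreal \<bar>g z\<bar> * (\<integral>\<^sup>+v. ennreal ((1 - cutoff k v) * \<bar>h v\<bar>) \<partial>V z)"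
          by (simp add: abs_mult ennreal_mult)
      qed
      from nn_integral_mono_AE[OF this] k(2)
      have "(\<integral>\<^sup>+z. ennreal \<bar>g z * (LINT v|V z. F k v) - g z * L z\<bar> \<partial>M) \<le> ennreal \<eta>"
        by (rule order_trans)
      moreover have "ennreal \<bar>LINT z|M. g z * (LINT v|V z. F k v) - g z * L z\<bar>
        \<le> (\<integral>\<^sup>+z. ennreal \<bar>g z * (LINT v|V z. F k v) - g z * L z\<bar> \<partial>M)"
        using integral_norm_bound_ennreal[of M "\<lambda>z. g z * (LINT v|V z. F k v) - g z * L z"] iFV i2 by auto
      ultimately have "ennreal \<bar>LINT z|M. g z * (LINT v|V z. F k v) - g z * L z\<bar> \<le> ennreal \<eta>" by order
      hence "\<bar>LINT z|M. g z * (LINT v|V z. F k v) - g z * L z\<bar> \<le> \<eta>" using \<eta> by (simp add: ennreal_le_iff)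
      thus ?thesis using iFV i2 by simp
    qed
    have "(\<lambda>n. LINT z|M. g z * F k (Z n z)) \<longlonglongrightarrow> (LINT z|M. g z * (LINT v|V z. F k v))" using yl by auto
    from LIMSEQ_D[OF this \<eta>] obtain N where N: "\<And>n. n \<ge> N \<Longrightarrow>
      norm ((LINT z|M. g z * F k (Z n z)) - (LINT z|M. g z * (LINT v|V z. F k v))) < \<eta>" by blast
    show "\<exists>no. \<forall>n\<ge>no. norm ((LINT z|M. g z * h (Z n z)) - (LINT z|M. g z * L z)) < e"
    proof (intro exI allI impI)
      fix n assume n: "n \<ge> N"
      show "norm ((LINT z|M. g z * h (Z n z)) - (LINT z|M. g z * L z)) < e"
        using d1[of n] d2 N[OF n] \<eta> unfolding \<eta>_def real_norm_def by linarith
    qed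
  qed
  hence "young_limit (\<lambda>z v. g z * h v) (\<lambda>z. g z * L z)"
    unfolding young_limit_def using i1 i2 AE2 by auto
  thus ?thesis by (rule that)
qed

text \<open>Expand the square of \<open>b (Z n z) - b (U z)\<close>. The square of \<open>b\<close> is again a test function, and \<open>b (U z)\<close>
can be put into the weight; so all three terms converge, and they cancel if the Young measure is a Dirac
mass. This gives convergence in \<open>L\<^sup>2\<close>, hence in \<open>L\<^sup>1\<close> with an integrable weight.\<close>

lemma dirac_Cc:
  assumes U: "U \<in> borel_measurable M" and dirac: "AE z in M. AE v in V z. v = U z"
    and g: "integrable M g" "\<And>z. z \<in> Q \<Longrightarrow> 0 \<le> g z" and b: "b \<in> Cc"
  shows "(\<lambda>n. LINT z|M. g z * \<bar>b (Z n z) - b (U z)\<bar>) \<longlonglongrightarrow> 0"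
    and "integrable M (\<lambda>z. g z * \<bar>b (Z n z) - b (U z)\<bar>)"
proof -
  obtain K where K: "K \<ge> 0" "\<And>v. \<bar>b v\<bar> \<le> K" using Cc_bounded[OF b] by metis
  note [measurable] = Cc_borel[OF b] U borel_measurable_integrable[OF g(1)]
  have Vc: "AE z in M. (LINT v|V z. c v) = c (U z)" if c: "c \<in> Cc" for c
    using dirac
  proof (rule AE_mp, intro AE_I2 impI)
    fix z assume z: "z \<in> space M" and d: "AE v in V z. v = U z"
    interpret prob_space "V z" using z V_prob by simp
    have "(LINT v|V z. c v) = (LINT v|V z. c (U z))"
      using d V_borel[OF _ Cc_borel[OF c]] z by (intro integral_cong_AE) auto
    thus "(LINT v|V z. c v) = c (U z)" by (simp add: prob_space)
  qed
  have bnd: "integrable M (\<lambda>z. g z * f z)" if f: "f \<in> borel_measurable M" "\<And>z. \<bar>f z\<bar> \<le> L" "0 \<le> L" for f and L :: real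
    using that by (intro Bochner_Integration.integrable_bound[OF integrable_mult_right[OF g(1), of L]])
      (auto simp: abs_mult mult.commute[of L] intro!: mult_left_mono AE_I2)
  have KK: "\<bar>b u * b v\<bar> \<le> K * K" for u v using K by (simp add: abs_mult mult_mono)
  have gb: "integrable M (\<lambda>z. g z * b (U z))" using K by (intro bnd[of _ K]) auto
  have gbb: "integrable M (\<lambda>z. g z * (b (U z) * b (U z)))" using K
    by (intro bnd[of _ "K * K"] KK) auto
  have ib: "integrable M (\<lambda>z. g z * b (U z) * b (Z n z))" for n
    using bnd[of "\<lambda>z. b (U z) * b (Z n z)" "K * K"] K KK by (auto simp: mult.assoc)
  have ibb: "integrable M (\<lambda>z. g z * (b (Z n z) * b (Z n z)))" for n
    using K by (intro bnd[of _ "K * K"] KK) auto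
  have l1: "(\<lambda>n. LINT z|M. g z * (b (Z n z) * b (Z n z))) \<longlonglongrightarrow> (LINT z|M. g z * (b (U z) * b (U z)))"
  proof -
    have "(\<lambda>n. LINT z|M. g z * (b (Z n z) * b (Z n z))) \<longlonglongrightarrow> (LINT z|M. g z * (LINT v|V z. b v * b v))"
      using young_limit_Cc[OF Cc_mult[OF b b] g(1)] unfolding young_limit_def by auto
    also have "(LINT z|M. g z * (LINT v|V z. b v * b v)) = (LINT z|M. g z * (b (U z) * b (U z)))"
      using Vc[OF Cc_mult[OF b b]] young_Cc_measurable[OF Cc_mult[OF b b]] by (intro integral_cong_AE) auto
    finally show ?thesis .
  qed
  have l2: "(\<lambda>n. LINT z|M. g z * b (U z) * b (Z n z)) \<longlonglongrightarrow> (LINT z|M. g z * (b (U z) * b (U z)))"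
  proof -
    have "(\<lambda>n. LINT z|M. g z * b (U z) * b (Z n z)) \<longlonglongrightarrow> (LINT z|M. g z * b (U z) * (LINT v|V z. b v))"
      using young_limit_Cc[OF b gb] unfolding young_limit_def by auto
    also have "(LINT z|M. g z * b (U z) * (LINT v|V z. b v)) = (LINT z|M. g z * (b (U z) * b (U z)))"
      using Vc[OF b] young_Cc_measurable[OF b] by (intro integral_cong_AE) auto
    finally show ?thesis .
  qed
  have sq: "(LINT z|M. g z * (b (Z n z) - b (U z))\<^sup>2) = (LINT z|M. g z * (b (Z n z) * b (Z n z)))
     - 2 * (LINT z|M. g z * b (U z) * b (Z n z)) + (LINT z|M. g z * (b (U z) * b (U z)))"
    and isq: "integrable M (\<lambda>z. g z * (b (Z n z) - b (U z))\<^sup>2)" for n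
  proof -
    have e: "(\<lambda>z. g z * (b (Z n z) - b (U z))\<^sup>2) = (\<lambda>z. g z * (b (Z n z) * b (Z n z)) - 2 * (g z * b (U z) * b (Z n z)) + g z * (b (U z) * b (U z)))"
      by (auto simp: power2_eq_square algebra_simps)
    show "integrable M (\<lambda>z. g z * (b (Z n z) - b (U z))\<^sup>2)" unfolding e using ib ibb gbb by auto
    show "(LINT z|M. g z * (b (Z n z) - b (U z))\<^sup>2) = (LINT z|M. g z * (b (Z n z) * b (Z n z)))
     - 2 * (LINT z|M. g z * b (U z) * b (Z n z)) + (LINT z|M. g z * (b (U z) * b (U z)))"
      unfolding e using ib ibb gbb by simp
  qed
  have l3: "(\<lambda>n. LINT z|M. g z * (b (Z n z) - b (U z))\<^sup>2) \<longlonglongrightarrow> 0"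
  proof -
    let ?A = "LINT z|M. g z * (b (U z) * b (U z))"
    have "(\<lambda>n. LINT z|M. g z * (b (Z n z) - b (U z))\<^sup>2) \<longlonglongrightarrow> ?A - 2 * ?A + ?A"
      unfolding sq by (intro tendsto_intros l1 l2)
    thus ?thesis by simp
  qed
  show iabs: "integrable M (\<lambda>z. g z * \<bar>b (Z n z) - b (U z)\<bar>)" for n
  proof (rule bnd[of _ "2 * K"])
    show "\<bar>\<bar>b (Z n z) - b (U z)\<bar>\<bar> \<le> 2 * K" for z using K(2)[of "Z n z"] K(2)[of "U z"] by linarith
  qed (use K in auto)
  define g0 where "g0 = (LINT z|M. g z)"
  have g0: "0 \<le> g0" unfolding g0_def using g(2) by (intro integral_nonneg_AE) auto
  show "(\<lambda>n. LINT z|M. g z * \<bar>b (Z n z) - b (U z)\<bar>) \<longlonglongrightarrow> 0"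
  proof (rule LIMSEQ_I)
    fix e :: real assume e: "e > 0"
    define \<eta> where "\<eta> = e / (2 * (g0 + 1))"
    have \<eta>: "\<eta> > 0" using e g0 by (simp add: \<eta>_def)
    have "\<eta> * e / 2 > 0" using e \<eta> by simp
    from LIMSEQ_D[OF l3 this] obtain N where N: "\<And>n. n \<ge> N \<Longrightarrow> \<bar>LINT z|M. g z * (b (Z n z) - b (U z))\<^sup>2\<bar> < \<eta> * e / 2"
      by auto
    show "\<exists>no. \<forall>n\<ge>no. norm ((LINT z|M. g z * \<bar>b (Z n z) - b (U z)\<bar>) - 0) < e"
    proof (intro exI allI impI)
      fix n assume n: "n \<ge> N"
      \<comment> \<open>Passes from the integral of the square to the integral of the absolute value.\<close>
      have pt: "\<bar>t\<bar> \<le> \<eta> + t\<^sup>2 / \<eta>" for t :: real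
      proof (cases "\<bar>t\<bar> \<le> \<eta>")
        case True thus ?thesis using \<eta> by (simp add: add_increasing2)
      next
        case False
        hence "\<bar>t\<bar> * \<eta> \<le> \<bar>t\<bar> * \<bar>t\<bar>" using \<eta> by (intro mult_left_mono) auto
        hence "\<bar>t\<bar> \<le> t\<^sup>2 / \<eta>" using \<eta> by (simp add: field_simps power2_eq_square)
        thus ?thesis using \<eta> by simp
      qed
      have "(LINT z|M. g z * \<bar>b (Z n z) - b (U z)\<bar>) \<le> (LINT z|M. \<eta> * g z + 1 / \<eta> * (g z * (b (Z n z) - b (U z))\<^sup>2))"
      proof (rule integral_mono[OF iabs])
        show "integrable M (\<lambda>z. \<eta> * g z + 1 / \<eta> * (g z * (b (Z n z) - b (U z))\<^sup>2))" using g(1) isq by auto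
        fix z assume z: "z \<in> space M"
        have "g z * \<bar>b (Z n z) - b (U z)\<bar> \<le> g z * (\<eta> + (b (Z n z) - b (U z))\<^sup>2 / \<eta>)"
          using g(2) z pt by (intro mult_left_mono) auto
        thus "g z * \<bar>b (Z n z) - b (U z)\<bar> \<le> \<eta> * g z + 1 / \<eta> * (g z * (b (Z n z) - b (U z))\<^sup>2)"
          by (simp add: algebra_simps)
      qed
      also have "\<dots> = \<eta> * g0 + 1 / \<eta> * (LINT z|M. g z * (b (Z n z) - b (U z))\<^sup>2)"
        using g(1) isq by (simp add: g0_def)
      also have "1 / \<eta> * (LINT z|M. g z * (b (Z n z) - b (U z))\<^sup>2) < 1 / \<eta> * (\<eta> * e / 2)"
        using N[OF n] \<eta> by (intro mult_strict_left_mono) auto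
      also have "1 / \<eta> * (\<eta> * e / 2) = e / 2" using \<eta> by simp
      also have "\<eta> * g0 \<le> e / 2" using g0 e by (simp add: \<eta>_def field_simps)
      finally have "(LINT z|M. g z * \<bar>b (Z n z) - b (U z)\<bar>) < e" by simp
      moreover have "(LINT z|M. g z * \<bar>b (Z n z) - b (U z)\<bar>) \<ge> 0"
        using g(2) by (intro integral_nonneg_AE) auto
      ultimately show "norm ((LINT z|M. g z * \<bar>b (Z n z) - b (U z)\<bar>) - 0) < e" by simp
    qed
  qed
qed

text \<open>Convergence in \<open>L\<^sup>1\<close>, by truncation and \<open>dirac_Cc\<close>.\<close>

lemma dirac_equi:
  assumes U: "U \<in> borel_measurable M" and dirac: "AE z in M. AE v in V z. v = U z"
    and g: "integrable M g" "\<And>z. z \<in> Q \<Longrightarrow> 0 \<le> g z" "\<And>z. z \<in> Q \<Longrightarrow> g z \<le> G" and G: "0 \<le> G"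
    and h: "equi_integrable h"
  shows "(\<lambda>n. LINT z|M. g z * \<bar>h (Z n z) - h (U z)\<bar>) \<longlonglongrightarrow> 0"
    and "integrable M (\<lambda>z. g z * \<bar>h (Z n z)\<bar>)"
    and "integrable M (\<lambda>z. g z * \<bar>h (U z)\<bar>)"
proof -
  have hc: "continuous_on UNIV h" using h by (simp add: equi_integrable_def)
  have hb [measurable]: "h \<in> borel_measurable borel" using hc by (rule borel_measurable_continuous_onI)
  note [measurable] = U borel_measurable_integrable[OF g(1)]
  obtain K where K: "K \<ge> 0" "\<And>v. v \<in> D \<Longrightarrow> \<bar>h v\<bar> \<le> K + 1 * R v"
    using h zero_less_one unfolding equi_integrable_def by blast
  have ha: "continuous_on UNIV (\<lambda>v. \<bar>h v\<bar>)" using hc by (intro continuous_intros)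
  note nb = young_nonneg_bound[OF ha abs_ge_zero K(2) K(1) zero_le_one g G]
  show iZ: "integrable M (\<lambda>z. g z * \<bar>h (Z n z)\<bar>)" for n by (rule nb(2))
  have VU: "AE z in M. (\<integral>\<^sup>+v. ennreal (f v) \<partial>V z) = ennreal (f (U z))" if f: "f \<in> borel_measurable borel" for f
    using dirac
  proof (rule AE_mp, intro AE_I2 impI)
    fix z assume z: "z \<in> space M" and d: "AE v in V z. v = U z"
    interpret prob_space "V z" using z V_prob by simp
    have "(\<integral>\<^sup>+v. ennreal (f v) \<partial>V z) = (\<integral>\<^sup>+v. ennreal (f (U z)) \<partial>V z)"
      using d by (intro nn_integral_cong_AE) auto
    thus "(\<integral>\<^sup>+v. ennreal (f v) \<partial>V z) = ennreal (f (U z))" by (simp add: emeasure_space_1)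
  qed
  have toU: "(\<integral>\<^sup>+z. ennreal (g z) * (\<integral>\<^sup>+v. ennreal (f v) \<partial>V z) \<partial>M) = (\<integral>\<^sup>+z. ennreal (g z * f (U z)) \<partial>M)"
    if f: "f \<in> borel_measurable borel" "\<And>v. 0 \<le> f v" for f
    using VU[OF f(1)] AE_space
    by (intro nn_integral_cong_AE, eventually_elim) (use g(2) f(2) in \<open>auto simp: ennreal_mult\<close>)
  show iU: "integrable M (\<lambda>z. g z * \<bar>h (U z)\<bar>)"
  proof (rule integrableI_nonneg)
    show "AE z in M. 0 \<le> g z * \<bar>h (U z)\<bar>" using g(2) by auto
    have "(\<integral>\<^sup>+z. ennreal (g z * \<bar>h (U z)\<bar>) \<partial>M) \<le> ennreal (K * (LINT z|M. g z) + 1 * G * C)"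
      using nb(3) toU[of "\<lambda>v. \<bar>h v\<bar>"] by simp
    thus "(\<integral>\<^sup>+z. ennreal (g z * \<bar>h (U z)\<bar>) \<partial>M) < \<infinity>" by (rule le_less_trans) simp
  qed simp
  \<comment> \<open>Used with \<open>x = h (Z n z)\<close>, \<open>y = h (U z)\<close> and the values of the cutoff at the two states.\<close>
  have split: "\<bar>x - y\<bar> \<le> \<bar>c * x - d * y\<bar> + ((1 - c) * \<bar>x\<bar> + (1 - d) * \<bar>y\<bar>)"
    if "0 \<le> 1 - c" "0 \<le> 1 - d" for x y c d :: real
  proof -
    have "x - y = (c * x - d * y) + ((1 - c) * x - (1 - d) * y)" by (simp add: algebra_simps)
    also have "\<bar>\<dots>\<bar> \<le> \<bar>c * x - d * y\<bar> + (\<bar>(1 - c) * x\<bar> + \<bar>(1 - d) * y\<bar>)" by linarith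
    finally show ?thesis using that by (simp add: abs_mult)
  qed
  show "(\<lambda>n. LINT z|M. g z * \<bar>h (Z n z) - h (U z)\<bar>) \<longlonglongrightarrow> 0"
  proof (rule LIMSEQ_I)
    fix e :: real assume e: "e > 0"
    define \<eta> where "\<eta> = e / 4"
    have \<eta>: "\<eta> > 0" using e by (simp add: \<eta>_def)
    obtain k where k: "\<And>n. (LINT z|M. g z * ((1 - cutoff k (Z n z)) * \<bar>h (Z n z)\<bar>)) \<le> \<eta>"
      "(\<integral>\<^sup>+z. ennreal (g z) * (\<integral>\<^sup>+v. ennreal ((1 - cutoff k v) * \<bar>h v\<bar>) \<partial>V z) \<partial>M) \<le> ennreal \<eta>"
      using uniform_tail[OF h g G \<eta>] by blast
    define F where "F = (\<lambda>v. cutoff k v * h v)"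
    have F: "F \<in> Cc" unfolding F_def by (rule cutoff_times_Cc[OF hc])
    have [measurable]: "F \<in> borel_measurable borel" by (rule Cc_borel[OF F])
    have cb [measurable]: "(cutoff k :: 'w \<Rightarrow> real) \<in> borel_measurable borel"
      by (intro borel_measurable_continuous_onI continuous_intros)
    have tail_int: "integrable M (\<lambda>z. g z * ((1 - cutoff k (X z)) * \<bar>h (X z)\<bar>))"
      if "integrable M (\<lambda>z. g z * \<bar>h (X z)\<bar>)" and [measurable]: "X \<in> borel_measurable M" for X
      using that(1)
    proof (rule Bochner_Integration.integrable_bound)
      show "AE z in M. norm (g z * ((1 - cutoff k (X z)) * \<bar>h (X z)\<bar>)) \<le> norm (g z * \<bar>h (X z)\<bar>)"
      proof (rule AE_I2)
        fix z
        have "\<bar>1 - cutoff k (X z)\<bar> * \<bar>h (X z)\<bar> \<le> \<bar>h (X z)\<bar>"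
          using cutoff_bounds[of k "X z"] by (intro mult_left_le_one_le) auto
        thus "norm (g z * ((1 - cutoff k (X z)) * \<bar>h (X z)\<bar>)) \<le> norm (g z * \<bar>h (X z)\<bar>)"
          by (simp add: abs_mult mult_left_mono)
      qed
    qed measurable
    have tU: "(LINT z|M. g z * ((1 - cutoff k (U z)) * \<bar>h (U z)\<bar>)) \<le> \<eta>"
    proof -
      have "ennreal (LINT z|M. g z * ((1 - cutoff k (U z)) * \<bar>h (U z)\<bar>)) = (\<integral>\<^sup>+z. ennreal (g z * ((1 - cutoff k (U z)) * \<bar>h (U z)\<bar>)) \<partial>M)"
        using g(2) cutoff_bounds[of k]
        by (intro nn_integral_eq_integral[symmetric] tail_int iU U AE_I2 mult_nonneg_nonneg) auto
      also have "\<dots> \<le> ennreal \<eta>"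
      proof -
        have "0 \<le> (1 - cutoff k v) * \<bar>h v\<bar>" for v using cutoff_bounds[of k v] by simp
        thus ?thesis using k(2) toU[of "\<lambda>v. (1 - cutoff k v) * \<bar>h v\<bar>"] by simp
      qed
      finally show ?thesis using \<eta> by (simp add: ennreal_le_iff)
    qed
    note dF = dirac_Cc[OF U dirac g(1,2) F]
    from LIMSEQ_D[OF dF(1) \<eta>] obtain N where N: "\<And>n. n \<ge> N \<Longrightarrow> \<bar>LINT z|M. g z * \<bar>F (Z n z) - F (U z)\<bar>\<bar> < \<eta>" by auto
    show "\<exists>no. \<forall>n\<ge>no. norm ((LINT z|M. g z * \<bar>h (Z n z) - h (U z)\<bar>) - 0) < e"
    proof (intro exI allI impI)
      fix n assume n: "n \<ge> N"
      let ?T = "\<lambda>X z. g z * ((1 - cutoff k (X z)) * \<bar>h (X z)\<bar>)"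
      have iT: "integrable M (?T (Z n))" "integrable M (?T U)" using tail_int iZ iU U by auto
      have "(LINT z|M. g z * \<bar>h (Z n z) - h (U z)\<bar>) \<le> (LINT z|M. g z * \<bar>F (Z n z) - F (U z)\<bar> + (?T (Z n) z + ?T U z))"
      proof (rule integral_mono')
        show "integrable M (\<lambda>z. g z * \<bar>F (Z n z) - F (U z)\<bar> + (?T (Z n) z + ?T U z))"
          using iT dF(2) by auto
        fix z assume z: "z \<in> space M"
        have "\<bar>h (Z n z) - h (U z)\<bar> \<le> \<bar>F (Z n z) - F (U z)\<bar>
           + ((1 - cutoff k (Z n z)) * \<bar>h (Z n z)\<bar> + (1 - cutoff k (U z)) * \<bar>h (U z)\<bar>)"
          unfolding F_def using cutoff_bounds by (intro split) auto
        hence "g z * \<bar>h (Z n z) - h (U z)\<bar> \<le> g z * (\<bar>F (Z n z) - F (U z)\<bar>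
           + ((1 - cutoff k (Z n z)) * \<bar>h (Z n z)\<bar> + (1 - cutoff k (U z)) * \<bar>h (U z)\<bar>))"
          using g(2) z by (intro mult_left_mono) auto
        thus "g z * \<bar>h (Z n z) - h (U z)\<bar> \<le> g z * \<bar>F (Z n z) - F (U z)\<bar> + (?T (Z n) z + ?T U z)"
          by (simp add: algebra_simps)
        show "0 \<le> g z * \<bar>F (Z n z) - F (U z)\<bar> + (?T (Z n) z + ?T U z)"
          using g(2) z cutoff_bounds by (intro add_nonneg_nonneg mult_nonneg_nonneg) auto
      qed
      also have "\<dots> = (LINT z|M. g z * \<bar>F (Z n z) - F (U z)\<bar>) + ((LINT z|M. ?T (Z n) z) + (LINT z|M. ?T U z))"
        using iT dF(2) by simp
      also have "\<dots> < e" using N[OF n] k(1)[of n] tU \<eta> unfolding \<eta>_def by linarith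
      finally have "(LINT z|M. g z * \<bar>h (Z n z) - h (U z)\<bar>) < e" .
      moreover have "(LINT z|M. g z * \<bar>h (Z n z) - h (U z)\<bar>) \<ge> 0"
        using g(2) by (intro integral_nonneg_AE) auto
      ultimately show "norm ((LINT z|M. g z * \<bar>h (Z n z) - h (U z)\<bar>) - 0) < e" by simp
    qed
  qed
qed

lemma bounded_equi_integrable:
  assumes "continuous_on UNIV h" "\<And>v. \<bar>h v\<bar> \<le> K"
  shows "equi_integrable h"
  unfolding equi_integrable_def
proof (intro conjI allI impI)
  fix \<epsilon> :: real assume "\<epsilon> > 0"
  have "\<bar>h v\<bar> \<le> max 0 K + \<epsilon> * R v" if "v \<in> D" for v
    using assms(2)[of v] R_nonneg[OF that] \<open>\<epsilon> > 0\<close> by (simp add: add_increasing2)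
  thus "\<exists>K\<ge>0. \<forall>v\<in>D. \<bar>h v\<bar> \<le> K + \<epsilon> * R v" by (intro exI[of _ "max 0 K"]) auto
qed (rule assms)

text \<open>The arctangent of a coordinate is bounded, hence \<open>dirac_equi\<close> applies to it even if the coordinate
itself is not equi-integrable. A subsequence of an \<open>L\<^sup>1\<close> convergent sequence converges almost everywhere,
and the tangent recovers the coordinate.\<close>

lemma dirac_AE_subsequence:
  assumes U: "U \<in> borel_measurable M" and dirac: "AE z in M. AE v in V z. v = U z"
    and r: "strict_mono (r :: nat \<Rightarrow> nat)"
  shows "\<exists>k :: nat \<Rightarrow> nat. strict_mono k \<and> (AE z in M. (\<lambda>n. Z (r (k n)) z) \<longlonglongrightarrow> U z)"
proof -
  obtain g :: "'a \<Rightarrow> real" where g': "integrable M g \<and> (\<forall>z. 0 < g z \<and> g z \<le> 1)" using positive_weight[OF Q] ..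
  have g: "integrable M g" "\<And>z. 0 < g z" "\<And>z. g z \<le> 1" using g' by auto
  define h where "h i = (\<lambda>v :: 'w. arctan (v \<bullet> i))" for i
  have hc: "continuous_on UNIV (h i)" for i unfolding h_def by (intro continuous_intros)
  have h: "equi_integrable (h i)" for i
  proof (rule bounded_equi_integrable[OF hc, where K = "pi / 2"])
    fix v show "\<bar>h i v\<bar> \<le> pi / 2" unfolding h_def using arctan_bounded[of "v \<bullet> i"] by linarith
  qed
  note [measurable] = borel_measurable_continuous_onI[OF hc] U borel_measurable_integrable[OF g(1)]
  note dh = dirac_equi[OF U dirac g(1) less_imp_le[OF g(2)] g(3) zero_le_one h]
  have i: "integrable M (\<lambda>z. g z * \<bar>h i (Z n z) - h i (U z)\<bar>)" for i n
  proof (rule Bochner_Integration.integrable_bound)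
    show "integrable M (\<lambda>z. g z * \<bar>h i (Z n z)\<bar> + g z * \<bar>h i (U z)\<bar>)" using dh(2,3) by auto
    show "AE z in M. norm (g z * \<bar>h i (Z n z) - h i (U z)\<bar>) \<le> norm (g z * \<bar>h i (Z n z)\<bar> + g z * \<bar>h i (U z)\<bar>)"
    proof (rule AE_I2)
      fix z
      have "g z * \<bar>h i (Z n z) - h i (U z)\<bar> \<le> g z * (\<bar>h i (Z n z)\<bar> + \<bar>h i (U z)\<bar>)"
        using g(2)[of z] by (intro mult_left_mono) auto
      moreover have "g z * \<bar>h i (Z n z) - h i (U z)\<bar> \<ge> 0" using g(2)[of z] by simp
      ultimately show "norm (g z * \<bar>h i (Z n z) - h i (U z)\<bar>) \<le> norm (g z * \<bar>h i (Z n z)\<bar> + g z * \<bar>h i (U z)\<bar>)"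
        by (simp add: distrib_left)
    qed
  qed measurable
  define W where "W n z = (\<Sum>i\<in>Basis. g z * \<bar>h i (Z (r n) z) - h i (U z)\<bar>)" for n z
  have Wn: "0 \<le> W n z" for n z unfolding W_def using g(2)[of z] by (intro sum_nonneg) auto
  have Wi: "integrable M (W n)" for n unfolding W_def using i by auto
  have "(\<lambda>n. LINT z|M. norm (W n z)) = (\<lambda>n. \<Sum>i\<in>Basis. LINT z|M. g z * \<bar>h i (Z (r n) z) - h i (U z)\<bar>)"
    using Wn i by (simp add: W_def)
  also have "\<dots> \<longlonglongrightarrow> (\<Sum>i\<in>(Basis::'w set). 0)"
    using LIMSEQ_subseq_LIMSEQ[OF dh(1) r] by (intro tendsto_sum) (simp add: o_def)
  finally have "(\<lambda>n. LINT z|M. norm (W n z)) \<longlonglongrightarrow> 0" by simp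
  from tendsto_L1_AE_subseq[OF Wi this] obtain k where k: "strict_mono k" "AE z in M. (\<lambda>n. W (k n) z) \<longlonglongrightarrow> 0" by auto
  have "AE z in M. (\<lambda>n. Z (r (k n)) z) \<longlonglongrightarrow> U z"
    using k(2)
  proof eventually_elim
    fix z assume z: "(\<lambda>n. W (k n) z) \<longlonglongrightarrow> 0"
    have "(\<lambda>n. Z (r (k n)) z \<bullet> i) \<longlonglongrightarrow> U z \<bullet> i" if ib: "i \<in> Basis" for i
    proof -
      have "(\<lambda>n. 1 / g z * W (k n) z) \<longlonglongrightarrow> 1 / g z * 0" by (intro tendsto_intros z)
      hence t0: "(\<lambda>n. 1 / g z * W (k n) z) \<longlonglongrightarrow> 0" by simp
      have "(\<lambda>n. h i (Z (r (k n)) z) - h i (U z)) \<longlonglongrightarrow> 0"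
      proof (rule Lim_null_comparison[OF always_eventually t0], intro allI)
        fix n
        have "g z * \<bar>h i (Z (r (k n)) z) - h i (U z)\<bar> \<le> W (k n) z"
          unfolding W_def using ib g(2)[of z]
          by (intro member_le_sum[where f = "\<lambda>i. g z * \<bar>h i (Z (r (k n)) z) - h i (U z)\<bar>"]) auto
        thus "norm (h i (Z (r (k n)) z) - h i (U z)) \<le> 1 / g z * W (k n) z"
          using g(2)[of z] by (simp add: field_simps)
      qed
      hence "(\<lambda>n. arctan (Z (r (k n)) z \<bullet> i)) \<longlonglongrightarrow> arctan (U z \<bullet> i)"
        unfolding h_def by (simp add: LIM_zero_iff)
      moreover have "isCont tan (arctan (U z \<bullet> i))" by (intro isCont_tan cos_arctan_not_zero)
      ultimately have "(\<lambda>n. tan (arctan (Z (r (k n)) z \<bullet> i))) \<longlonglongrightarrow> tan (arctan (U z \<bullet> i))"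
        by (rule isCont_tendsto_compose[rotated])
      thus ?thesis by (simp only: tan_arctan)
    qed
    thus "(\<lambda>n. Z (r (k n)) z) \<longlonglongrightarrow> U z" by (subst tendsto_componentwise_iff) blast
  qed
  with k(1) show ?thesis by blast
qed

text \<open>Monotone convergence, applied first to the Young measures and then to the base space. It serves for
integrands that are limits of test functions but are not continuous.\<close>

lemma young_monotone_limit:
  assumes lim: "\<And>k. young_limit (f k) (F k)"
    and nn: "\<And>k z v. z \<in> Q \<Longrightarrow> 0 \<le> f k z v"
    and mono: "\<And>k l z v. z \<in> Q \<Longrightarrow> k \<le> l \<Longrightarrow> f k z v \<le> f l z v"
    and ptw: "\<And>z v. z \<in> Q \<Longrightarrow> (\<lambda>k. f k z v) \<longlonglongrightarrow> fl z v"
    and bd: "\<And>k. (LINT z|M. F k z) \<le> X"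
  obtains Fl where "integrable M Fl" "(LINT z|M. Fl z) \<le> X"
    "AE z in M. integrable (V z) (fl z) \<and> (LINT v|V z. fl z v) = Fl z"
proof -
  have Fi: "integrable M (F k)" for k using lim[of k] by (simp add: young_limit_def)
  have VF: "AE z in M. \<forall>k. integrable (V z) (f k z) \<and> (LINT v|V z. f k z v) = F k z"
    using lim by (subst AE_all_countable) (auto simp: young_limit_def)
  have Fn: "AE z in M. \<forall>k. 0 \<le> F k z \<and> F k z \<le> F (Suc k) z"
    using VF
  proof (rule AE_mp, intro AE_I2 impI allI)
    fix z k assume z: "z \<in> space M" and v: "\<forall>k. integrable (V z) (f k z) \<and> (LINT v|V z. f k z v) = F k z"
    have "0 \<le> (LINT v|V z. f k z v)" using nn z by (intro Bochner_Integration.integral_nonneg) auto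
    moreover have "(LINT v|V z. f k z v) \<le> (LINT v|V z. f (Suc k) z v)"
      using v mono z by (intro integral_mono) auto
    ultimately show "0 \<le> F k z \<and> F k z \<le> F (Suc k) z" using v by auto
  qed
  have Fk: "AE z in M. 0 \<le> F k z" and Fk': "AE z in M. F k z \<le> F (Suc k) z" for k
    using Fn by (auto elim: eventually_mono)
  have X: "0 \<le> X" using bd[of 0] integral_nonneg_AE[OF Fk[of 0]] by linarith
  define G where "G z = (SUP k. ennreal (F k z))" for z
  have Gm [measurable]: "G \<in> borel_measurable M"
    unfolding G_def using Fi by (intro borel_measurable_SUP) auto
  have "(\<integral>\<^sup>+z. G z \<partial>M) = (SUP k. \<integral>\<^sup>+z. ennreal (F k z) \<partial>M)"
    unfolding G_def
  proof (rule nn_integral_monotone_convergence_SUP_AE)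
    show "AE z in M. ennreal (F k z) \<le> ennreal (F (Suc k) z)" for k
      using Fk'[of k] by eventually_elim (rule ennreal_leI)
  qed (use Fi in auto)
  also have "\<dots> \<le> ennreal X"
    using bd Fk Fi by (intro SUP_least) (simp add: nn_integral_eq_integral ennreal_leI)
  finally have GX: "(\<integral>\<^sup>+z. G z \<partial>M) \<le> ennreal X" .
  have Gfin: "AE z in M. G z \<noteq> \<infinity>"
    using GX by (intro nn_integral_PInf_AE) (auto simp: top_unique)
  \<comment> \<open>Finite almost everywhere by the bound \<open>X\<close>.\<close>
  define F' where "F' z = enn2real (G z)" for z
  have F'm: "F' \<in> borel_measurable M" unfolding F'_def by measurable
  have F'nn: "(\<integral>\<^sup>+z. ennreal (F' z) \<partial>M) \<le> ennreal X"
  proof -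
    have "(\<integral>\<^sup>+z. ennreal (F' z) \<partial>M) = (\<integral>\<^sup>+z. G z \<partial>M)"
      using Gfin by (intro nn_integral_cong_AE) (auto simp: F'_def top.not_eq_extremum elim!: eventually_mono)
    thus ?thesis using GX by simp
  qed
  have F'0: "0 \<le> F' z" for z by (simp add: F'_def)
  have F'i: "integrable M F'"
    using F'm F'0 F'nn by (intro integrableI_nonneg) (auto intro: le_less_trans)
  have "ennreal (LINT z|M. F' z) \<le> ennreal X"
    using F'nn nn_integral_eq_integral[OF F'i] F'0 by simp
  hence F'X: "(LINT z|M. F' z) \<le> X" using X by (simp add: ennreal_le_iff)
  have "AE z in M. integrable (V z) (fl z) \<and> (LINT v|V z. fl z v) = F' z"
    using VF Fn Gfin AE_space
  proof eventually_elim
    fix z assume v: "\<forall>k. integrable (V z) (f k z) \<and> (LINT v|V z. f k z v) = F k z"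
      and n: "\<forall>k. 0 \<le> F k z \<and> F k z \<le> F (Suc k) z" and g: "G z \<noteq> \<infinity>" and z: "z \<in> space M"
    have zQ: "z \<in> Q" using z by simp
    have incF: "incseq (\<lambda>k. F k z)" using n by (intro incseq_SucI) auto
    have le: "F k z \<le> F' z" for k
    proof -
      have "ennreal (F k z) \<le> G z" unfolding G_def by (rule SUP_upper) simp
      hence "enn2real (ennreal (F k z)) \<le> F' z" unfolding F'_def using g by (intro enn2real_mono) (auto simp: top.not_eq_extremum)
      thus ?thesis using n by simp
    qed
    have "(\<lambda>k. ennreal (F k z)) \<longlonglongrightarrow> G z"
      unfolding G_def using incF by (intro LIMSEQ_SUP) (auto simp: incseq_def intro: ennreal_leI)
    moreover have "G z = ennreal (F' z)" unfolding F'_def using g by (simp add: top.not_eq_extremum)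
    ultimately have "(\<lambda>k. ennreal (F k z)) \<longlonglongrightarrow> ennreal (F' z)" by simp
    hence "(\<lambda>k. F k z) \<longlonglongrightarrow> F' z"
      using n F'0 by (subst (asm) tendsto_ennreal_iff) auto
    hence lim: "(\<lambda>k. LINT v|V z. f k z v) \<longlonglongrightarrow> F' z" using v by simp
    have vi: "integrable (V z) (f k z)" for k using v by simp
    have mo: "AE v in V z. mono (\<lambda>k. f k z v)" using mono[OF zQ] by (intro AE_I2) (simp add: mono_def)
    have pt: "AE v in V z. (\<lambda>k. f k z v) \<longlonglongrightarrow> fl z v" using ptw[OF zQ] by (intro AE_I2)
    have me: "fl z \<in> borel_measurable (V z)"
      by (rule borel_measurable_LIMSEQ_metric[where f = "\<lambda>k. f k z"]) (use vi ptw[OF zQ] in auto)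
    show "integrable (V z) (fl z) \<and> (LINT v|V z. fl z v) = F' z"
      using integrable_monotone_convergence[OF vi mo pt lim me] integral_monotone_convergence[OF vi mo pt lim me] by simp
  qed
  with F'i F'X show ?thesis by (rule that)
qed

lemma young_AE_null:
  fixes f :: "'w \<Rightarrow> real"
  assumes f: "continuous_on UNIV f" "\<And>v. 0 \<le> f v" and D0: "\<And>v. v \<in> D \<Longrightarrow> f v = 0"
  shows "AE z in M. AE v in V z. f v = 0"
proof -
  obtain g :: "'a \<Rightarrow> real" where g': "integrable M g \<and> (\<forall>z. 0 < g z \<and> g z \<le> 1)" using positive_weight[OF Q] ..
  have g: "integrable M g" "\<And>z. 0 < g z" "\<And>z. g z \<le> 1" using g' by auto
  have fR: "f v \<le> 0 + 0 * R v" if "v \<in> D" for v using D0[OF that] by simp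
  note b = young_nonneg_bound(3,4)[OF f fR order_refl order_refl g(1) less_imp_le[OF g(2)] g(3) zero_le_one]
  have [measurable]: "g \<in> borel_measurable M" using g(1) by simp
  have "AE z in M. ennreal (g z) * (\<integral>\<^sup>+v. ennreal (f v) \<partial>V z) = 0"
    using b by (subst nn_integral_0_iff_AE[symmetric]) auto
  thus ?thesis
  proof (rule AE_mp, intro AE_I2[where M = M] impI)
    fix z assume z: "z \<in> space M" "ennreal (g z) * (\<integral>\<^sup>+v. ennreal (f v) \<partial>V z) = 0"
    have "(\<integral>\<^sup>+v. ennreal (f v) \<partial>V z) = 0" using z(2) g(2)[of z] by (simp add: ennreal_eq_0_iff)
    moreover have "f \<in> borel_measurable (V z)"
      using V_borel[OF _ borel_measurable_continuous_onI[OF f(1)]] z(1) by simp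
    ultimately have "AE v in V z. ennreal (f v) = 0" by (subst (asm) nn_integral_0_iff_AE) auto
    thus "AE v in V z. f v = 0" by eventually_elim (use f(2) in \<open>auto simp: ennreal_eq_0_iff intro: antisym\<close>)
  qed
qed

text \<open>Subtract the multiple \<open>K\<close> of \<open>h\<close> that belongs to \<open>\<delta>\<close> from \<open>f\<close>. The positive part of the difference
dominates \<open>f\<close> where \<open>h\<close> is nonpositive, and its Young averages have integral of order \<open>\<delta>\<close>.\<close>

lemma young_AE_null_on:
  assumes f: "continuous_on UNIV f" and h: "continuous_on UNIV h"
    and D0: "\<And>\<delta>. \<delta> > 0 \<Longrightarrow> \<exists>K\<ge>0. \<forall>v\<in>D. f v \<le> \<delta> * (1 + R v) + K * h v"
  shows "AE z in M. AE v in V z. h v \<le> 0 \<longrightarrow> f v \<le> 0"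
proof -
  obtain g :: "'a \<Rightarrow> real" where g': "integrable M g \<and> (\<forall>z. 0 < g z \<and> g z \<le> 1)" using positive_weight[OF Q] ..
  have g: "integrable M g" "\<And>z. 0 < g z" "\<And>z. g z \<le> 1" using g' by auto
  have [measurable]: "g \<in> borel_measurable M" using g(1) by simp
  have "\<forall>j. \<exists>K\<ge>0. \<forall>v\<in>D. f v \<le> 1 / real (Suc j) * (1 + R v) + K * h v" by (intro allI D0) simp
  then obtain K where K: "\<And>j. K j \<ge> 0" "\<And>j v. v \<in> D \<Longrightarrow> f v \<le> 1 / real (Suc j) * (1 + R v) + K j * h v" by metis
  define F where "F j = (\<lambda>v. max 0 (f v - K j * h v))" for j
  have Fc: "continuous_on UNIV (F j)" for j unfolding F_def using f h by (intro continuous_intros)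
  have F0: "0 \<le> F j v" for j v by (simp add: F_def)
  have FR: "F j v \<le> 1 / real (Suc j) + 1 / real (Suc j) * R v" if "v \<in> D" for j v
    using K(2)[OF that, of j] R_nonneg[OF that] by (auto simp: F_def distrib_left)
  have n: "0 \<le> 1 / real (Suc j)" for j by simp
  note b = young_nonneg_bound(3,4)[OF Fc F0 FR n n g(1) less_imp_le[OF g(2)] g(3) zero_le_one]
  define g0 where "g0 = (LINT z|M. g z)"
  \<comment> \<open>Only countably many values \<open>\<delta> = 1 / (j + 1)\<close> are used, to keep the infimum measurable.\<close>
  define Y where "Y z = (INF j. \<integral>\<^sup>+v. ennreal (F j v) \<partial>V z)" for z
  have Ym [measurable]: "Y \<in> borel_measurable M" unfolding Y_def using b(2) by (intro borel_measurable_INF) auto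
  have Yj: "(\<integral>\<^sup>+z. ennreal (g z) * Y z \<partial>M) \<le> ennreal (1 / real (Suc j) * (g0 + C))" for j
  proof -
    have "(\<integral>\<^sup>+z. ennreal (g z) * Y z \<partial>M) \<le> (\<integral>\<^sup>+z. ennreal (g z) * (\<integral>\<^sup>+v. ennreal (F j v) \<partial>V z) \<partial>M)"
      unfolding Y_def by (intro nn_integral_mono mult_left_mono INF_lower) auto
    also note b(1)[of j]
    finally show ?thesis by (simp add: g0_def algebra_simps add_divide_distrib)
  qed
  have "(\<integral>\<^sup>+z. ennreal (g z) * Y z \<partial>M) \<le> 0"
  proof (rule LIMSEQ_le_const)
    have "(\<lambda>j. 1 / real (Suc j) * (g0 + C)) \<longlonglongrightarrow> 0 * (g0 + C)"
      by (intro tendsto_intros LIMSEQ_Suc[OF lim_1_over_n])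
    hence "(\<lambda>j. ennreal (1 / real (Suc j) * (g0 + C))) \<longlonglongrightarrow> ennreal 0" by (intro tendsto_ennrealI) simp
    thus "(\<lambda>j. ennreal (1 / real (Suc j) * (g0 + C))) \<longlonglongrightarrow> 0" by simp
    show "\<exists>N. \<forall>j\<ge>N. (\<integral>\<^sup>+z. ennreal (g z) * Y z \<partial>M) \<le> ennreal (1 / real (Suc j) * (g0 + C))" using Yj by blast
  qed
  hence "AE z in M. ennreal (g z) * Y z = 0" by (subst nn_integral_0_iff_AE[symmetric]) auto
  thus ?thesis
  proof (rule AE_mp, intro AE_I2[where M = M] impI)
    fix z assume z: "z \<in> space M" "ennreal (g z) * Y z = 0"
    have Y0: "Y z = 0" using z(2) g(2)[of z] by (simp add: ennreal_eq_0_iff)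
    have [measurable]: "f \<in> borel_measurable (V z)" "h \<in> borel_measurable (V z)"
      using V_borel[OF _ borel_measurable_continuous_onI[OF f]] V_borel[OF _ borel_measurable_continuous_onI[OF h]] z(1) by auto
    define X where "X v = (if h v \<le> 0 then max 0 (f v) else 0)" for v
    have Xm [measurable]: "X \<in> borel_measurable (V z)" unfolding X_def by measurable
    have "(\<integral>\<^sup>+v. ennreal (X v) \<partial>V z) \<le> (\<integral>\<^sup>+v. ennreal (F j v) \<partial>V z)" for j
    proof (intro nn_integral_mono ennreal_leI)
      fix v
      have "h v \<le> 0 \<Longrightarrow> K j * h v \<le> 0" using K(1)[of j] by (simp add: mult_nonneg_nonpos)
      thus "X v \<le> F j v" by (auto simp: X_def F_def)
    qed
    hence "(\<integral>\<^sup>+v. ennreal (X v) \<partial>V z) \<le> Y z" unfolding Y_def by (intro INF_greatest)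
    hence "(\<integral>\<^sup>+v. ennreal (X v) \<partial>V z) = 0" using Y0 by simp
    hence "AE v in V z. ennreal (X v) = 0" by (subst (asm) nn_integral_0_iff_AE) auto
    thus "AE v in V z. h v \<le> 0 \<longrightarrow> f v \<le> 0"
      by eventually_elim (auto simp: X_def ennreal_eq_0_iff split: if_splits)
  qed
qed

end

section \<open>Lebesgue measurable functions on space-time cylinders\<close>

text \<open>Lebesgue measure on the product is the completion of the product measure, for which Fubini's theorem is
available; here and below a Lebesgue measurable function is replaced by a Borel function that agrees with
it almost everywhere.\<close>

lemma AE_lebesgue_prod:
  fixes P :: "'a::euclidean_space \<times> 'b::euclidean_space \<Rightarrow> bool"
  assumes "AE z in lebesgue. P z"
  shows "AE t in lebesgue. AE x in lebesgue. P (t, x)"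
proof -
  have "AE z in (lborel :: 'a measure) \<Otimes>\<^sub>M (lborel :: 'b measure). P z"
    using assms unfolding lborel_prod AE_completion_iff .
  from lborel_pair.AE_pair[OF this] show ?thesis by (simp add: AE_completion_iff)
qed

lemma nn_integral_lebesgue_prod:
  fixes f :: "'a::euclidean_space \<times> 'b::euclidean_space \<Rightarrow> ennreal"
  assumes f: "f \<in> borel_measurable lebesgue"
  shows "(\<integral>\<^sup>+z. f z \<partial>lebesgue) = (\<integral>\<^sup>+t. (\<integral>\<^sup>+x. f (t, x) \<partial>lebesgue) \<partial>lebesgue)"
    and "(\<lambda>t. \<integral>\<^sup>+x. f (t, x) \<partial>lebesgue) \<in> borel_measurable lebesgue"
proof -
  obtain g where g: "g \<in> borel_measurable lborel" "AE z in lborel. f z = g z"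
    using completion_ex_borel_measurable[OF f] by blast
  have gp: "g \<in> borel_measurable ((lborel :: 'a measure) \<Otimes>\<^sub>M (lborel :: 'b measure))"
    using g(1) by (simp add: lborel_prod)
  have "AE z in lebesgue. f z = g z" using g(2) by (rule AE_completion)
  hence "AE t in lebesgue. AE x in lebesgue. f (t, x) = g (t, x)" by (rule AE_lebesgue_prod)
  hence ae: "AE t in lebesgue. (\<integral>\<^sup>+x. g (t, x) \<partial>lborel) = (\<integral>\<^sup>+x. f (t, x) \<partial>lebesgue)"
  proof eventually_elim
    fix t assume "AE x in lebesgue. f (t, x) = g (t, x)"
    hence "(\<integral>\<^sup>+x. f (t, x) \<partial>lebesgue) = (\<integral>\<^sup>+x. g (t, x) \<partial>lebesgue)" by (rule nn_integral_cong_AE)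
    thus "(\<integral>\<^sup>+x. g (t, x) \<partial>lborel) = (\<integral>\<^sup>+x. f (t, x) \<partial>lebesgue)" by (simp add: nn_integral_completion)
  qed
  have gm: "(\<lambda>t. \<integral>\<^sup>+x. g (t, x) \<partial>lborel) \<in> borel_measurable lborel"
    by (rule lborel.borel_measurable_nn_integral_fst[OF gp])
  have "(\<integral>\<^sup>+z. f z \<partial>lebesgue) = (\<integral>\<^sup>+z. g z \<partial>lborel)"
    using g(2) by (simp add: nn_integral_completion cong: nn_integral_cong_AE)
  also have "\<dots> = (\<integral>\<^sup>+t. (\<integral>\<^sup>+x. g (t, x) \<partial>lborel) \<partial>lborel)"
    using lborel.nn_integral_fst[OF gp] by (simp add: lborel_prod)
  also have "\<dots> = (\<integral>\<^sup>+t. (\<integral>\<^sup>+x. g (t, x) \<partial>lborel) \<partial>lebesgue)" by (simp add: nn_integral_completion)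
  also have "\<dots> = (\<integral>\<^sup>+t. (\<integral>\<^sup>+x. f (t, x) \<partial>lebesgue) \<partial>lebesgue)" by (rule nn_integral_cong_AE[OF ae])
  finally show "(\<integral>\<^sup>+z. f z \<partial>lebesgue) = (\<integral>\<^sup>+t. (\<integral>\<^sup>+x. f (t, x) \<partial>lebesgue) \<partial>lebesgue)" .
  show "(\<lambda>t. \<integral>\<^sup>+x. f (t, x) \<partial>lebesgue) \<in> borel_measurable lebesgue"
  proof (rule measurableI)
    fix A :: "ennreal set" assume A: "A \<in> sets borel"
    let ?g = "\<lambda>t. \<integral>\<^sup>+x. g (t, x) \<partial>lborel" and ?f = "\<lambda>t. \<integral>\<^sup>+x. f (t, x) \<partial>lebesgue"
    have "?g \<in> borel_measurable lebesgue" using gm by (rule measurable_completion)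
    hence A': "?g -` A \<inter> space lebesgue \<in> sets lebesgue" using A by (rule measurable_sets)
    have ae': "AE t in lebesgue. t \<in> ?g -` A \<inter> space lebesgue \<longleftrightarrow> t \<in> ?f -` A \<inter> space lebesgue"
      using ae by eventually_elim simp
    show "?f -` A \<inter> space lebesgue \<in> sets lebesgue"
      by (rule completion.in_sets_AE[OF ae' A' Int_lower2])
  qed simp
qed

lemma section_lebesgue_measurable:
  fixes f :: "'a::euclidean_space \<times> 'b::euclidean_space \<Rightarrow> 'c::euclidean_space"
  assumes f: "f \<in> borel_measurable lebesgue"
  shows "AE t in lebesgue. (\<lambda>x. f (t, x)) \<in> borel_measurable lebesgue"
proof -
  have "AE t in lebesgue. (\<lambda>x. f (t, x) \<bullet> i) \<in> borel_measurable lebesgue" for i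
  proof -
    have "(\<lambda>z. f z \<bullet> i) \<in> borel_measurable lebesgue" using f by measurable
    then obtain g where g: "g \<in> borel_measurable lborel" "AE z in lborel. f z \<bullet> i = g z"
      using completion_ex_borel_measurable_real by blast
    have "AE z in lebesgue. f z \<bullet> i = g z" using g(2) by (rule AE_completion)
    hence "AE t in lebesgue. AE x in lebesgue. f (t, x) \<bullet> i = g (t, x)" by (rule AE_lebesgue_prod)
    thus ?thesis
    proof eventually_elim
      fix t assume "AE x in lebesgue. f (t, x) \<bullet> i = g (t, x)"
      hence "AE x in lebesgue. g (t, x) = f (t, x) \<bullet> i" by eventually_elim simp
      moreover have "(\<lambda>x. g (t, x)) \<in> borel_measurable lebesgue"
      proof (rule measurable_completion)
        have "g \<in> borel_measurable borel" using g(1) by simp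
        moreover have "(\<lambda>x. (t, x)) \<in> borel_measurable borel"
          by (intro borel_measurable_continuous_onI continuous_intros)
        ultimately have "(\<lambda>x. g (t, x)) \<in> borel_measurable borel" by (rule measurable_compose[rotated])
        thus "(\<lambda>x. g (t, x)) \<in> borel_measurable lborel" by simp
      qed
      ultimately show "(\<lambda>x. f (t, x) \<bullet> i) \<in> borel_measurable lebesgue"
        by (rule borel_measurable_AE[rotated])
    qed
  qed
  hence "AE t in lebesgue. \<forall>i\<in>Basis. (\<lambda>x. f (t, x) \<bullet> i) \<in> borel_measurable lebesgue"
    by (simp add: AE_ball_countable countable_finite)
  thus ?thesis by eventually_elim (subst borel_measurable_euclidean_space, blast)
qed

lemma cylinder_lebesgue [measurable]: "(cylinder T :: (real \<times> (real^'d)) set) \<in> sets lebesgue"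
proof -
  have "open (cylinder T :: (real \<times> (real^'d)) set)" by (intro open_Times) auto
  thus ?thesis by (simp add: borel_open sets_completionI_sets)
qed

lemma AE_cylinder:
  assumes "AE z in lebesgue_on (cylinder T :: (real \<times> (real^'d)) set). P z"
  shows "AE t in lebesgue_on {0<..<T}. AE x in lebesgue. P (t, x)"
proof -
  have "AE z in lebesgue. z \<in> (cylinder T :: (real \<times> (real^'d)) set) \<longrightarrow> P z"
    using assms by (subst (asm) AE_restrict_space_iff) auto
  from AE_lebesgue_prod[OF this] show ?thesis
    by (subst AE_restrict_space_iff) auto
qed

lemma nn_integral_cylinder:
  fixes f :: "real \<times> (real^'d) \<Rightarrow> ennreal"
  assumes "f \<in> borel_measurable (lebesgue_on (cylinder T))"
  shows "(\<integral>\<^sup>+z. f z \<partial>lebesgue_on (cylinder T)) = (\<integral>\<^sup>+t. (\<integral>\<^sup>+x. f (t, x) \<partial>lebesgue) \<partial>lebesgue_on {0<..<T})"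
    and "(\<lambda>t. \<integral>\<^sup>+x. f (t, x) \<partial>lebesgue) \<in> borel_measurable (lebesgue_on {0<..<T})"
proof -
  have m: "(\<lambda>z. f z * indicator (cylinder T) z) \<in> borel_measurable lebesgue"
    using assms by (subst (asm) borel_measurable_restrict_space_iff_ennreal) auto
  have e: "(\<integral>\<^sup>+x. f (t, x) * indicator (cylinder T) (t, x) \<partial>lebesgue) = (\<integral>\<^sup>+x. f (t, x) \<partial>lebesgue) * indicator {0<..<T} t" for t
    by (auto simp: indicator_def)
  show "(\<integral>\<^sup>+z. f z \<partial>lebesgue_on (cylinder T)) = (\<integral>\<^sup>+t. (\<integral>\<^sup>+x. f (t, x) \<partial>lebesgue) \<partial>lebesgue_on {0<..<T})"
    using nn_integral_lebesgue_prod(1)[OF m] unfolding e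
    by (simp add: nn_integral_restrict_space)
  show "(\<lambda>t. \<integral>\<^sup>+x. f (t, x) \<partial>lebesgue) \<in> borel_measurable (lebesgue_on {0<..<T})"
    using nn_integral_lebesgue_prod(2)[OF m] unfolding e
    by (subst borel_measurable_restrict_space_iff_ennreal) auto
qed

lemma cylinder_section_measurable:
  fixes f :: "real \<times> (real^'d) \<Rightarrow> 'b::euclidean_space"
  assumes f: "f \<in> borel_measurable (lebesgue_on (cylinder T))"
  shows "AE t in lebesgue_on {0<..<T}. (\<lambda>x. f (t, x)) \<in> borel_measurable lebesgue"
proof -
  have "(\<lambda>z. if z \<in> cylinder T then f z else 0) \<in> borel_measurable lebesgue"
    using f by (subst borel_measurable_if) auto
  from section_lebesgue_measurable[OF this]
  have "AE t in lebesgue_on {0<..<T}. (\<lambda>x. if (t, x) \<in> cylinder T then f (t, x) else 0) \<in> borel_measurable lebesgue"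
    by (subst AE_restrict_space_iff) auto
  thus ?thesis by (rule AE_mp) (intro AE_I2 impI, simp)
qed

lemma powr_le_linear:
  assumes "0 \<le> (F::real)" "F \<le> B" "1 \<le> q"
  shows "F powr q \<le> B powr (q - 1) * F"
proof (cases "F = 0")
  case False
  hence "F > 0" using assms by simp
  have "F powr q = F powr (q - 1) * F" using \<open>F > 0\<close> powr_add[of F "q - 1" 1] by simp
  also have "\<dots> \<le> B powr (q - 1) * F" using assms by (intro mult_right_mono powr_mono2) auto
  finally show ?thesis .
qed simp

text \<open>If the integrals over the slices are bounded by \<open>B\<close>, then their powers with exponent \<open>q\<close> are bounded by
\<open>B\<close> to the power \<open>q - 1\<close> times the integrals themselves. So \<open>L\<^sup>1\<close> convergence upgrades to all \<open>q\<close>.\<close>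

lemma Lq_L1_bounded_slices:
  fixes f :: "real \<times> (real^'d) \<Rightarrow> 'b::euclidean_space"
  assumes f: "f \<in> borel_measurable (lebesgue_on (cylinder T))"
    and K: "compact K" and q: "1 \<le> q" and B: "0 \<le> B"
    and bd: "AE t in lebesgue_on {0<..<T}. (\<integral>\<^sup>+x. ennreal (norm (f (t, x))) \<partial>lebesgue_on K) \<le> ennreal B"
  shows "in_Lq_L1 q T K f"
    and "(LINT t|lebesgue_on {0<..<T}. (LINT x|lebesgue_on K. norm (f (t, x))) powr q)
      \<le> B powr (q - 1) * (LINT z|lebesgue_on (cylinder T). indicator ({0<..<T} \<times> K) z * norm (f z))"
proof -
  let ?N = "lebesgue_on {0<..<T}"
  have KL: "K \<in> sets lebesgue" using K by (simp add: compact_imp_closed lmeasurable_compact fmeasurableD)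
  have PL: "{0<..<T} \<times> K \<in> sets lebesgue"
    using K by (intro sets_completionI_sets) (auto intro!: borel_Times simp: compact_imp_closed borel_closed)
  have fin: "finite_measure ?N"
    by (rule finite_measure_lebesgue_on) simp
  have nm: "(\<lambda>z. ennreal (norm (f z)) * indicator ({0<..<T} \<times> K) z) \<in> borel_measurable (lebesgue_on (cylinder T))"
  proof -
    have "{0<..<T} \<times> K \<in> sets (lebesgue_on (cylinder T))"
      using PL by (subst sets_restrict_space_iff) auto
    thus ?thesis using f by measurable
  qed
  note Ton = nn_integral_cylinder[OF nm]
  define G where "G t = (\<integral>\<^sup>+x. ennreal (norm (f (t, x))) \<partial>lebesgue_on K)" for t
  have G: "(\<integral>\<^sup>+x. ennreal (norm (f (t, x))) * indicator ({0<..<T} \<times> K) (t, x) \<partial>lebesgue) = G t" if "t \<in> {0<..<T}" for t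
  proof -
    have "(\<integral>\<^sup>+x. ennreal (norm (f (t, x))) * indicator ({0<..<T} \<times> K) (t, x) \<partial>lebesgue)
      = (\<integral>\<^sup>+x. ennreal (norm (f (t, x))) * indicator K x \<partial>lebesgue)"
      using that by (intro nn_integral_cong) (auto simp: indicator_def)
    thus ?thesis using KL by (simp add: G_def nn_integral_restrict_space)
  qed
  have Gm: "G \<in> borel_measurable ?N"
    using Ton(2) by (subst (asm) measurable_cong[OF G]) auto
  have fsec: "AE t in ?N. (\<lambda>x. f (t, x)) \<in> borel_measurable (lebesgue_on K)"
    using cylinder_section_measurable[OF f] by eventually_elim (rule measurable_restrict_space1)
  define F where "F t = (LINT x|lebesgue_on K. norm (f (t, x)))" for t
  have good: "AE t in ?N. integrable (lebesgue_on K) (\<lambda>x. f (t, x)) \<and> ennreal (F t) = G t \<and> 0 \<le> F t \<and> F t \<le> B"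
    using fsec bd
  proof eventually_elim
    fix t assume m: "(\<lambda>x. f (t, x)) \<in> borel_measurable (lebesgue_on K)"
      and b: "(\<integral>\<^sup>+x. ennreal (norm (f (t, x))) \<partial>lebesgue_on K) \<le> ennreal B"
    have i: "integrable (lebesgue_on K) (\<lambda>x. f (t, x))"
      using m b by (intro integrableI_bounded) (auto intro: le_less_trans)
    have e: "ennreal (F t) = G t" unfolding F_def G_def using i by (intro nn_integral_eq_integral[symmetric]) auto
    moreover have F0: "0 \<le> F t" unfolding F_def by simp
    moreover have "F t \<le> B" using e b B by (simp add: G_def[symmetric]) (metis B ennreal_le_iff)
    ultimately show "integrable (lebesgue_on K) (\<lambda>x. f (t, x)) \<and> ennreal (F t) = G t \<and> 0 \<le> F t \<and> F t \<le> B"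
      using i by blast
  qed
  \<comment> \<open>\<open>F\<close> is a Bochner integral over the slice and equals the measurable function \<open>G\<close> only for almost every time.\<close>
  have Fm: "F \<in> borel_measurable ?N"
  proof -
    have "(\<lambda>t. enn2real (G t)) \<in> borel_measurable ?N" using Gm by measurable
    hence "(\<lambda>t. if t \<in> {0<..<T} then enn2real (G t) else 0) \<in> borel_measurable lebesgue"
      by (subst borel_measurable_if) auto
    moreover have "AE t in lebesgue. (if t \<in> {0<..<T} then enn2real (G t) else 0) = (if t \<in> {0<..<T} then F t else 0)"
    proof -
      have "AE t in ?N. enn2real (G t) = F t" using good by eventually_elim (metis enn2real_ennreal)
      thus ?thesis by (subst (asm) AE_restrict_space_iff) (auto elim: eventually_mono)
    qed
    ultimately have "(\<lambda>t. if t \<in> {0<..<T} then F t else 0) \<in> borel_measurable lebesgue" by (rule borel_measurable_AE)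
    thus ?thesis by (subst (asm) borel_measurable_if) auto
  qed
  have Fq: "AE t in ?N. F t powr q \<le> B powr (q - 1) * F t \<and> F t powr q \<le> B powr q"
    using good by eventually_elim (use q powr_le_linear in \<open>auto intro: powr_mono2\<close>)
  have iFq: "integrable ?N (\<lambda>t. F t powr q)"
    using Fm Fq by (intro finite_measure.integrable_const_bound[OF fin, of _ "B powr q"]) auto
  have iF: "integrable ?N F"
    using Fm good by (intro finite_measure.integrable_const_bound[OF fin, of _ B]) (auto elim: eventually_mono)
  show "in_Lq_L1 q T K f"
    unfolding in_Lq_L1_def
  proof (intro conjI)
    show "f \<in> borel_measurable (lebesgue_on ({0<..<T} \<times> K))"
      using f by (rule measurable_restrict_mono) auto
    show "AE t in ?N. integrable (lebesgue_on K) (\<lambda>x. f (t, x))" using good by eventually_elim blast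
    show "integrable ?N (\<lambda>t. (LINT x|lebesgue_on K. norm (f (t, x))) powr q)" using iFq by (simp add: F_def)
  qed
  have "(\<integral>\<^sup>+z. ennreal (indicator ({0<..<T} \<times> K) z * norm (f z)) \<partial>lebesgue_on (cylinder T))
      = (\<integral>\<^sup>+z. ennreal (norm (f z)) * indicator ({0<..<T} \<times> K) z \<partial>lebesgue_on (cylinder T))"
    by (intro nn_integral_cong) (auto simp: indicator_def)
  also have "\<dots> = (\<integral>\<^sup>+t. G t \<partial>?N)" unfolding Ton(1) using G by (intro nn_integral_cong) auto
  also have "\<dots> = (\<integral>\<^sup>+t. ennreal (F t) \<partial>?N)" using good by (intro nn_integral_cong_AE) (auto elim: eventually_mono)
  also have "\<dots> = ennreal (LINT t|?N. F t)"
    using iF good by (intro nn_integral_eq_integral) (auto elim: eventually_mono)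
  finally have nn: "(\<integral>\<^sup>+z. ennreal (indicator ({0<..<T} \<times> K) z * norm (f z)) \<partial>lebesgue_on (cylinder T)) = ennreal (LINT t|?N. F t)" .
  have im: "(\<lambda>z. indicator ({0<..<T} \<times> K) z * norm (f z)) \<in> borel_measurable (lebesgue_on (cylinder T))"
  proof -
    have "{0<..<T} \<times> K \<in> sets (lebesgue_on (cylinder T))"
      using PL by (subst sets_restrict_space_iff) auto
    thus ?thesis using f by measurable
  qed
  have eqF: "(LINT z|lebesgue_on (cylinder T). indicator ({0<..<T} \<times> K) z * norm (f z)) = (LINT t|?N. F t)"
  proof -
    have "0 \<le> (LINT t|?N. F t)" by (intro Bochner_Integration.integral_nonneg) (simp add: F_def)
    thus ?thesis using nn im by (subst integral_eq_nn_integral) auto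
  qed
  have "(LINT t|?N. F t powr q) \<le> (LINT t|?N. B powr (q - 1) * F t)"
    using iFq iF Fq by (intro integral_mono_AE) (auto elim: eventually_mono)
  thus "(LINT t|lebesgue_on {0<..<T}. (LINT x|lebesgue_on K. norm (f (t, x))) powr q)
      \<le> B powr (q - 1) * (LINT z|lebesgue_on (cylinder T). indicator ({0<..<T} \<times> K) z * norm (f z))"
  proof -
    have Fl: "F = (\<lambda>t. LINT x|lebesgue_on K. norm (f (t, x)))" by (rule ext) (simp add: F_def)
    assume "(LINT t|?N. F t powr q) \<le> (LINT t|?N. B powr (q - 1) * F t)"
    thus ?thesis unfolding eqF using iF by (simp add: Fl)
  qed
qed

text \<open>Fatou's lemma on almost every slice. It transfers bounds that are uniform in time from the sequence to the
barycenter.\<close>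

lemma slice_bound_limit:
  fixes f :: "nat \<Rightarrow> real \<times> (real^'d) \<Rightarrow> 'b::euclidean_space"
  assumes f: "\<And>n. f n \<in> borel_measurable (lebesgue_on (cylinder T))"
    and K: "K \<in> sets lebesgue"
    and lim: "AE z in lebesgue_on (cylinder T). (\<lambda>n. f n z) \<longlonglongrightarrow> g z"
    and bd: "\<And>n. AE t in lebesgue_on {0<..<T}. (\<integral>\<^sup>+x. ennreal (norm (f n (t, x))) \<partial>lebesgue_on K) \<le> ennreal B"
  shows "AE t in lebesgue_on {0<..<T}. (\<integral>\<^sup>+x. ennreal (norm (g (t, x))) \<partial>lebesgue_on K) \<le> ennreal B"
proof -
  have 1: "AE t in lebesgue_on {0<..<T}. \<forall>n. (\<lambda>x. f n (t, x)) \<in> borel_measurable lebesgue"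
    using cylinder_section_measurable[OF f] by (subst AE_all_countable) blast
  have 2: "AE t in lebesgue_on {0<..<T}. \<forall>n. (\<integral>\<^sup>+x. ennreal (norm (f n (t, x))) \<partial>lebesgue_on K) \<le> ennreal B"
    using bd by (subst AE_all_countable) blast
  show ?thesis using 1 2 AE_cylinder[OF lim]
  proof eventually_elim
    fix t assume m: "\<forall>n. (\<lambda>x. f n (t, x)) \<in> borel_measurable lebesgue"
      and b: "\<forall>n. (\<integral>\<^sup>+x. ennreal (norm (f n (t, x))) \<partial>lebesgue_on K) \<le> ennreal B"
      and l: "AE x in lebesgue. (\<lambda>n. f n (t, x)) \<longlonglongrightarrow> g (t, x)"
    have mK: "(\<lambda>x. f n (t, x)) \<in> borel_measurable (lebesgue_on K)" for n
      using m by (intro measurable_restrict_space1) blast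
    have lK: "AE x in lebesgue_on K. (\<lambda>n. f n (t, x)) \<longlonglongrightarrow> g (t, x)"
      using l K by (subst AE_restrict_space_iff) (auto elim: eventually_mono)
    have "(\<integral>\<^sup>+x. ennreal (norm (g (t, x))) \<partial>lebesgue_on K) = (\<integral>\<^sup>+x. liminf (\<lambda>n. ennreal (norm (f n (t, x)))) \<partial>lebesgue_on K)"
    proof (rule nn_integral_cong_AE)
      show "AE x in lebesgue_on K. ennreal (norm (g (t, x))) = liminf (\<lambda>n. ennreal (norm (f n (t, x))))"
        using lK
      proof eventually_elim
        fix x assume "(\<lambda>n. f n (t, x)) \<longlonglongrightarrow> g (t, x)"
        hence "(\<lambda>n. ennreal (norm (f n (t, x)))) \<longlonglongrightarrow> ennreal (norm (g (t, x)))"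
          by (intro tendsto_ennrealI tendsto_norm)
        thus "ennreal (norm (g (t, x))) = liminf (\<lambda>n. ennreal (norm (f n (t, x))))"
          by (metis lim_imp_Liminf sequentially_bot)
      qed
    qed
    also have "\<dots> \<le> liminf (\<lambda>n. \<integral>\<^sup>+x. ennreal (norm (f n (t, x))) \<partial>lebesgue_on K)"
      using mK by (intro nn_integral_liminf) measurable
    also have "\<dots> \<le> ennreal B"
      using b by (intro Liminf_le) auto
    finally show "(\<integral>\<^sup>+x. ennreal (norm (g (t, x))) \<partial>lebesgue_on K) \<le> ennreal B" .
  qed
qed

lemma converges_in_Lq_L1loc_I:
  fixes f :: "nat \<Rightarrow> real \<times> (real^'d) \<Rightarrow> 'b::euclidean_space"
  assumes f: "\<And>n. f n \<in> borel_measurable (lebesgue_on (cylinder T))"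
    and g: "g \<in> borel_measurable (lebesgue_on (cylinder T))"
    and q: "1 \<le> q"
    and bd: "\<And>K. compact K \<Longrightarrow> \<exists>B\<ge>0. (\<forall>n. AE t in lebesgue_on {0<..<T}. (\<integral>\<^sup>+x. ennreal (norm (f n (t, x))) \<partial>lebesgue_on K) \<le> ennreal B)
        \<and> (AE t in lebesgue_on {0<..<T}. (\<integral>\<^sup>+x. ennreal (norm (g (t, x))) \<partial>lebesgue_on K) \<le> ennreal B)"
    and L1: "\<And>K. compact K \<Longrightarrow> (\<lambda>n. LINT z|lebesgue_on (cylinder T). indicator ({0<..<T} \<times> K) z * norm (f n z - g z)) \<longlonglongrightarrow> 0"
  shows "converges_in_Lq_L1loc q T f g"
  unfolding converges_in_Lq_L1loc_def
proof (intro allI impI conjI)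
  fix K :: "(real^'d) set" assume K: "compact K"
  obtain B where B: "B \<ge> 0"
    "\<And>n. AE t in lebesgue_on {0<..<T}. (\<integral>\<^sup>+x. ennreal (norm (f n (t, x))) \<partial>lebesgue_on K) \<le> ennreal B"
    "AE t in lebesgue_on {0<..<T}. (\<integral>\<^sup>+x. ennreal (norm (g (t, x))) \<partial>lebesgue_on K) \<le> ennreal B"
    using bd[OF K] by blast
  show "in_Lq_L1 q T K (f n)" for n by (rule Lq_L1_bounded_slices(1)[OF f K q B(1) B(2)])
  show "in_Lq_L1 q T K g" by (rule Lq_L1_bounded_slices(1)[OF g K q B(1) B(3)])
  have fg: "(\<lambda>z. f n z - g z) \<in> borel_measurable (lebesgue_on (cylinder T))" for n using f g by measurable
  have bfg: "AE t in lebesgue_on {0<..<T}. (\<integral>\<^sup>+x. ennreal (norm (f n (t, x) - g (t, x))) \<partial>lebesgue_on K) \<le> ennreal (2 * B)" for n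
    using B(2)[of n] B(3) cylinder_section_measurable[OF f, of n] cylinder_section_measurable[OF g]
  proof eventually_elim
    fix t assume 1: "(\<integral>\<^sup>+x. ennreal (norm (f n (t, x))) \<partial>lebesgue_on K) \<le> ennreal B"
      and 2: "(\<integral>\<^sup>+x. ennreal (norm (g (t, x))) \<partial>lebesgue_on K) \<le> ennreal B"
      and m: "(\<lambda>x. f n (t, x)) \<in> borel_measurable lebesgue" "(\<lambda>x. g (t, x)) \<in> borel_measurable lebesgue"
    have [measurable]: "(\<lambda>x. f n (t, x)) \<in> borel_measurable (lebesgue_on K)" "(\<lambda>x. g (t, x)) \<in> borel_measurable (lebesgue_on K)"
      using m by (auto intro: measurable_restrict_space1)
    have "(\<integral>\<^sup>+x. ennreal (norm (f n (t, x) - g (t, x))) \<partial>lebesgue_on K)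
       \<le> (\<integral>\<^sup>+x. ennreal (norm (f n (t, x))) + ennreal (norm (g (t, x))) \<partial>lebesgue_on K)"
      by (intro nn_integral_mono) (simp add: ennreal_plus[symmetric] norm_triangle_ineq4 del: ennreal_plus)
    also have "\<dots> = (\<integral>\<^sup>+x. ennreal (norm (f n (t, x))) \<partial>lebesgue_on K) + (\<integral>\<^sup>+x. ennreal (norm (g (t, x))) \<partial>lebesgue_on K)"
      by (rule nn_integral_add) measurable
    also have "\<dots> \<le> ennreal B + ennreal B" by (rule add_mono[OF 1 2])
    also have "\<dots> = ennreal (2 * B)" using B(1) by (simp add: ennreal_plus[symmetric] del: ennreal_plus)
    finally show "(\<integral>\<^sup>+x. ennreal (norm (f n (t, x) - g (t, x))) \<partial>lebesgue_on K) \<le> ennreal (2 * B)" .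
  qed
  have B2: "0 \<le> 2 * B" using B(1) by simp
  define X where "X n = (LINT t|lebesgue_on {0<..<T}. (LINT x|lebesgue_on K. norm (f n (t, x) - g (t, x))) powr q)" for n
  have X0: "0 \<le> X n" for n unfolding X_def by (intro Bochner_Integration.integral_nonneg) simp
  have XY: "X n \<le> (2 * B) powr (q - 1) * (LINT z|lebesgue_on (cylinder T). indicator ({0<..<T} \<times> K) z * norm (f n z - g z))" for n
    unfolding X_def by (rule Lq_L1_bounded_slices(2)[OF fg K q B2 bfg])
  have "X \<longlonglongrightarrow> 0"
  proof (rule tendsto_sandwich)
    show "\<forall>\<^sub>F n in sequentially. 0 \<le> X n" using X0 by simp
    show "\<forall>\<^sub>F n in sequentially. X n \<le> (2 * B) powr (q - 1) * (LINT z|lebesgue_on (cylinder T). indicator ({0<..<T} \<times> K) z * norm (f n z - g z))"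
      using XY by simp
    show "(\<lambda>n. 0 :: real) \<longlonglongrightarrow> 0" by simp
    show "(\<lambda>n. (2 * B) powr (q - 1) * (LINT z|lebesgue_on (cylinder T). indicator ({0<..<T} \<times> K) z * norm (f n z - g z))) \<longlonglongrightarrow> 0"
      using tendsto_mult_left[OF L1[OF K], of "(2 * B) powr (q - 1)"] by simp
  qed
  hence "(\<lambda>n. X n powr (1 / q)) \<longlonglongrightarrow> 0"
    using X0 q by (intro tendsto_zero_powrI[where b = "1 / q"]) auto
  thus "(\<lambda>n. Lq_L1_norm q T K (\<lambda>z. f n z - g z)) \<longlonglongrightarrow> 0"
    by (simp add: Lq_L1_norm_def X_def)
qed

section \<open>A radial test field with logarithmic cutoff\<close>

lemma square_pos_part_deriv:
  "((\<lambda>u::real. (max 0 u)\<^sup>2) has_real_derivative 2 * max 0 u) (at u)"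
proof -
  consider "u > 0" | "u < 0" | "u = 0" by linarith
  thus ?thesis
  proof cases
    case 1
    have "((\<lambda>u::real. u\<^sup>2) has_real_derivative 2 * u) (at u)" by (auto intro!: derivative_eq_intros)
    hence "((\<lambda>u::real. (max 0 u)\<^sup>2) has_real_derivative 2 * u) (at u)"
      by (rule has_field_derivative_transform_within_open[of _ _ _ "{0<..}"]) (use 1 in auto)
    thus ?thesis using 1 by simp
  next
    case 2
    have "((\<lambda>u::real. 0) has_real_derivative 0) (at u)" by simp
    hence "((\<lambda>u::real. (max 0 u)\<^sup>2) has_real_derivative 0) (at u)"
      by (rule has_field_derivative_transform_within_open[of _ _ _ "{..<0}"]) (use 2 in auto)
    thus ?thesis using 2 by simp
  next
    case 3
    have "((\<lambda>h::real. (max 0 (0 + h))\<^sup>2 / h) \<longlongrightarrow> 0) (at 0)"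
    proof (rule Lim_null_comparison)
      show "\<forall>\<^sub>F h::real in at 0. norm ((max 0 (0 + h))\<^sup>2 / h) \<le> \<bar>h\<bar>"
        by (rule always_eventually) (auto simp: max_def power2_eq_square)
      show "((\<lambda>h::real. \<bar>h\<bar>) \<longlongrightarrow> 0) (at 0)" by (auto intro!: tendsto_eq_intros)
    qed
    thus ?thesis using 3 by (simp add: DERIV_def)
  qed
qed

text \<open>The function \<open>ln (1 + |x|\<^sup>2)\<close> varies by a bounded amount over dyadic annuli, so \<open>|x|\<close> times the gradient
of the cutoff is of order \<open>\<epsilon>\<close> everywhere although the support is compact. The test field contains its
square, which is continuously differentiable.\<close>

definition log_cutoff :: "real \<Rightarrow> 'a::euclidean_space \<Rightarrow> real"
  where "log_cutoff \<epsilon> x = max 0 (1 - \<epsilon> * ln (1 + x \<bullet> x))"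

text \<open>Vanishing at \<open>t = 0\<close> removes the initial momenta from the weak formulations; they are not assumed to
converge.\<close>

definition time_bump :: "real \<Rightarrow> real \<Rightarrow> real"
  where "time_bump b t = t * (max 0 (b - t))\<^sup>2"

definition time_bump' :: "real \<Rightarrow> real \<Rightarrow> real"
  where "time_bump' b t = (max 0 (b - t))\<^sup>2 - 2 * t * max 0 (b - t)"

text \<open>Its spatial gradient is \<open>\<psi> \<theta> (\<theta> I - 4 \<epsilon> x \<otimes> x / (1 + |x|\<^sup>2))\<close>, where \<open>\<psi>\<close> is the time bump and \<open>\<theta>\<close>
the logarithmic cutoff.\<close>

definition radial_field :: "real \<Rightarrow> real \<Rightarrow> real \<times> (real^'d) \<Rightarrow> real^'d"
  where "radial_field b \<epsilon> z = (time_bump b (fst z) * (log_cutoff \<epsilon> (snd z))\<^sup>2) *\<^sub>R snd z"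

definition radial_field' :: "real \<Rightarrow> real \<Rightarrow> real \<times> (real^'d) \<Rightarrow> real \<times> (real^'d) \<Rightarrow> real^'d"
  where "radial_field' b \<epsilon> z h =
     (time_bump' b (fst z) * (log_cutoff \<epsilon> (snd z))\<^sup>2 * fst h
       - 4 * \<epsilon> * time_bump b (fst z) * log_cutoff \<epsilon> (snd z) * (snd z \<bullet> snd h) / (1 + snd z \<bullet> snd z)) *\<^sub>R snd z
     + (time_bump b (fst z) * (log_cutoff \<epsilon> (snd z))\<^sup>2) *\<^sub>R snd h"

lemma one_plus_inner_pos: "0 < 1 + x \<bullet> (x :: 'a::real_inner)"
  using inner_ge_zero[of x] by linarith

lemma time_bump_deriv: "(time_bump b has_real_derivative time_bump' b t) (at t)"
proof -
  have "((\<lambda>t. (max 0 (b - t))\<^sup>2) has_real_derivative (2 * max 0 (b - t)) * (-1)) (at t)"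
    by (rule DERIV_chain2[OF square_pos_part_deriv]) (auto intro!: derivative_eq_intros)
  from DERIV_mult[OF DERIV_ident this] show ?thesis
    unfolding time_bump_def[abs_def] time_bump'_def by (simp add: algebra_simps)
qed

lemma radial_field_has_derivative:
  "(radial_field b \<epsilon> has_derivative radial_field' b \<epsilon> z) (at z)"
proof -
  obtain t x where z: "z = (t, x)" by (cases z)
  have p: "0 < 1 + x \<bullet> x" by (rule one_plus_inner_pos)
  have 1: "((\<lambda>z. time_bump b (fst z)) has_derivative (\<lambda>h. fst h * time_bump' b t)) (at z)"
  proof -
    have "(time_bump b has_derivative (\<lambda>h. h * time_bump' b t)) (at (fst z))"
      using time_bump_deriv[of b t] by (simp add: has_field_derivative_def z mult_commute_abs)
    from has_derivative_compose[OF has_derivative_fst[OF has_derivative_ident] this] show ?thesis by simp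
  qed
  have 2: "((\<lambda>z. 1 - \<epsilon> * ln (1 + snd z \<bullet> snd z)) has_derivative (\<lambda>h. - \<epsilon> * (2 * (x \<bullet> snd h)) / (1 + x \<bullet> x))) (at z)"
    by (rule derivative_eq_intros refl | use p in \<open>simp add: z; fail\<close>)+
      (use p in \<open>simp add: z fun_eq_iff inner_commute field_simps\<close>)
  have 3: "((\<lambda>z. (log_cutoff \<epsilon> (snd z))\<^sup>2) has_derivative
     (\<lambda>h. (- \<epsilon> * (2 * (x \<bullet> snd h)) / (1 + x \<bullet> x)) * (2 * log_cutoff \<epsilon> x))) (at z)"
  proof -
    have "((\<lambda>u::real. (max 0 u)\<^sup>2) has_derivative (\<lambda>h. h * (2 * log_cutoff \<epsilon> x))) (at (1 - \<epsilon> * ln (1 + snd z \<bullet> snd z)))"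
      using square_pos_part_deriv[of "1 - \<epsilon> * ln (1 + x \<bullet> x)"]
      by (simp add: has_field_derivative_def z log_cutoff_def mult_commute_abs)
    from has_derivative_compose[OF 2 this] show ?thesis by (simp add: log_cutoff_def)
  qed
  have 4: "(snd has_derivative snd) (at z)" by (rule has_derivative_snd[OF has_derivative_ident])
  from has_derivative_scaleR[OF has_derivative_mult[OF 1 3] 4]
  show ?thesis unfolding radial_field_def[abs_def]
    by (rule has_derivative_eq_rhs) (simp add: fun_eq_iff radial_field'_def z algebra_simps)
qed

lemma radial_field_frechet: "frechet_derivative (radial_field b \<epsilon>) (at z) = radial_field' b \<epsilon> z"
  using frechet_derivative_at[OF radial_field_has_derivative] by metis

lemma log_cutoff_continuous [continuous_intros]:
  assumes "continuous_on A f" shows "continuous_on A (\<lambda>z. log_cutoff \<epsilon> (f z))"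
  unfolding log_cutoff_def
  by (intro continuous_intros assms) (intro ballI, rule less_imp_neq[THEN not_sym], rule one_plus_inner_pos)

lemma log_cutoff_bounds: "0 \<le> \<epsilon> \<Longrightarrow> 0 \<le> log_cutoff \<epsilon> x" "0 \<le> \<epsilon> \<Longrightarrow> log_cutoff \<epsilon> x \<le> 1"
  by (auto simp: log_cutoff_def)

lemma log_cutoff_support:
  assumes "\<epsilon> > 0" "norm x > exp (1 / \<epsilon>)" shows "log_cutoff \<epsilon> x = 0"
proof -
  have e: "exp (1 / \<epsilon>) \<ge> 1" using assms(1) by simp
  have "exp (1 / \<epsilon>) \<le> norm x * norm x" using assms(2) e
    by (smt (verit, best) mult_le_cancel_left1)
  hence "exp (1 / \<epsilon>) \<le> 1 + x \<bullet> x" by (simp add: dot_square_norm power2_eq_square)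
  hence "1 / \<epsilon> \<le> ln (1 + x \<bullet> x)" using one_plus_inner_pos[of x] by (simp add: ln_ge_iff)
  hence "1 - \<epsilon> * ln (1 + x \<bullet> x) \<le> 0" using assms(1) by (simp add: field_simps)
  thus ?thesis by (simp add: log_cutoff_def)
qed

lemma radial_field_C1c:
  assumes "\<epsilon> > 0" "0 < b" "b < T"
  shows "radial_field b \<epsilon> \<in> (C1c (cylinder0 T) :: (real \<times> (real^'d) \<Rightarrow> real^'d) set)"
proof -
  let ?\<phi> = "radial_field b \<epsilon> :: real \<times> (real^'d) \<Rightarrow> real^'d"
  let ?D = "\<lambda>z :: real \<times> (real^'d). Blinfun (radial_field' b \<epsilon> z)"
  have bl: "bounded_linear (radial_field' b \<epsilon> z)" for z :: "real \<times> (real^'d)"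
    using radial_field_has_derivative has_derivative_bounded_linear by blast
  have ap: "blinfun_apply (?D z) = radial_field' b \<epsilon> z" for z
    using bl by (simp add: bounded_linear_Blinfun_apply)
  have c: "continuous_on (cylinder0 T) ?D"
  proof (rule continuous_on_blinfun_componentwise)
    fix i :: "real \<times> (real^'d)"
    have "1 + x \<bullet> x \<noteq> 0" for x :: "real^'d" using one_plus_inner_pos[of x] by simp
    thus "continuous_on (cylinder0 T) (\<lambda>z. blinfun_apply (?D z) i)"
      unfolding ap radial_field'_def time_bump_def time_bump'_def
      by (intro continuous_intros) auto
  qed
  let ?K = "{0..b} \<times> cball (0 :: real^'d) (exp (1 / \<epsilon>))"
  have "compact ?K" by (intro compact_Times) auto
  moreover have "?K \<subseteq> cylinder0 T" using assms by auto
  moreover have "?\<phi> z = 0" if "z \<in> cylinder0 T - ?K" for z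
  proof -
    obtain t x where z: "z = (t, x)" by (cases z)
    show ?thesis
    proof (cases "t > b")
      case True thus ?thesis by (simp add: z radial_field_def time_bump_def)
    next
      case False
      hence "norm x > exp (1 / \<epsilon>)" using that by (auto simp: z dist_norm)
      thus ?thesis using log_cutoff_support[OF assms(1), of x] by (simp add: z radial_field_def)
    qed
  qed
  ultimately have supp: "\<exists>K. compact K \<and> K \<subseteq> cylinder0 T \<and> (\<forall>z\<in>cylinder0 T - K. ?\<phi> z = 0)" by blast
  have der: "(?\<phi> has_derivative blinfun_apply (?D z)) (at z within cylinder0 T)" for z
    unfolding ap by (rule has_derivative_at_withinI[OF radial_field_has_derivative])
  show ?thesis unfolding C1c_def by (intro CollectI conjI supp exI[of _ ?D] ballI der c)
qed

text \<open>The contraction of the momentum flux with the spatial gradient of \<open>radial_field\<close>, without the common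
factor \<open>\<psi> \<theta>\<close>.\<close>

definition momentum_flux_form :: "real \<Rightarrow> real \<Rightarrow> real \<Rightarrow> real^'d \<Rightarrow> real \<Rightarrow> real^'d \<Rightarrow> real \<Rightarrow> real"
  where "momentum_flux_form \<gamma> \<theta> \<epsilon> x \<rho> m S =
     \<theta> * (kinetic 0 \<rho> m + real CARD('d) * pressure \<gamma> \<rho> S)
     - 4 * \<epsilon> * ((m \<bullet> x)\<^sup>2 / \<rho> + (x \<bullet> x) * pressure \<gamma> \<rho> S) / (1 + x \<bullet> x)"

lemma momentum_integrand_radial_field:
  fixes \<rho> S :: "real \<times> (real^'d) \<Rightarrow> real" and m :: "real \<times> (real^'d) \<Rightarrow> real^'d"
  assumes "\<rho> (t, x) > 0 \<or> \<rho> (t, x) = 0 \<and> m (t, x) = 0"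
  shows "momentum_integrand \<gamma> \<rho> m S (radial_field b \<epsilon>) (t, x) =
     time_bump' b t * (log_cutoff \<epsilon> x)\<^sup>2 * (m (t, x) \<bullet> x)
     + time_bump b t * log_cutoff \<epsilon> x * momentum_flux_form \<gamma> (log_cutoff \<epsilon> x) \<epsilon> x (\<rho> (t, x)) (m (t, x)) (S (t, x))"
proof -
  define \<theta> \<psi> where "\<theta> = log_cutoff \<epsilon> x" and "\<psi> = time_bump b t"
  define e where "e = 4 * \<epsilon> / (1 + x \<bullet> x)"
  let ?m = "m (t, x)"
  have dt: "?m \<bullet> d_t (radial_field b \<epsilon>) (t, x) = time_bump' b t * \<theta>\<^sup>2 * (?m \<bullet> x)"
    by (simp add: d_t_def radial_field_frechet radial_field'_def \<theta>_def)
  have comp: "radial_field' b \<epsilon> (t, x) (0, axis j 1) $ i = \<psi> * \<theta> * (\<theta> * (if i = j then 1 else 0) - e * (x $ i * x $ j))" for i j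
  proof -
    have 1: "x \<bullet> axis j 1 = x $ j" by (simp add: inner_axis)
    have 2: "(axis j 1 :: real^'d) $ i = (if i = j then 1 else 0)" by (simp add: axis_def)
    show ?thesis
      by (simp add: radial_field'_def 1 2 \<theta>_def \<psi>_def e_def power2_eq_square algebra_simps)
  qed
  have xx: "(\<Sum>i\<in>UNIV. x $ i * x $ i) = x \<bullet> x" by (simp add: inner_vec_def)
  have dv: "div_x (radial_field b \<epsilon>) (t, x) = \<psi> * \<theta> * (\<theta> * real CARD('d) - e * (x \<bullet> x))"
    unfolding div_x_def radial_field_frechet comp
    by (simp add: sum_distrib_left[symmetric] sum_subtractf xx)
  have mm: "outer ?m ?m \<bullet> jacobian_x (radial_field b \<epsilon>) (t, x) = \<psi> * \<theta> * (\<theta> * (?m \<bullet> ?m) - e * (?m \<bullet> x)\<^sup>2)"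
  proof -
    have "outer ?m ?m \<bullet> jacobian_x (radial_field b \<epsilon>) (t, x)
      = (\<Sum>i\<in>UNIV. \<Sum>j\<in>UNIV. ?m $ i * ?m $ j * (\<psi> * \<theta> * (\<theta> * (if i = j then 1 else 0) - e * (x $ i * x $ j))))"
      by (simp add: inner_vec_def outer_def jacobian_x_def radial_field_frechet comp)
    also have "\<dots> = (\<Sum>i\<in>UNIV. \<Sum>j\<in>UNIV. \<psi> * \<theta> * (\<theta> * (if i = j then ?m $ i * ?m $ i else 0))
         - \<psi> * \<theta> * e * ((?m $ i * x $ i) * (?m $ j * x $ j)))"
      by (intro sum.cong refl) (auto simp: algebra_simps)
    also have "\<dots> = \<psi> * \<theta> * (\<theta> * (\<Sum>i\<in>UNIV. ?m $ i * ?m $ i))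
         - \<psi> * \<theta> * e * ((\<Sum>i\<in>UNIV. ?m $ i * x $ i) * (\<Sum>j\<in>UNIV. ?m $ j * x $ j))"
      by (simp add: sum_subtractf sum_distrib_left[symmetric] sum_product)
    also have "\<dots> = \<psi> * \<theta> * (\<theta> * (?m \<bullet> ?m) - e * (?m \<bullet> x)\<^sup>2)"
      by (simp add: inner_vec_def power2_eq_square algebra_simps)
    finally show ?thesis .
  qed
  show ?thesis
  proof (cases "\<rho> (t, x) > 0")
    case True
    have fl: "momentum_flux_form \<gamma> \<theta> \<epsilon> x \<rho>' m' S' = \<theta> * ((m' \<bullet> m') / \<rho>' + real CARD('d) * pressure \<gamma> \<rho>' S')
        - e * ((m' \<bullet> x)\<^sup>2 / \<rho>' + (x \<bullet> x) * pressure \<gamma> \<rho>' S')" for \<rho>' S' and m' :: "real^'d"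
      by (simp add: momentum_flux_form_def kinetic_def e_def)
    from True show ?thesis unfolding momentum_integrand_def dt dv inner_scaleR_left mm
      unfolding \<theta>_def[symmetric] \<psi>_def[symmetric] fl
      by (simp add: algebra_simps diff_divide_distrib add_divide_distrib)
  next
    case False
    then show ?thesis using assms unfolding momentum_integrand_def dt
      by (auto simp: momentum_flux_form_def kinetic_def \<theta>_def[symmetric])
  qed
qed

section \<open>Convexity of the perturbed momentum flux\<close>

text \<open>\<open>momentum_flux_form\<close> plus \<open>kappa \<gamma> * \<epsilon>\<close> times the energy, see \<open>momentum_flux_form_eq\<close>. It is written so that
all coefficients are visibly nonnegative; \<open>kinetic y\<close> accommodates the rank-one term.\<close>

definition convexified_flux :: "real \<Rightarrow> real \<Rightarrow> real \<Rightarrow> real^'d \<Rightarrow> real \<Rightarrow> real^'d \<Rightarrow> real \<Rightarrow> real"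
  where "convexified_flux \<gamma> \<theta> \<epsilon> y \<rho> m S =
     (\<theta> + \<epsilon> * (2 * \<gamma> - 2)) * kinetic 0 \<rho> m + 4 * \<epsilon> * kinetic y \<rho> m
     + (\<theta> * real CARD('d) + \<epsilon> * (8 * c_v \<gamma> + 4 - 4 * (y \<bullet> y))) * pressure \<gamma> \<rho> S"

definition convexified_flux_tangent ::
    "real \<Rightarrow> real \<Rightarrow> real \<Rightarrow> real^'d \<Rightarrow> real \<Rightarrow> real^'d \<Rightarrow> real \<Rightarrow> real \<Rightarrow> real^'d \<Rightarrow> real \<Rightarrow> real"
  where "convexified_flux_tangent \<gamma> \<theta> \<epsilon> y r n \<sigma> \<rho> m S =
     (\<theta> + \<epsilon> * (2 * \<gamma> - 2)) * kinetic_tangent 0 r n \<rho> m + 4 * \<epsilon> * kinetic_tangent y r n \<rho> m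
     + (\<theta> * real CARD('d) + \<epsilon> * (8 * c_v \<gamma> + 4 - 4 * (y \<bullet> y))) * pressure_tangent \<gamma> r \<sigma> \<rho> S"

text \<open>Half of this number is at least \<open>4\<close>, and so is its product with \<open>c_v \<gamma>\<close>: this much energy compensates
the rank-one part of the gradient in the kinetic and in the pressure term.\<close>

abbreviation kappa :: "real \<Rightarrow> real" where "kappa \<gamma> \<equiv> 8 + 4 * (\<gamma> - 1)"

text \<open>Takes the denominator of \<open>x \<otimes> x / (1 + |x|\<^sup>2)\<close> into the vector, which becomes shorter than \<open>1\<close>.\<close>

abbreviation damped :: "real^'d \<Rightarrow> real^'d" where "damped x \<equiv> x /\<^sub>R sqrt (1 + x \<bullet> x)"

lemma damped_inner: "(m \<bullet> damped x)\<^sup>2 = (m \<bullet> x)\<^sup>2 / (1 + x \<bullet> x)"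
  "damped x \<bullet> damped x = (x \<bullet> x) / (1 + x \<bullet> x)"
proof -
  have s: "(sqrt (1 + x \<bullet> x))\<^sup>2 = 1 + x \<bullet> x" using one_plus_inner_pos[of x] by simp
  show "(m \<bullet> damped x)\<^sup>2 = (m \<bullet> x)\<^sup>2 / (1 + x \<bullet> x)"
    using s by (simp add: power_mult_distrib power_inverse divide_inverse)
  show "damped x \<bullet> damped x = (x \<bullet> x) / (1 + x \<bullet> x)"
    using s by (simp add: divide_inverse power2_eq_square[symmetric] power_inverse mult.assoc[symmetric] inverse_mult_distrib[symmetric])
qed

lemma norm_damped: "norm (damped x) \<le> 1"
proof -
  have "(norm (damped x))\<^sup>2 \<le> 1" using damped_inner(2)[of x] one_plus_inner_pos[of x]
    unfolding power2_norm_eq_inner by (simp only: damped_inner(2)) (simp add: divide_le_eq)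
  thus ?thesis by (simp add: abs_square_le_1)
qed

lemma momentum_flux_form_eq:
  fixes m :: "real^'d"
  assumes "\<gamma> > 1"
  shows "momentum_flux_form \<gamma> \<theta> \<epsilon> x \<rho> m S + kappa \<gamma> * \<epsilon> * (1/2 * kinetic 0 \<rho> m + c_v \<gamma> * pressure \<gamma> \<rho> S)
    = convexified_flux \<gamma> \<theta> \<epsilon> (damped x) \<rho> m S"
proof -
  have c: "kappa \<gamma> * c_v \<gamma> = 8 * c_v \<gamma> + 4" using assms by (simp add: c_v_def field_simps)
  define k where "k = (m \<bullet> x)\<^sup>2 / \<rho> / (1 + x \<bullet> x)"
  define l where "l = (x \<bullet> x) / (1 + x \<bullet> x)"
  have k: "kinetic (damped x) \<rho> m = kinetic 0 \<rho> m - k"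
    unfolding kinetic_def damped_inner by (simp add: k_def diff_divide_distrib mult.commute)
  have f: "momentum_flux_form \<gamma> \<theta> \<epsilon> x \<rho> m S = \<theta> * (kinetic 0 \<rho> m + real CARD('d) * pressure \<gamma> \<rho> S)
     - 4 * \<epsilon> * (k + l * pressure \<gamma> \<rho> S)"
  proof -
    have "4 * \<epsilon> * (A + X * P) / D = 4 * \<epsilon> * (A / D + X / D * P)" for A X P D :: real
      by (simp add: add_divide_distrib distrib_left)
    thus ?thesis unfolding momentum_flux_form_def k_def l_def by simp
  qed
  have "kappa \<gamma> * \<epsilon> * (1/2 * kinetic 0 \<rho> m + c_v \<gamma> * pressure \<gamma> \<rho> S)
     = (4 + 2 * (\<gamma> - 1)) * \<epsilon> * kinetic 0 \<rho> m + (kappa \<gamma> * c_v \<gamma>) * \<epsilon> * pressure \<gamma> \<rho> S"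
    by (simp add: algebra_simps)
  thus ?thesis unfolding convexified_flux_def k f c damped_inner l_def[symmetric] by (simp add: algebra_simps)
qed

lemma kinetic_nonneg_unit: 
  assumes "(\<rho>, m :: real^'d, S) \<in> energy_domain" "norm y \<le> 1" shows "kinetic y \<rho> m \<ge> 0"
proof -
  have "(m \<bullet> y)\<^sup>2 \<le> (m \<bullet> m) * (y \<bullet> y)" by (rule Cauchy_Schwarz_ineq)
  also have "\<dots> \<le> (m \<bullet> m) * 1"
    using assms(2) by (intro mult_left_mono) (auto simp: dot_square_norm power_le_one)
  finally show ?thesis using assms(1) by (auto simp: kinetic_def energy_domain_def)
qed

lemma inner_le_1: "norm (y :: 'a::real_inner) \<le> 1 \<Longrightarrow> y \<bullet> y \<le> 1"
  by (simp add: dot_square_norm power_le_one)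

lemma convexified_flux_nonneg:
  assumes "\<gamma> > 1" "0 \<le> \<theta>" "0 \<le> \<epsilon>" "norm y \<le> 1" "(\<rho>, m :: real^'d, S) \<in> energy_domain"
  shows "0 \<le> convexified_flux \<gamma> \<theta> \<epsilon> y \<rho> m S"
  using kinetic_nonneg[OF assms(5)] kinetic_nonneg_unit[OF assms(5,4)] pressure_nonneg[OF assms(5), of \<gamma>]
    inner_le_1[OF assms(4)] c_v_pos[OF assms(1)] assms(1,2,3)
  unfolding convexified_flux_def by (intro add_nonneg_nonneg mult_nonneg_nonneg) auto

lemma convexified_flux_tangent_at: "r > 0 \<Longrightarrow>
   convexified_flux_tangent \<gamma> \<theta> \<epsilon> y r n \<sigma> r n \<sigma> = convexified_flux \<gamma> \<theta> \<epsilon> y r n \<sigma>"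
proof -
  assume r: "r > 0"
  have "kinetic_tangent y r n r n = kinetic y r n" for y
    using r by (simp add: kinetic_tangent_def kinetic_def power2_eq_square field_simps)
  moreover have "pressure_tangent \<gamma> r \<sigma> r \<sigma> = pressure \<gamma> r \<sigma>"
    using r by (simp add: pressure_tangent_def)
  ultimately show ?thesis by (simp add: convexified_flux_tangent_def convexified_flux_def)
qed

text \<open>The gap of \<open>\<theta> tr F\<close>, where \<open>F\<close> is the momentum flux, controls the relative energy, since the trace contains
the full kinetic energy and at least one copy of the pressure. The gaps of the terms with factor \<open>\<epsilon>\<close> are
nonnegative and are dropped.\<close>

lemma convexified_flux_bregman:
  fixes u v :: "real \<times> (real^'d) \<times> real"
  assumes \<gamma>: "\<gamma> > 1" and u: "u = (r, n, \<sigma>)" "r > 0" and v: "v = (\<rho>, m, S)" "v \<in> energy_domain"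
    and \<theta>: "0 \<le> \<theta>" and \<epsilon>: "0 \<le> \<epsilon>" and y: "norm y \<le> 1"
  shows "convexified_flux_tangent \<gamma> \<theta> \<epsilon> y r n \<sigma> \<rho> m S + \<theta> * (min 2 (\<gamma> - 1) * bregman_energy \<gamma> u v)
      \<le> convexified_flux \<gamma> \<theta> \<epsilon> y \<rho> m S"
proof -
  define K0 where "K0 = kinetic 0 \<rho> m - kinetic_tangent 0 r n \<rho> m"
  define Ky where "Ky = kinetic y \<rho> m - kinetic_tangent y r n \<rho> m"
  define P where "P = pressure \<gamma> \<rho> S - pressure_tangent \<gamma> r \<sigma> \<rho> S"
  have v': "(\<rho>, m, S) \<in> energy_domain" using v by simp
  have K0: "K0 \<ge> 0" using kinetic_tangent_le[OF u(2) v', of 0 n] by (simp add: K0_def)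
  have Ky: "Ky \<ge> 0" using kinetic_tangent_le[OF u(2) v' y, of n] by (simp add: Ky_def)
  have P: "P \<ge> 0" using pressure_tangent_le(1)[OF \<gamma> u(2) v', of \<sigma>] by (simp add: P_def)
  have d: "real CARD('d) \<ge> 1" by (simp add: Suc_leI)
  have "min 2 (\<gamma> - 1) * bregman_energy \<gamma> u v = min 2 (\<gamma> - 1) * (1/2 * K0) + min 2 (\<gamma> - 1) * (c_v \<gamma> * P)"
    by (simp add: bregman_energy_def u v K0_def P_def distrib_left)
  also have "min 2 (\<gamma> - 1) * (1/2 * K0) \<le> 2 * (1/2 * K0)" using K0 by (intro mult_right_mono) auto
  also have "min 2 (\<gamma> - 1) * (c_v \<gamma> * P) \<le> (\<gamma> - 1) * (c_v \<gamma> * P)"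
    using P c_v_pos[OF \<gamma>] by (intro mult_right_mono) auto
  also have "(\<gamma> - 1) * (c_v \<gamma> * P) = 1 * P" using \<gamma> by (simp add: c_v_def)
  also have "1 * P \<le> real CARD('d) * P" using d P by (intro mult_right_mono) auto
  finally have "min 2 (\<gamma> - 1) * bregman_energy \<gamma> u v \<le> K0 + real CARD('d) * P" by simp
  hence "\<theta> * (min 2 (\<gamma> - 1) * bregman_energy \<gamma> u v) \<le> \<theta> * (K0 + real CARD('d) * P)"
    using \<theta> by (rule mult_left_mono)
  moreover have "0 \<le> \<epsilon> * (2 * \<gamma> - 2) * K0 + 4 * \<epsilon> * Ky + \<epsilon> * (8 * c_v \<gamma> + 4 - 4 * (y \<bullet> y)) * P"
    using \<epsilon> K0 Ky P \<gamma> c_v_pos[OF \<gamma>] inner_le_1[OF y] by (intro add_nonneg_nonneg mult_nonneg_nonneg) auto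
  moreover have "convexified_flux \<gamma> \<theta> \<epsilon> y \<rho> m S - convexified_flux_tangent \<gamma> \<theta> \<epsilon> y r n \<sigma> \<rho> m S
     = \<theta> * (K0 + real CARD('d) * P) + (\<epsilon> * (2 * \<gamma> - 2) * K0 + 4 * \<epsilon> * Ky + \<epsilon> * (8 * c_v \<gamma> + 4 - 4 * (y \<bullet> y)) * P)"
    by (simp add: convexified_flux_def convexified_flux_tangent_def K0_def Ky_def P_def algebra_simps)
  ultimately show ?thesis by linarith
qed

definition energy_tangent :: "real \<Rightarrow> real \<times> (real^'d) \<times> real \<Rightarrow> real \<times> (real^'d) \<times> real \<Rightarrow> real"
  where "energy_tangent \<gamma> u v =
     1/2 * kinetic_tangent 0 (fst u) (fst (snd u)) (fst v) (fst (snd v))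
     + c_v \<gamma> * pressure_tangent \<gamma> (fst u) (snd (snd u)) (fst v) (snd (snd v))"

lemma bregman_energy_eq:
  "bregman_energy \<gamma> u v = 1/2 * kinetic 0 (fst v) (fst (snd v)) + c_v \<gamma> * pressure \<gamma> (fst v) (snd (snd v)) - energy_tangent \<gamma> u v"
  by (simp add: bregman_energy_def energy_tangent_def algebra_simps)

lemma kinetic_tangent_affine:
  "kinetic_tangent y r n \<rho> m = ((2 / r) *\<^sub>R (n - (n \<bullet> y) *\<^sub>R y)) \<bullet> m - ((n \<bullet> n - (n \<bullet> y)\<^sup>2) / r\<^sup>2) * \<rho>"
  by (simp add: kinetic_tangent_def inner_diff_left inner_diff_right inner_commute)

lemma pressure_tangent_affine:
  "pressure_tangent \<gamma> r \<sigma> \<rho> S = (pressure \<gamma> r \<sigma> * (\<gamma> - (\<gamma> - 1) * \<sigma> / r) / r) * \<rho>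
    + (pressure \<gamma> r \<sigma> * (\<gamma> - 1) / r) * S - pressure \<gamma> r \<sigma> * (\<gamma> - 1)"
  by (simp add: pressure_tangent_def algebra_simps)

text \<open>The functions that commute with passing to the barycenter.\<close>

definition affine_form :: "(real \<times> (real^'d) \<times> real \<Rightarrow> real) \<Rightarrow> bool"
  where "affine_form f \<longleftrightarrow> (\<exists>\<alpha> \<beta> \<zeta> \<delta>. \<forall>v. f v = \<alpha> * fst v + \<beta> \<bullet> fst (snd v) + \<zeta> * snd (snd v) + \<delta>)"

lemma affine_form_add: assumes "affine_form f" "affine_form g" shows "affine_form (\<lambda>v. f v + g v)"
proof -
  obtain \<alpha> \<beta> \<zeta> \<delta> where f: "\<And>v. f v = \<alpha> * fst v + \<beta> \<bullet> fst (snd v) + \<zeta> * snd (snd v) + \<delta>"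
    using assms(1) unfolding affine_form_def by blast
  obtain \<alpha>' \<beta>' \<zeta>' \<delta>' where g: "\<And>v. g v = \<alpha>' * fst v + \<beta>' \<bullet> fst (snd v) + \<zeta>' * snd (snd v) + \<delta>'"
    using assms(2) unfolding affine_form_def by blast
  show ?thesis unfolding affine_form_def f g
    by (rule exI[of _ "\<alpha> + \<alpha>'"], rule exI[of _ "\<beta> + \<beta>'"], rule exI[of _ "\<zeta> + \<zeta>'"], rule exI[of _ "\<delta> + \<delta>'"])
      (simp add: algebra_simps inner_add_left)
qed

lemma affine_form_scale: assumes "affine_form f" shows "affine_form (\<lambda>v. c * f v)"
proof -
  obtain \<alpha> \<beta> \<zeta> \<delta> where f: "\<And>v. f v = \<alpha> * fst v + \<beta> \<bullet> fst (snd v) + \<zeta> * snd (snd v) + \<delta>"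
    using assms(1) unfolding affine_form_def by blast
  show ?thesis unfolding affine_form_def f
    by (rule exI[of _ "c * \<alpha>"], rule exI[of _ "c *\<^sub>R \<beta>"], rule exI[of _ "c * \<zeta>"], rule exI[of _ "c * \<delta>"])
      (simp add: algebra_simps)
qed

lemma affine_form_kinetic_tangent: "affine_form (\<lambda>v. kinetic_tangent y r n (fst v) (fst (snd v)))"
  unfolding affine_form_def kinetic_tangent_affine
  by (rule exI[of _ "- ((n \<bullet> n - (n \<bullet> y)\<^sup>2) / r\<^sup>2)"], rule exI[of _ "(2 / r) *\<^sub>R (n - (n \<bullet> y) *\<^sub>R y)"],
      rule exI[of _ 0], rule exI[of _ 0]) simp

lemma affine_form_pressure_tangent: "affine_form (\<lambda>v. pressure_tangent \<gamma> r \<sigma> (fst v) (snd (snd v)))"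
  unfolding affine_form_def pressure_tangent_affine
  by (rule exI[of _ "pressure \<gamma> r \<sigma> * (\<gamma> - (\<gamma> - 1) * \<sigma> / r) / r"], rule exI[of _ 0],
      rule exI[of _ "pressure \<gamma> r \<sigma> * (\<gamma> - 1) / r"], rule exI[of _ "- (pressure \<gamma> r \<sigma> * (\<gamma> - 1))"]) simp

lemma affine_form_inner: "affine_form (\<lambda>v. fst (snd v) \<bullet> x)"
  unfolding affine_form_def
  by (rule exI[of _ 0], rule exI[of _ x], rule exI[of _ 0], rule exI[of _ 0]) (simp add: inner_commute)

lemma affine_form_energy_tangent: "affine_form (energy_tangent \<gamma> u)"
  unfolding energy_tangent_def
  by (intro affine_form_add affine_form_scale affine_form_kinetic_tangent affine_form_pressure_tangent)

lemma affine_form_convexified_flux_tangent: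
  "affine_form (\<lambda>v. convexified_flux_tangent \<gamma> \<theta> \<epsilon> y r n \<sigma> (fst v) (fst (snd v)) (snd (snd v)))"
  unfolding convexified_flux_tangent_def
  by (intro affine_form_add affine_form_scale affine_form_kinetic_tangent affine_form_pressure_tangent)

lemma barycenter_affine_form:
  fixes V :: "(real \<times> (real^'d) \<times> real) measure"
  assumes "prob_space V" "integrable V fst" "integrable V (\<lambda>v. fst (snd v))" "integrable V (\<lambda>v. snd (snd v))" "affine_form f"
  shows "integrable V f" "(LINT v|V. f v) = f (LINT v|V. fst v, LINT v|V. fst (snd v), LINT v|V. snd (snd v))"
proof -
  obtain \<alpha> \<beta> \<zeta> \<delta> where f: "f = (\<lambda>v. \<alpha> * fst v + \<beta> \<bullet> fst (snd v) + \<zeta> * snd (snd v) + \<delta>)"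
    using assms(5) unfolding affine_form_def by blast
  interpret prob_space V by (rule assms(1))
  show "integrable V f" "(LINT v|V. f v) = f (LINT v|V. fst v, LINT v|V. fst (snd v), LINT v|V. snd (snd v))"
    unfolding f using assms(2-4) by (auto simp: prob_space)
qed

lemma borel_measurable_bregman_energy: "(bregman_energy \<gamma> u :: real \<times> (real^'d) \<times> real \<Rightarrow> real) \<in> borel_measurable borel"
proof -
  have [measurable]: "(\<lambda>v :: real \<times> (real^'d) \<times> real. fst v) \<in> borel_measurable borel"
    "(\<lambda>v :: real \<times> (real^'d) \<times> real. fst (snd v)) \<in> borel_measurable borel"
    "(\<lambda>v :: real \<times> (real^'d) \<times> real. snd (snd v)) \<in> borel_measurable borel"
    by (intro borel_measurable_continuous_onI continuous_intros)+
  show ?thesis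
    unfolding bregman_energy_def[abs_def] kinetic_def kinetic_tangent_def pressure_def pressure_tangent_def
    by measurable
qed

text \<open>The sign of \<open>c\<close> decides that concentrations of negative entropy are harmless.\<close>

lemma energy_tangent_slopes:
  assumes \<gamma>: "\<gamma> > 1" and u: "fst u > 0"
  shows "\<exists>\<alpha> \<beta> c \<delta>. c > 0 \<and> (\<forall>v :: real \<times> (real^'d) \<times> real.
    energy_tangent \<gamma> u v = \<alpha> * fst v + \<beta> \<bullet> fst (snd v) + c * snd (snd v) + \<delta>)"
proof -
  obtain r n \<sigma> where u': "u = (r, n, \<sigma>)" by (cases u)
  let ?p = "pressure \<gamma> r \<sigma>"
  have c: "c_v \<gamma> * (?p * (\<gamma> - 1) / r) > 0"
    using \<gamma> u u' c_v_pos[OF \<gamma>] pressure_pos[of r \<gamma> \<sigma>] by simp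
  show ?thesis
  proof (intro exI conjI allI)
    show "c_v \<gamma> * (?p * (\<gamma> - 1) / r) > 0" by (rule c)
    fix v :: "real \<times> (real^'d) \<times> real"
    show "energy_tangent \<gamma> u v =
      (c_v \<gamma> * (?p * (\<gamma> - (\<gamma> - 1) * \<sigma> / r) / r) - 1/2 * ((n \<bullet> n - (n \<bullet> 0)\<^sup>2) / r\<^sup>2)) * fst v
      + ((1/2) *\<^sub>R ((2 / r) *\<^sub>R (n - (n \<bullet> 0) *\<^sub>R 0))) \<bullet> fst (snd v)
      + (c_v \<gamma> * (?p * (\<gamma> - 1) / r)) * snd (snd v) + - (c_v \<gamma> * (?p * (\<gamma> - 1)))"
      unfolding energy_tangent_def u' kinetic_tangent_affine pressure_tangent_affine fst_conv snd_conv inner_scaleR_left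
      by (simp only: distrib_left right_diff_distrib left_diff_distrib)
  qed
qed

text \<open>A finite sum of products of a function of the base point and a function of the state, as the definition
of a Young measure requires.\<close>

lemma convexified_flux_expand:
  "convexified_flux \<gamma> \<theta> \<epsilon> y \<rho> (m :: real^'d) S =
     (\<theta> + \<epsilon> * (2 * \<gamma> - 2) + 4 * \<epsilon>) * ((m \<bullet> m) / \<rho>)
     + (\<theta> * real CARD('d) + \<epsilon> * (8 * c_v \<gamma> + 4 - 4 * (y \<bullet> y))) * pressure \<gamma> \<rho> S
     + (\<Sum>p\<in>Basis \<times> Basis. (- 4 * \<epsilon> * ((y \<bullet> fst p) * (y \<bullet> snd p))) * ((m \<bullet> fst p) * (m \<bullet> snd p) / \<rho>))"
proof -
  have "(m \<bullet> y)\<^sup>2 / \<rho> = (\<Sum>p\<in>Basis \<times> Basis. ((y \<bullet> fst p) * (y \<bullet> snd p)) * ((m \<bullet> fst p) * (m \<bullet> snd p) / \<rho>))"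
    unfolding power2_eq_square euclidean_inner[of m y] sum_product sum.cartesian_product sum_divide_distrib
    by (intro sum.cong refl) (auto simp: mult_ac)
  hence "(\<Sum>p\<in>Basis \<times> Basis. (- 4 * \<epsilon> * ((y \<bullet> fst p) * (y \<bullet> snd p))) * ((m \<bullet> fst p) * (m \<bullet> snd p) / \<rho>))
     = - 4 * \<epsilon> * ((m \<bullet> y)\<^sup>2 / \<rho>)"
    by (simp add: sum_distrib_left mult.assoc)
  thus ?thesis by (simp add: convexified_flux_def kinetic_def diff_divide_distrib algebra_simps)
qed

text \<open>A nonnegative density with mean zero vanishes almost surely. The energy domain then leaves only states with
zero momentum and nonpositive entropy, and the mean of the entropy decides.\<close>

lemma vacuum_dirac:
  fixes V :: "(real \<times> (real^'d) \<times> real) measure"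
  assumes V: "prob_space V" and dom: "AE v in V. v \<in> energy_domain"
    and i: "integrable V fst" "integrable V (\<lambda>v. fst (snd v))" "integrable V (\<lambda>v. snd (snd v))"
    and \<rho>: "(LINT v|V. fst v) = 0" and S: "(LINT v|V. snd (snd v)) = 0"
  shows "AE v in V. v = (0, 0, 0)" and "(LINT v|V. fst (snd v)) = 0"
proof -
  have "AE v in V. 0 \<le> fst v" using dom by eventually_elim (auto simp: energy_domain_def)
  hence "AE v in V. fst v = 0" using \<rho> i(1) integral_nonneg_eq_0_iff_AE by blast
  hence v: "AE v in V. v = (0, 0, snd (snd v)) \<and> 0 \<le> - snd (snd v)"
    using dom by eventually_elim (auto simp: energy_domain_def)
  have "AE v in V. - snd (snd v) = 0"
  proof (subst integral_nonneg_eq_0_iff_AE[symmetric])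
    show "integrable V (\<lambda>v. - snd (snd v))" using i(3) by simp
    show "AE v in V. 0 \<le> - snd (snd v)" using v by eventually_elim simp
    show "(LINT v|V. - snd (snd v)) = 0" using S by simp
  qed
  with v show v0: "AE v in V. v = (0, 0, 0)" by eventually_elim (metis neg_equal_0_iff_equal)
  hence "AE v in V. fst (snd v) = 0" by eventually_elim simp
  hence "(LINT v|V. fst (snd v)) = (LINT v|V. 0)" using i(2) by (intro integral_cong_AE) auto
  thus "(LINT v|V. fst (snd v)) = 0" by simp
qed

text \<open>Jensen's inequality for the convexified flux minus a multiple of the tangent of the energy at the far field
state, plus a linear term. At the barycenter this function is the momentum integrand plus a multiple of the
relative energy, which is nonnegative and is dropped. What Jensen's inequality loses is at least a multiple of
the mean relative energy with respect to the barycenter.\<close>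

lemma jensen_defect:
  fixes V :: "(real \<times> (real^'d) \<times> real) measure"
  assumes \<gamma>: "\<gamma> > 1" and w: "fst w > 0"
    and V: "prob_space V" "sets V = sets borel" and dom: "AE v in V. v \<in> energy_domain"
    and i: "integrable V fst" "integrable V (\<lambda>v. fst (snd v))" "integrable V (\<lambda>v. snd (snd v))"
    and u: "u = (LINT v|V. fst v, LINT v|V. fst (snd v), LINT v|V. snd (snd v))"
    and vac: "fst u = 0 \<Longrightarrow> snd (snd u) = 0"
    and nn: "0 \<le> \<omega>" "0 \<le> \<theta>" "0 \<le> \<epsilon>"
    and g: "integrable V g" "AE v in V. g v = \<tau> * (fst (snd v) \<bullet> x)
       + \<omega> * (convexified_flux \<gamma> \<theta> \<epsilon> (damped x) (fst v) (fst (snd v)) (snd (snd v)) - kappa \<gamma> * \<epsilon> * energy_tangent \<gamma> w v)"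
  shows "\<tau> * (fst (snd u) \<bullet> x) + \<omega> * momentum_flux_form \<gamma> \<theta> \<epsilon> x (fst u) (fst (snd u)) (snd (snd u)) \<le> (LINT v|V. g v)"
    and "fst u > 0 \<Longrightarrow> \<omega> * \<theta> > 0 \<Longrightarrow> integrable V (bregman_energy \<gamma> u)"
    and "fst u > 0 \<Longrightarrow> \<omega> * \<theta> > 0 \<Longrightarrow> \<omega> * \<theta> * (min 2 (\<gamma> - 1) * (LINT v|V. bregman_energy \<gamma> u v))
      \<le> (LINT v|V. g v) - (\<tau> * (fst (snd u) \<bullet> x) + \<omega> * momentum_flux_form \<gamma> \<theta> \<epsilon> x (fst u) (fst (snd u)) (snd (snd u)))"
    and "0 \<le> fst u"
proof -
  interpret prob_space V by fact
  have "AE v in V. 0 \<le> fst v" using dom by eventually_elim (auto simp: energy_domain_def)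
  thus u0: "0 \<le> fst u" unfolding u by (simp add: integral_nonneg_AE)
  let ?mom = "\<tau> * (fst (snd u) \<bullet> x) + \<omega> * momentum_flux_form \<gamma> \<theta> \<epsilon> x (fst u) (fst (snd u)) (snd (snd u))"
  have E: "momentum_flux_form \<gamma> \<theta> \<epsilon> x (fst v) (fst (snd v)) (snd (snd v)) + kappa \<gamma> * \<epsilon> * bregman_energy \<gamma> w v
     = convexified_flux \<gamma> \<theta> \<epsilon> (damped x) (fst v) (fst (snd v)) (snd (snd v)) - kappa \<gamma> * \<epsilon> * energy_tangent \<gamma> w v"
    for v :: "real \<times> (real^'d) \<times> real"
    using momentum_flux_form_eq[OF \<gamma>, of \<theta> \<epsilon> x "fst v" "fst (snd v)" "snd (snd v)"]
    unfolding bregman_energy_eq[of \<gamma> w v] right_diff_distrib by simp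
  have kap: "0 \<le> kappa \<gamma> * \<epsilon>" using \<gamma> nn(3) by simp
  have pos: "?mom \<le> (LINT v|V. g v) \<and> (\<omega> * \<theta> > 0 \<longrightarrow> integrable V (bregman_energy \<gamma> u) \<and>
      \<omega> * \<theta> * (min 2 (\<gamma> - 1) * (LINT v|V. bregman_energy \<gamma> u v)) \<le> (LINT v|V. g v) - ?mom)" if up: "fst u > 0"
  proof -
    obtain r n \<sigma> where u': "u = (r, n, \<sigma>)" by (cases u)
    have r: "r > 0" using up u' by simp
    \<comment> \<open>The affine function \<open>L\<close> below supports the integrand from below at the barycenter.\<close>
    have udom: "u \<in> energy_domain" using r by (simp add: u' energy_domain_def)
    define L where "L v = \<tau> * (fst (snd v) \<bullet> x)
       + \<omega> * (convexified_flux_tangent \<gamma> \<theta> \<epsilon> (damped x) r n \<sigma> (fst v) (fst (snd v)) (snd (snd v)) + (- (kappa \<gamma> * \<epsilon>)) * energy_tangent \<gamma> w v)"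
      for v :: "real \<times> (real^'d) \<times> real"
    have "affine_form L" unfolding L_def
      by (intro affine_form_add affine_form_scale affine_form_inner affine_form_convexified_flux_tangent affine_form_energy_tangent)
    note La = barycenter_affine_form[OF V(1) i this, folded u]
    have Lu: "L u = ?mom + \<omega> * (kappa \<gamma> * \<epsilon> * bregman_energy \<gamma> w u)"
    proof -
      have "L u = \<tau> * (n \<bullet> x) + \<omega> * (convexified_flux \<gamma> \<theta> \<epsilon> (damped x) r n \<sigma> - kappa \<gamma> * \<epsilon> * energy_tangent \<gamma> w u)"
        by (simp add: L_def u' convexified_flux_tangent_at[OF r])
      also have "\<dots> = \<tau> * (n \<bullet> x) + \<omega> * (momentum_flux_form \<gamma> \<theta> \<epsilon> x r n \<sigma> + kappa \<gamma> * \<epsilon> * bregman_energy \<gamma> w u)"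
        using E[of u] by (simp add: u')
      finally show ?thesis by (simp add: u' distrib_left)
    qed
    have mL: "?mom \<le> L u"
      using Lu nn(1) kap bregman_energy_nonneg[OF \<gamma> w udom] by simp
    have gL: "AE v in V. L v + \<omega> * \<theta> * (min 2 (\<gamma> - 1) * bregman_energy \<gamma> u v) \<le> g v \<and> 0 \<le> bregman_energy \<gamma> u v"
      using g(2) dom
    proof eventually_elim
      fix v assume gv: "g v = \<tau> * (fst (snd v) \<bullet> x)
       + \<omega> * (convexified_flux \<gamma> \<theta> \<epsilon> (damped x) (fst v) (fst (snd v)) (snd (snd v)) - kappa \<gamma> * \<epsilon> * energy_tangent \<gamma> w v)"
        and v: "v \<in> energy_domain"
      have "convexified_flux_tangent \<gamma> \<theta> \<epsilon> (damped x) r n \<sigma> (fst v) (fst (snd v)) (snd (snd v)) + \<theta> * (min 2 (\<gamma> - 1) * bregman_energy \<gamma> u v)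
        \<le> convexified_flux \<gamma> \<theta> \<epsilon> (damped x) (fst v) (fst (snd v)) (snd (snd v))"
        using nn by (intro convexified_flux_bregman[OF \<gamma> u' r _ v] norm_damped) auto
      hence "\<omega> * (convexified_flux_tangent \<gamma> \<theta> \<epsilon> (damped x) r n \<sigma> (fst v) (fst (snd v)) (snd (snd v)) + \<theta> * (min 2 (\<gamma> - 1) * bregman_energy \<gamma> u v))
        \<le> \<omega> * convexified_flux \<gamma> \<theta> \<epsilon> (damped x) (fst v) (fst (snd v)) (snd (snd v))"
        using nn(1) by (rule mult_left_mono)
      thus "L v + \<omega> * \<theta> * (min 2 (\<gamma> - 1) * bregman_energy \<gamma> u v) \<le> g v \<and> 0 \<le> bregman_energy \<gamma> u v"
        unfolding gv L_def using bregman_energy_nonneg[OF \<gamma> up v] by (simp add: algebra_simps)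
    qed
    have nnt: "0 \<le> \<omega> * \<theta> * (min 2 (\<gamma> - 1) * t)" if "0 \<le> t" for t using nn \<gamma> that by simp
    have gL': "AE v in V. L v \<le> g v" using gL
    proof eventually_elim
      fix v assume "L v + \<omega> * \<theta> * (min 2 (\<gamma> - 1) * bregman_energy \<gamma> u v) \<le> g v \<and> 0 \<le> bregman_energy \<gamma> u v"
      thus "L v \<le> g v" using nnt[of "bregman_energy \<gamma> u v"] by linarith
    qed
    have "L u \<le> (LINT v|V. g v)" unfolding La(2)[symmetric] using La(1) g(1) gL' by (rule integral_mono_AE)
    hence 1: "?mom \<le> (LINT v|V. g v)" using mL by linarith
    have 2: "integrable V (bregman_energy \<gamma> u) \<and>
      \<omega> * \<theta> * (min 2 (\<gamma> - 1) * (LINT v|V. bregman_energy \<gamma> u v)) \<le> (LINT v|V. g v) - ?mom" if o: "\<omega> * \<theta> > 0"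
    proof -
      define q where "q = \<omega> * \<theta> * min 2 (\<gamma> - 1)"
      have q: "q > 0" using o \<gamma> by (simp add: q_def)
      have ib: "integrable V (bregman_energy \<gamma> u)"
      proof (rule Bochner_Integration.integrable_bound)
        show "integrable V (\<lambda>v. (1 / q) * (g v - L v))" using g(1) La(1) by auto
        show "bregman_energy \<gamma> u \<in> borel_measurable V"
          using borel_measurable_bregman_energy measurable_cong_sets[OF V(2) refl] by blast
        show "AE v in V. norm (bregman_energy \<gamma> u v) \<le> norm ((1 / q) * (g v - L v))"
          using gL
        proof eventually_elim
          fix v assume v: "L v + \<omega> * \<theta> * (min 2 (\<gamma> - 1) * bregman_energy \<gamma> u v) \<le> g v \<and> 0 \<le> bregman_energy \<gamma> u v"
          hence "q * bregman_energy \<gamma> u v \<le> g v - L v" by (simp add: q_def mult.assoc)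
          hence "bregman_energy \<gamma> u v \<le> (1 / q) * (g v - L v)" using q by (simp add: field_simps)
          thus "norm (bregman_energy \<gamma> u v) \<le> norm ((1 / q) * (g v - L v))"
            using v unfolding real_norm_def by linarith
        qed
      qed
      have "(LINT v|V. L v + q * bregman_energy \<gamma> u v) \<le> (LINT v|V. g v)"
        using ib La(1) g(1) gL by (intro integral_mono_AE) (auto simp: q_def mult.assoc elim: eventually_mono)
      hence "L u + q * (LINT v|V. bregman_energy \<gamma> u v) \<le> (LINT v|V. g v)" using ib La by simp
      thus ?thesis using ib mL by (simp add: q_def mult.assoc)
    qed
    from 1 2 show ?thesis by blast
  qed
  show "?mom \<le> (LINT v|V. g v)"
  proof (cases "fst u > 0")
    case True thus ?thesis using pos by blast
  next
    case False
    hence u00: "fst u = 0" using u0 by simp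
    have v0: "AE v in V. v = (0, 0, 0)"
      using vac[OF u00] u00 unfolding u by (intro vacuum_dirac(1)[OF V(1) dom i]) auto
    have m0: "fst (snd u) = 0"
      using vac[OF u00] u00 vacuum_dirac(2)[OF V(1) dom i] by (simp add: u)
    have z0: "(0, 0, 0) \<in> (energy_domain :: (real \<times> (real^'d) \<times> real) set)" by (simp add: energy_domain_def)
    have "AE v in V. g v = \<omega> * (kappa \<gamma> * \<epsilon> * bregman_energy \<gamma> w (0, 0, 0))"
      using g(2) v0
    proof eventually_elim
      fix v assume gv: "g v = \<tau> * (fst (snd v) \<bullet> x)
       + \<omega> * (convexified_flux \<gamma> \<theta> \<epsilon> (damped x) (fst v) (fst (snd v)) (snd (snd v)) - kappa \<gamma> * \<epsilon> * energy_tangent \<gamma> w v)"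
        and v: "v = (0, 0, 0)"
      show "g v = \<omega> * (kappa \<gamma> * \<epsilon> * bregman_energy \<gamma> w (0, 0, 0))"
        unfolding gv E[symmetric] unfolding v by (simp add: momentum_flux_form_def kinetic_def)
    qed
    hence "(LINT v|V. g v) = (LINT v|V. \<omega> * (kappa \<gamma> * \<epsilon> * bregman_energy \<gamma> w (0, 0, 0)))"
      using g(1) by (intro integral_cong_AE) auto
    also have "\<dots> = \<omega> * (kappa \<gamma> * \<epsilon> * bregman_energy \<gamma> w (0, 0, 0))" by (simp add: prob_space)
    also have "\<dots> \<ge> 0" using nn(1) kap bregman_energy_nonneg[OF \<gamma> w z0] by simp
    finally show ?thesis by (simp add: u00 m0 momentum_flux_form_def kinetic_def)
  qed
  show "fst u > 0 \<Longrightarrow> \<omega> * \<theta> > 0 \<Longrightarrow> integrable V (bregman_energy \<gamma> u)" using pos by blast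
  show "fst u > 0 \<Longrightarrow> \<omega> * \<theta> > 0 \<Longrightarrow> \<omega> * \<theta> * (min 2 (\<gamma> - 1) * (LINT v|V. bregman_energy \<gamma> u v)) \<le> (LINT v|V. g v) - ?mom"
    using pos by blast
qed

section \<open>The Young measure is a Dirac mass\<close>

text \<open>A weight may have unbounded support in time outside the cylinder; only its values in the cylinder matter.\<close>

lemma continuous_weight:
  fixes g :: "real \<times> (real^'d) \<Rightarrow> real"
  assumes g: "continuous_on UNIV g" and r: "\<And>t x. norm x > r \<Longrightarrow> g (t, x) = 0"
  shows "integrable (lebesgue_on (cylinder T)) g" "\<exists>G\<ge>0. \<forall>z\<in>cylinder T. \<bar>g z\<bar> \<le> G"
proof -
  let ?K = "{0..T} \<times> cball (0 :: real^'d) r"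
  have K: "compact ?K" by (intro compact_Times) auto
  have gK: "continuous_on ?K g" using g by (rule continuous_on_subset) simp
  have out: "g z = 0" if "z \<in> cylinder T - ?K" for z
    using that r by (cases z) (auto simp: dist_norm)
  have "integrable lborel (\<lambda>z. indicator ?K z *\<^sub>R g z)" by (rule borel_integrable_compact[OF K gK])
  hence "integrable lebesgue (\<lambda>z. indicator ?K z *\<^sub>R g z)"
    by (subst integrable_completion) (auto dest: borel_measurable_integrable)
  hence "integrable lebesgue (\<lambda>z. indicator (cylinder T) z *\<^sub>R (indicator ?K z *\<^sub>R g z))"
    by (rule integrable_mult_indicator[OF cylinder_lebesgue])
  also have "(\<lambda>z. indicator (cylinder T) z *\<^sub>R (indicator ?K z *\<^sub>R g z)) = (\<lambda>z. indicator (cylinder T) z *\<^sub>R g z)"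
  proof (rule ext)
    fix z show "indicator (cylinder T) z *\<^sub>R (indicator ?K z *\<^sub>R g z) = indicator (cylinder T) z *\<^sub>R g z"
    proof (cases "z \<in> cylinder T - ?K")
      case True thus ?thesis using out[of z] by simp
    next
      case False thus ?thesis by (cases "z \<in> cylinder T") (auto simp: indicator_def)
    qed
  qed
  finally show "integrable (lebesgue_on (cylinder T)) g"
    using cylinder_lebesgue by (subst integrable_restrict_space) auto
  have "compact (g ` ?K)" by (rule compact_continuous_image[OF gK K])
  hence "bounded (g ` ?K)" by (rule compact_imp_bounded)
  then obtain G where G: "\<And>y. y \<in> g ` ?K \<Longrightarrow> norm y \<le> G" unfolding bounded_iff by blast
  have "\<bar>g z\<bar> \<le> max 0 G" if "z \<in> cylinder T" for z
    using out[of z] G[of "g z"] that by (cases "z \<in> ?K") auto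
  thus "\<exists>G\<ge>0. \<forall>z\<in>cylinder T. \<bar>g z\<bar> \<le> G" by (intro exI[of _ "max 0 G"]) auto
qed

text \<open>The pressure and \<open>|m|\<^sup>2 / \<rho>\<close> do not extend continuously to vacuum. Multiplied by this cutoff they become
test functions, and in the limit they are restricted to positive density. Nothing is lost, because they
vanish at the vacuum states of the energy domain.\<close>

definition density_cutoff :: "nat \<Rightarrow> real \<times> (real^'d) \<times> real \<Rightarrow> real"
  where "density_cutoff k v = cutoff k v * max 0 (min 1 (real k * fst v - 1))"

lemma density_cutoff_bounds: "0 \<le> density_cutoff k v" "density_cutoff k v \<le> 1"
  using cutoff_bounds[of k v] by (auto simp: density_cutoff_def intro!: mult_le_one)

lemma density_cutoff_zero: "fst v \<le> 0 \<Longrightarrow> density_cutoff k v = 0"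
proof -
  assume "fst v \<le> 0"
  hence "real k * fst v \<le> 0" by (simp add: mult_nonneg_nonpos)
  thus ?thesis by (simp add: density_cutoff_def)
qed

lemma density_cutoff_mono:
  assumes "k \<le> l" shows "density_cutoff k v \<le> density_cutoff l v"
proof (cases "fst v \<le> 0")
  case True thus ?thesis by (simp add: density_cutoff_zero)
next
  case False
  hence "real k * fst v \<le> real l * fst v" using assms by (intro mult_right_mono) auto
  hence "max 0 (min 1 (real k * fst v - 1)) \<le> max 0 (min 1 (real l * fst v - 1))" by linarith
  thus ?thesis unfolding density_cutoff_def using cutoff_mono[OF assms, of v] cutoff_bounds[of l v]
    by (intro mult_mono) auto
qed

lemma density_cutoff_tendsto:
  "(\<lambda>k. density_cutoff k v * f) \<longlonglongrightarrow> (if fst v > 0 then f else 0)"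
proof (cases "fst v > 0")
  case True
  obtain n where n: "2 / fst v \<le> real n" using real_arch_simple by blast
  have "\<forall>\<^sub>F k in sequentially. k \<ge> n \<and> cutoff k v = 1"
    using eventually_ge_at_top[of n] cutoff_eventually[of v] by eventually_elim simp
  hence "\<forall>\<^sub>F k in sequentially. density_cutoff k v * f = f"
  proof eventually_elim
    fix k assume k: "k \<ge> n \<and> cutoff k v = 1"
    hence "2 / fst v \<le> real k" using n by linarith
    hence "2 \<le> real k * fst v" using True by (simp add: field_simps)
    thus "density_cutoff k v * f = f" using k by (simp add: density_cutoff_def)
  qed
  thus ?thesis using True by (simp add: tendsto_eventually)
next
  case False thus ?thesis by (simp add: density_cutoff_zero)
qed

text \<open>On the support of the cutoff, \<open>h\<close> agrees with the continuous function obtained by replacing the density \<open>\<rho>\<close>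
by \<open>max \<rho> (1 / (k + 1))\<close>.\<close>

lemma density_cutoff_Cc:
  fixes h :: "real \<times> (real^'d) \<times> real \<Rightarrow> real"
  assumes h: "continuous_on {v. fst v > 0} h"
  shows "(\<lambda>v. density_cutoff k v * h v) \<in> Cc"
proof -
  define p where "p v = (max (fst v) (1 / real (Suc k)), snd v)" for v :: "real \<times> (real^'d) \<times> real"
  have pc: "continuous_on UNIV p" unfolding p_def by (intro continuous_intros)
  have "continuous_on UNIV (\<lambda>v. h (p v))"
  proof (rule continuous_on_compose2[OF h pc])
    have "fst (p v) > 0" for v by (simp add: p_def less_max_iff_disj)
    thus "p ` UNIV \<subseteq> {v. fst v > 0}" by auto
  qed
  hence "continuous_on UNIV (\<lambda>v. max 0 (min 1 (real k * fst v - 1)) * h (p v))" by (intro continuous_intros)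
  hence "(\<lambda>v. cutoff k v * (max 0 (min 1 (real k * fst v - 1)) * h (p v))) \<in> Cc" by (rule cutoff_times_Cc)
  moreover have "(\<lambda>v. cutoff k v * (max 0 (min 1 (real k * fst v - 1)) * h (p v))) = (\<lambda>v. density_cutoff k v * h v)"
  proof (rule ext)
    fix v :: "real \<times> (real^'d) \<times> real"
    show "cutoff k v * (max 0 (min 1 (real k * fst v - 1)) * h (p v)) = density_cutoff k v * h v"
    proof (cases "real k * fst v > 1")
      case True
      hence k: "k > 0" by (cases k) auto
      hence "fst v > 1 / real k" using True by (simp add: field_simps)
      moreover have "1 / real k \<ge> 1 / real (Suc k)" using k by (intro divide_left_mono) auto
      ultimately have "p v = v" by (simp add: p_def max_def)
      thus ?thesis by (simp add: density_cutoff_def)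
    next
      case False thus ?thesis by (simp add: density_cutoff_def)
    qed
  qed
  ultimately show ?thesis by simp
qed

text \<open>The abstract setting with the relative energy with respect to the far field state \<open>w\<close>.\<close>

locale euler_young = bounded_young_sequence "cylinder T :: (real \<times> (real^'d)) set" Z V energy_domain "bregman_energy \<gamma> w" C B
  for T :: real and Z :: "nat \<Rightarrow> real \<times> (real^'d) \<Rightarrow> real \<times> (real^'d) \<times> real" and V \<gamma> w C B +
  assumes \<gamma>: "\<gamma> > 1" and w: "fst w > 0" and T: "T > 0"
begin

lemma equi_integrable_density: "equi_integrable fst"
  unfolding equi_integrable_def
proof (intro conjI allI impI)
  fix \<epsilon> :: real assume \<epsilon>: "\<epsilon> > 0"
  obtain K where K: "K \<ge> 0" "\<And>v :: real \<times> (real^'d) \<times> real. v \<in> energy_domain \<Longrightarrow> fst v \<le> K + \<epsilon> * bregman_energy \<gamma> w v"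
    using density_le_energy[OF \<gamma> w \<epsilon>] by blast
  have "fst v \<ge> 0" if "v \<in> energy_domain" for v :: "real \<times> (real^'d) \<times> real"
    using that by (auto simp: energy_domain_def)
  thus "\<exists>K\<ge>0. \<forall>v\<in>energy_domain. \<bar>fst v\<bar> \<le> K + \<epsilon> * bregman_energy \<gamma> w v" using K by auto
qed (intro continuous_intros)

lemma momentum_entropy_equi:
  assumes "\<epsilon> > 0"
  obtains K where "K \<ge> 0" "\<And>v. v \<in> energy_domain \<Longrightarrow> norm (fst (snd v)) + max 0 (snd (snd v)) \<le> K + \<epsilon> * bregman_energy \<gamma> w v"
proof -
  obtain L where L: "L \<ge> 0" "\<And>v. v \<in> energy_domain \<Longrightarrow>
      norm (fst (snd v)) + max 0 (snd (snd v)) \<le> \<epsilon> / 2 * (1 + bregman_energy \<gamma> w v) + L * fst v"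
    using momentum_entropy_le_energy_density[OF \<gamma> w, of "\<epsilon> / 2"] assms by auto
  obtain K where K: "K \<ge> 0" "\<And>v :: real \<times> (real^'d) \<times> real. v \<in> energy_domain \<Longrightarrow> fst v \<le> K + \<epsilon> / (2 * (L + 1)) * bregman_energy \<gamma> w v"
    using density_le_energy[OF \<gamma> w, of "\<epsilon> / (2 * (L + 1))"] assms L(1) by auto
  have "norm (fst (snd v)) + max 0 (snd (snd v)) \<le> (\<epsilon> / 2 + L * K) + \<epsilon> * bregman_energy \<gamma> w v"
    if v: "v \<in> energy_domain" for v
  proof -
    have R: "0 \<le> bregman_energy \<gamma> w v" by (rule R_nonneg[OF v])
    have "L * fst v \<le> L * (K + \<epsilon> / (2 * (L + 1)) * bregman_energy \<gamma> w v)" using K(2)[OF v] L(1) by (rule mult_left_mono)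
    also have "\<dots> = L * K + (L / (L + 1)) * (\<epsilon> / 2 * bregman_energy \<gamma> w v)" by (simp add: distrib_left)
    also have "(L / (L + 1)) * (\<epsilon> / 2 * bregman_energy \<gamma> w v) \<le> 1 * (\<epsilon> / 2 * bregman_energy \<gamma> w v)"
      using L(1) assms R by (intro mult_right_mono) auto
    finally show ?thesis using L(2)[OF v] by (simp add: distrib_left)
  qed
  thus ?thesis using that[of "\<epsilon> / 2 + L * K"] assms L(1) K(1) by auto
qed

lemma equi_integrable_momentum: "equi_integrable (\<lambda>v. fst (snd v) \<bullet> i)"
  unfolding equi_integrable_def
proof (intro conjI allI impI)
  fix \<epsilon> :: real assume \<epsilon>: "\<epsilon> > 0"
  define e where "e = \<epsilon> / (norm i + 1)"
  have e: "e > 0" using \<epsilon> by (simp add: e_def add_nonneg_pos)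
  obtain K where K: "K \<ge> 0" "\<And>v. v \<in> energy_domain \<Longrightarrow> norm (fst (snd v)) + max 0 (snd (snd v)) \<le> K + e * bregman_energy \<gamma> w v"
    using momentum_entropy_equi[OF e] by blast
  have "\<bar>fst (snd v) \<bullet> i\<bar> \<le> (norm i + 1) * K + \<epsilon> * bregman_energy \<gamma> w v" if v: "v \<in> energy_domain" for v
  proof -
    have "\<bar>fst (snd v) \<bullet> i\<bar> \<le> norm (fst (snd v)) * norm i" by (rule Cauchy_Schwarz_ineq2)
    also have "\<dots> \<le> (norm i + 1) * norm (fst (snd v))" by (simp add: algebra_simps)
    also have "\<dots> \<le> (norm i + 1) * (K + e * bregman_energy \<gamma> w v)"
      using K(2)[OF v] by (intro mult_left_mono) auto
    also have "\<dots> = (norm i + 1) * K + ((norm i + 1) * e) * bregman_energy \<gamma> w v" by (simp add: algebra_simps)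
    also have "(norm i + 1) * e = \<epsilon>" using norm_ge_zero[of i] by (simp add: e_def add_nonneg_pos less_imp_neq[THEN not_sym])
    finally show ?thesis .
  qed
  thus "\<exists>K\<ge>0. \<forall>v\<in>energy_domain. \<bar>fst (snd v) \<bullet> i\<bar> \<le> K + \<epsilon> * bregman_energy \<gamma> w v"
    using K(1) by (intro exI[of _ "(norm i + 1) * K"]) auto
qed (intro continuous_intros)

lemma equi_integrable_entropy_pos: "equi_integrable (\<lambda>v. max 0 (snd (snd v)))"
  unfolding equi_integrable_def
proof (intro conjI allI impI)
  fix \<epsilon> :: real assume \<epsilon>: "\<epsilon> > 0"
  obtain K where K: "K \<ge> 0" "\<And>v. v \<in> energy_domain \<Longrightarrow> norm (fst (snd v)) + max 0 (snd (snd v)) \<le> K + \<epsilon> * bregman_energy \<gamma> w v"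
    using momentum_entropy_equi[OF \<epsilon>] by blast
  have "\<bar>max 0 (snd (snd v))\<bar> \<le> K + \<epsilon> * bregman_energy \<gamma> w v" if "v \<in> energy_domain" for v
    using K(2)[OF that] norm_ge_zero[of "fst (snd v)"] by linarith
  thus "\<exists>K\<ge>0. \<forall>v\<in>energy_domain. \<bar>max 0 (snd (snd v))\<bar> \<le> K + \<epsilon> * bregman_energy \<gamma> w v" using K(1) by blast
qed (intro continuous_intros)

text \<open>Negative densities are excluded by testing with a function that vanishes on the energy domain. The restrictions
on momentum and entropy at vacuum come from \<open>momentum_entropy_le_energy_density\<close>, with \<open>\<delta>\<close> tending to \<open>0\<close>.\<close>

lemma young_in_energy_domain: "AE z in M. AE v in V z. v \<in> energy_domain"
proof -
  have 1: "AE z in M. AE v in V z. max 0 (- fst v) = 0"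
    by (intro young_AE_null continuous_intros) (auto simp: energy_domain_def)
  have 2: "AE z in M. AE v in V z. fst v \<le> 0 \<longrightarrow> norm (fst (snd v)) + max 0 (snd (snd v)) \<le> 0"
  proof (rule young_AE_null_on)
    fix \<delta> :: real assume "\<delta> > 0"
    from momentum_entropy_le_energy_density[OF \<gamma> w this]
    show "\<exists>K\<ge>0. \<forall>v\<in>energy_domain. norm (fst (snd v)) + max 0 (snd (snd v)) \<le> \<delta> * (1 + bregman_energy \<gamma> w v) + K * fst v" .
  qed (intro continuous_intros)+
  from 1 2 show ?thesis
  proof eventually_elim
    fix z assume "AE v in V z. max 0 (- fst v) = 0"
      and "AE v in V z. fst v \<le> 0 \<longrightarrow> norm (fst (snd v)) + max 0 (snd (snd v)) \<le> 0"
    thus "AE v in V z. v \<in> energy_domain"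
    proof eventually_elim
      fix v :: "real \<times> (real^'d) \<times> real"
      assume v: "max 0 (- fst v) = 0" "fst v \<le> 0 \<longrightarrow> norm (fst (snd v)) + max 0 (snd (snd v)) \<le> 0"
      show "v \<in> energy_domain"
      proof (cases "fst v > 0")
        case True thus ?thesis by (cases v) (auto simp: energy_domain_def)
      next
        case False
        hence "fst v = 0" "norm (fst (snd v)) + max 0 (snd (snd v)) \<le> 0" using v by auto
        moreover hence "norm (fst (snd v)) = 0" "snd (snd v) \<le> 0" using norm_ge_zero[of "fst (snd v)"] by linarith+
        ultimately show ?thesis by (cases v) (auto simp: energy_domain_def)
      qed
    qed
  qed
qed

lemma young_integrable:
  "AE z in M. integrable (V z) (\<lambda>v. norm v) \<and> integrable (V z) fst \<and> integrable (V z) (\<lambda>v. fst (snd v)) \<and> integrable (V z) (\<lambda>v. snd (snd v))"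
proof -
  have "AE z in M. integrable (V z) (\<lambda>v. norm v)"
    using norm_le B by (intro young_AE_finite[of norm B B] continuous_intros) (auto simp: distrib_left)
  thus ?thesis
  proof (rule AE_mp, intro AE_I2 impI)
    fix z assume z: "z \<in> space M" and i: "integrable (V z) (\<lambda>v. norm v)"
    have s: "sets (V z) = sets borel" using V_sets z by simp
    have m: "f \<in> borel_measurable (V z)" if "f \<in> borel_measurable borel" for f :: "_ \<Rightarrow> 'c::topological_space"
      using measurable_cong_sets[OF s refl] that by blast
    have n: "norm (fst v) \<le> norm v" "norm (fst (snd v)) \<le> norm v" "norm (snd (snd v)) \<le> norm v"
      for v :: "real \<times> (real^'d) \<times> real"
      using norm_fst_le[of "fst v" "snd v"] norm_snd_le[of "snd v" "fst v"]
        norm_fst_le[of "fst (snd v)" "snd (snd v)"] norm_snd_le[of "snd (snd v)" "fst (snd v)"] by auto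
    show "integrable (V z) (\<lambda>v. norm v) \<and> integrable (V z) fst \<and> integrable (V z) (\<lambda>v. fst (snd v)) \<and> integrable (V z) (\<lambda>v. snd (snd v))"
    proof (intro conjI i)
      show "integrable (V z) fst"
        using n by (intro Bochner_Integration.integrable_bound[OF i] m) (auto intro!: borel_measurable_continuous_onI continuous_intros)
      show "integrable (V z) (\<lambda>v. fst (snd v))"
        using n by (intro Bochner_Integration.integrable_bound[OF i] m) (auto intro!: borel_measurable_continuous_onI continuous_intros)
      show "integrable (V z) (\<lambda>v. snd (snd v))"
        using n by (intro Bochner_Integration.integrable_bound[OF i] m) (auto intro!: borel_measurable_continuous_onI continuous_intros)
    qed
  qed
qed

definition momentum_functional :: "(real \<times> (real^'d) \<Rightarrow> real \<times> (real^'d) \<times> real) \<Rightarrow> (real \<times> (real^'d) \<Rightarrow> real^'d) \<Rightarrow> real \<times> (real^'d) \<Rightarrow> real"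
  where "momentum_functional X = momentum_integrand \<gamma> (\<lambda>z. fst (X z)) (\<lambda>z. fst (snd (X z))) (\<lambda>z. snd (snd (X z)))"

definition test_time :: "real \<Rightarrow> real \<Rightarrow> real \<times> (real^'d) \<Rightarrow> real"
  where "test_time b \<epsilon> z = time_bump' b (fst z) * (log_cutoff \<epsilon> (snd z))\<^sup>2"

definition test_weight :: "real \<Rightarrow> real \<Rightarrow> real \<times> (real^'d) \<Rightarrow> real"
  where "test_weight b \<epsilon> z = time_bump b (fst z) * log_cutoff \<epsilon> (snd z)"

text \<open>The momentum integrand for \<open>radial_field\<close> plus \<open>kappa \<gamma> * \<epsilon>\<close> times the weighted relative energy, as a function
of the state (\<open>flux_energy_eq\<close>). The flux and the energy are combined in \<open>convexified_flux\<close>; the rest is affine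
in the state.\<close>

definition flux_energy :: "real \<Rightarrow> real \<Rightarrow> real \<times> (real^'d) \<Rightarrow> real \<times> (real^'d) \<times> real \<Rightarrow> real"
  where "flux_energy b \<epsilon> z v = test_time b \<epsilon> z * (fst (snd v) \<bullet> snd z)
       + test_weight b \<epsilon> z * (convexified_flux \<gamma> (log_cutoff \<epsilon> (snd z)) \<epsilon> (damped (snd z)) (fst v) (fst (snd v)) (snd (snd v))
           - kappa \<gamma> * \<epsilon> * energy_tangent \<gamma> w v)"

lemma flux_energy_eq:
  assumes "X z \<in> energy_domain"
  shows "flux_energy b \<epsilon> z (X z) = momentum_functional X (radial_field b \<epsilon>) z
     + kappa \<gamma> * \<epsilon> * (test_weight b \<epsilon> z * bregman_energy \<gamma> w (X z))"
proof -
  obtain t x where z: "z = (t, x)" by (cases z)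
  obtain \<rho> m S where v: "X z = (\<rho>, m, S)" by (cases "X z")
  have d: "\<rho> > 0 \<or> \<rho> = 0 \<and> m = 0" using assms by (auto simp: v energy_domain_def)
  have "momentum_functional X (radial_field b \<epsilon>) z = test_time b \<epsilon> z * (m \<bullet> x) + test_weight b \<epsilon> z * momentum_flux_form \<gamma> (log_cutoff \<epsilon> x) \<epsilon> x \<rho> m S"
    unfolding momentum_functional_def z using d v[unfolded z]
    by (subst momentum_integrand_radial_field) (auto simp: test_time_def test_weight_def)
  moreover have "momentum_flux_form \<gamma> (log_cutoff \<epsilon> x) \<epsilon> x \<rho> m S + kappa \<gamma> * \<epsilon> * bregman_energy \<gamma> w (\<rho>, m, S)
     = convexified_flux \<gamma> (log_cutoff \<epsilon> x) \<epsilon> (damped x) \<rho> m S - kappa \<gamma> * \<epsilon> * energy_tangent \<gamma> w (\<rho>, m, S)"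
    using momentum_flux_form_eq[OF \<gamma>, of "log_cutoff \<epsilon> x" \<epsilon> x \<rho> m S]
    unfolding bregman_energy_eq[of \<gamma> w "(\<rho>, m, S)"] right_diff_distrib by simp
  hence "test_weight b \<epsilon> z * (convexified_flux \<gamma> (log_cutoff \<epsilon> x) \<epsilon> (damped x) \<rho> m S - kappa \<gamma> * \<epsilon> * energy_tangent \<gamma> w (\<rho>, m, S))
     = test_weight b \<epsilon> z * (momentum_flux_form \<gamma> (log_cutoff \<epsilon> x) \<epsilon> x \<rho> m S + kappa \<gamma> * \<epsilon> * bregman_energy \<gamma> w (\<rho>, m, S))" by simp
  ultimately show ?thesis unfolding flux_energy_def z v[unfolded z] by (simp add: algebra_simps)
qed

lemma test_weight_bounds:
  assumes "z \<in> cylinder T" "0 \<le> \<epsilon>" "0 < b" "b \<le> T"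
  shows "0 \<le> test_weight b \<epsilon> z" "test_weight b \<epsilon> z \<le> T ^ 3"
proof -
  obtain t x where z: "z = (t, x)" by (cases z)
  have t: "0 < t" "t < T" using assms z by auto
  have m: "0 \<le> max 0 (b - t)" "max 0 (b - t) \<le> T" using assms t T by auto
  have "0 \<le> time_bump b t" using t by (simp add: time_bump_def)
  moreover have "time_bump b t \<le> T ^ 3"
  proof -
    have "t * (max 0 (b - t))\<^sup>2 \<le> T * T\<^sup>2" using t m by (intro mult_mono power_mono) auto
    thus ?thesis by (simp add: time_bump_def power3_eq_cube power2_eq_square)
  qed
  ultimately show "0 \<le> test_weight b \<epsilon> z" "test_weight b \<epsilon> z \<le> T ^ 3"
    using log_cutoff_bounds[OF assms(2), of x] T
    by (auto simp: test_weight_def z intro: order_trans[OF mult_left_le])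
qed

lemma test_field_weight:
  assumes "\<epsilon> > 0" "continuous_on UNIV (\<lambda>z :: real \<times> (real^'d). c z)"
  shows "integrable M (\<lambda>z. test_weight b \<epsilon> z * c z)" "\<exists>G\<ge>0. \<forall>z\<in>cylinder T. \<bar>test_weight b \<epsilon> z * c z\<bar> \<le> G"
    "integrable M (\<lambda>z. test_time b \<epsilon> z * c z)" "\<exists>G\<ge>0. \<forall>z\<in>cylinder T. \<bar>test_time b \<epsilon> z * c z\<bar> \<le> G"
proof -
  have 1: "continuous_on UNIV (\<lambda>z. test_weight b \<epsilon> z * c z)"
    unfolding test_weight_def time_bump_def by (intro continuous_intros assms)
  have 2: "continuous_on UNIV (\<lambda>z. test_time b \<epsilon> z * c z)"
    unfolding test_time_def time_bump'_def by (intro continuous_intros assms)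
  have z: "test_weight b \<epsilon> (t, x) * c (t, x) = 0" "test_time b \<epsilon> (t, x) * c (t, x) = 0"
    if "norm x > exp (1 / \<epsilon>)" for t x
    using log_cutoff_support[OF assms(1) that] by (auto simp: test_weight_def test_time_def)
  show "integrable M (\<lambda>z. test_weight b \<epsilon> z * c z)" "\<exists>G\<ge>0. \<forall>z\<in>cylinder T. \<bar>test_weight b \<epsilon> z * c z\<bar> \<le> G"
    using continuous_weight[OF 1 z(1)] by auto
  show "integrable M (\<lambda>z. test_time b \<epsilon> z * c z)" "\<exists>G\<ge>0. \<forall>z\<in>cylinder T. \<bar>test_time b \<epsilon> z * c z\<bar> \<le> G"
    using continuous_weight[OF 2 z(2)] by auto
qed

lemma young_limit_weight:
  assumes "\<epsilon> > 0" "continuous_on UNIV c" "equi_integrable h"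
  shows "\<exists>I. young_limit (\<lambda>z v. (test_weight b \<epsilon> z * c z) * h v) I"
    and "\<exists>I. young_limit (\<lambda>z v. (test_time b \<epsilon> z * c z) * h v) I"
proof -
  note W = test_field_weight[OF assms(1,2), of b]
  obtain G1 where "G1 \<ge> 0" "\<And>z. z \<in> cylinder T \<Longrightarrow> \<bar>test_weight b \<epsilon> z * c z\<bar> \<le> G1" using W(2) by blast
  with young_limit_equi[OF assms(3) W(1)] show "\<exists>I. young_limit (\<lambda>z v. (test_weight b \<epsilon> z * c z) * h v) I" by metis
  obtain G2 where "G2 \<ge> 0" "\<And>z. z \<in> cylinder T \<Longrightarrow> \<bar>test_time b \<epsilon> z * c z\<bar> \<le> G2" using W(4) by blast
  with young_limit_equi[OF assms(3) W(3)] show "\<exists>I. young_limit (\<lambda>z v. (test_time b \<epsilon> z * c z) * h v) I" by metis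
qed

lemma young_limit_add_ex:
  "\<exists>I. young_limit f I \<Longrightarrow> \<exists>I. young_limit h I \<Longrightarrow> \<exists>I. young_limit (\<lambda>z v. f z v + h z v) I"
  using young_limit_add by blast

lemma young_limit_sum_ex:
  assumes "\<And>i. i \<in> A \<Longrightarrow> \<exists>I. young_limit (f i) I"
  shows "\<exists>I. young_limit (\<lambda>z v. \<Sum>i\<in>A. f i z v) I"
proof -
  have "\<forall>i\<in>A. \<exists>I. young_limit (f i) I" using assms by blast
  then obtain I where "\<forall>i\<in>A. young_limit (f i) (I i)" by metis
  hence "young_limit (\<lambda>z v. \<Sum>i\<in>A. f i z v) (\<lambda>z. \<Sum>i\<in>A. I i z)" by (intro young_limit_sum) auto
  thus ?thesis by blast
qed

text \<open>Along the sequence the integral of \<open>flux_energy\<close> is the momentum functional plus an error bounded by the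
energy. For the passage to the limit it is split into three parts: the convexified flux, which is nonnegative
and a monotone limit of test functions; a multiple of the negative entropy, which is nonnegative as well; and
terms linear in density, momentum and positive entropy, which are equi-integrable. The first two parts are
lower semicontinuous, the last one converges.\<close>

lemma flux_energy_limit:
  assumes \<epsilon>: "0 < \<epsilon>" and b: "0 < b" "b < T"
    and mi: "\<And>n. integrable M (momentum_functional (Z n) (radial_field b \<epsilon>))"
    and ml: "(\<lambda>n. LINT z|M. momentum_functional (Z n) (radial_field b \<epsilon>) z) \<longlonglongrightarrow> m\<^sub>0"
  shows "\<exists>I. integrable M I \<and> (LINT z|M. I z) \<le> m\<^sub>0 + kappa \<gamma> * \<epsilon> * (T ^ 3 * C) \<and>
    (AE z in M. \<exists>g. integrable (V z) g \<and> (LINT v|V z. g v) = I z \<and> (AE v in V z. g v = flux_energy b \<epsilon> z v))"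
proof -
  let ?\<omega> = "test_weight b \<epsilon>" and ?\<theta> = "\<lambda>z :: real \<times> (real^'d). log_cutoff \<epsilon> (snd z)"
  let ?y = "\<lambda>z :: real \<times> (real^'d). damped (snd z)"
  obtain \<alpha> \<beta> c \<delta> where c: "c > 0"
    and et: "\<And>v :: real \<times> (real^'d) \<times> real. energy_tangent \<gamma> w v = \<alpha> * fst v + \<beta> \<bullet> fst (snd v) + c * snd (snd v) + \<delta>"
    using energy_tangent_slopes[OF \<gamma> w] by blast
  define \<kappa> where "\<kappa> = kappa \<gamma> * \<epsilon>"
  have \<kappa>: "\<kappa> \<ge> 0" using \<gamma> \<epsilon> by (simp add: \<kappa>_def)
  \<comment> \<open>The terms that converge. The entropy enters here through its positive part only.\<close>
  define a where "a z v = (\<Sum>i\<in>Basis. (test_time b \<epsilon> z * (snd z \<bullet> i)) * (fst (snd v) \<bullet> i))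
     + ((?\<omega> z * (- \<kappa> * \<alpha>)) * fst v + ((?\<omega> z * (- \<kappa>)) * (fst (snd v) \<bullet> \<beta>)
     + ((?\<omega> z * (- \<kappa> * c)) * max 0 (snd (snd v)) + (?\<omega> z * (- \<kappa> * \<delta>)) * 1)))" for z and v :: "real \<times> (real^'d) \<times> real"
  have one: "equi_integrable (\<lambda>_. 1)" by (rule bounded_equi_integrable[where K = 1]) auto
  have "\<exists>A. young_limit a A" unfolding a_def
    by (intro young_limit_add_ex young_limit_sum_ex young_limit_weight equi_integrable_momentum
        equi_integrable_density equi_integrable_entropy_pos one \<epsilon> continuous_intros)
  then obtain A where A: "young_limit a A" by blast
  \<comment> \<open>The terms for which only lower semicontinuity holds, truncated so that they are test functions.\<close>
  define f where "f k z v = density_cutoff k v * (?\<omega> z * convexified_flux \<gamma> (?\<theta> z) \<epsilon> (?y z) (fst v) (fst (snd v)) (snd (snd v)))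
     + ?\<omega> z * (\<kappa> * c) * (cutoff k v * max 0 (- snd (snd v)))" for k z and v :: "real \<times> (real^'d) \<times> real"
  define fl where "fl z v = (if fst v > 0 then ?\<omega> z * convexified_flux \<gamma> (?\<theta> z) \<epsilon> (?y z) (fst v) (fst (snd v)) (snd (snd v)) else 0)
     + ?\<omega> z * (\<kappa> * c) * max 0 (- snd (snd v))" for z and v :: "real \<times> (real^'d) \<times> real"
  have cv: "c_v \<gamma> > 0" using \<gamma> by (rule c_v_pos)
  have dc: "continuous_on UNIV (\<lambda>z :: real \<times> (real^'d). damped (snd z))"
  proof -
    have "1 + x \<bullet> x \<noteq> 0" for x :: "real^'d" using one_plus_inner_pos[of x] by simp
    thus ?thesis by (intro continuous_intros) auto
  qed
  have flim: "\<exists>F. young_limit (f k) F" for k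
  proof -
    have cc: "\<exists>I. young_limit (\<lambda>z v. (?\<omega> z * q z) * (density_cutoff k v * h v)) I"
      if "continuous_on UNIV q" "continuous_on {v. fst v > 0} h" for q and h :: "real \<times> (real^'d) \<times> real \<Rightarrow> real"
      using young_limit_Cc[OF density_cutoff_Cc[OF that(2)] test_field_weight(1)[OF \<epsilon> that(1)]] by blast
    have p: "continuous_on {v :: real \<times> (real^'d) \<times> real. fst v > 0} (\<lambda>v. pressure \<gamma> (fst v) (snd (snd v)))"
      unfolding pressure_def using cv by (intro continuous_intros) auto
    have k0: "continuous_on {v :: real \<times> (real^'d) \<times> real. fst v > 0} (\<lambda>v. (fst (snd v) \<bullet> fst (snd v)) / fst v)"
      by (intro continuous_intros) auto
    have kij: "continuous_on {v :: real \<times> (real^'d) \<times> real. fst v > 0} (\<lambda>v. (fst (snd v) \<bullet> i) * (fst (snd v) \<bullet> j) / fst v)" for i j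
      by (intro continuous_intros) auto
    have s: "\<exists>I. young_limit (\<lambda>z v. (?\<omega> z * (\<kappa> * c)) * (cutoff k v * max 0 (- snd (snd v)))) I"
    proof -
      have b: "(\<lambda>v :: real \<times> (real^'d) \<times> real. cutoff k v * max 0 (- snd (snd v))) \<in> Cc"
        by (intro cutoff_times_Cc continuous_intros)
      show ?thesis using young_limit_Cc[OF b test_field_weight(1)[OF \<epsilon> continuous_on_const, of b "\<kappa> * c"]] by blast
    qed
    have e: "f k = (\<lambda>z v. (((?\<omega> z * (?\<theta> z + \<epsilon> * (2 * \<gamma> - 2) + 4 * \<epsilon>)) * (density_cutoff k v * ((fst (snd v) \<bullet> fst (snd v)) / fst v))
       + (?\<omega> z * (?\<theta> z * real CARD('d) + \<epsilon> * (8 * c_v \<gamma> + 4 - 4 * (?y z \<bullet> ?y z)))) * (density_cutoff k v * pressure \<gamma> (fst v) (snd (snd v))))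
       + (\<Sum>p\<in>Basis \<times> Basis. (?\<omega> z * (- 4 * \<epsilon> * ((?y z \<bullet> fst p) * (?y z \<bullet> snd p)))) * (density_cutoff k v * ((fst (snd v) \<bullet> fst p) * (fst (snd v) \<bullet> snd p) / fst v))))
       + (?\<omega> z * (\<kappa> * c)) * (cutoff k v * max 0 (- snd (snd v))))"
    proof (intro ext)
      fix z and v :: "real \<times> (real^'d) \<times> real"
      have alg: "d * (o' * (A1 * X + A2 * Y + (\<Sum>p\<in>P. B p * W p))) = o' * A1 * (d * X) + o' * A2 * (d * Y) + (\<Sum>p\<in>P. o' * B p * (d * W p))"
        for d o' A1 A2 X Y :: real and P :: "((real^'d) \<times> (real^'d)) set" and B W
        by (simp add: distrib_left sum_distrib_left mult_ac)
      show "f k z v = (((?\<omega> z * (?\<theta> z + \<epsilon> * (2 * \<gamma> - 2) + 4 * \<epsilon>)) * (density_cutoff k v * ((fst (snd v) \<bullet> fst (snd v)) / fst v))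
       + (?\<omega> z * (?\<theta> z * real CARD('d) + \<epsilon> * (8 * c_v \<gamma> + 4 - 4 * (?y z \<bullet> ?y z)))) * (density_cutoff k v * pressure \<gamma> (fst v) (snd (snd v))))
       + (\<Sum>p\<in>Basis \<times> Basis. (?\<omega> z * (- 4 * \<epsilon> * ((?y z \<bullet> fst p) * (?y z \<bullet> snd p)))) * (density_cutoff k v * ((fst (snd v) \<bullet> fst p) * (fst (snd v) \<bullet> snd p) / fst v))))
       + (?\<omega> z * (\<kappa> * c)) * (cutoff k v * max 0 (- snd (snd v)))"
        unfolding f_def convexified_flux_expand alg ..
    qed
    have t1: "\<exists>I. young_limit (\<lambda>z v. (?\<omega> z * (?\<theta> z + \<epsilon> * (2 * \<gamma> - 2) + 4 * \<epsilon>)) * (density_cutoff k v * ((fst (snd v) \<bullet> fst (snd v)) / fst v))) I"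
      by (rule cc[OF _ k0]) (intro continuous_intros)
    have t2: "\<exists>I. young_limit (\<lambda>z v. (?\<omega> z * (?\<theta> z * real CARD('d) + \<epsilon> * (8 * c_v \<gamma> + 4 - 4 * (?y z \<bullet> ?y z)))) * (density_cutoff k v * pressure \<gamma> (fst v) (snd (snd v)))) I"
      by (rule cc[OF _ p]) (intro continuous_intros dc)
    have t3: "\<exists>I. young_limit (\<lambda>z v. \<Sum>p\<in>Basis \<times> Basis. (?\<omega> z * (- 4 * \<epsilon> * ((?y z \<bullet> fst p) * (?y z \<bullet> snd p)))) * (density_cutoff k v * ((fst (snd v) \<bullet> fst p) * (fst (snd v) \<bullet> snd p) / fst v))) I"
    proof (rule young_limit_sum_ex)
      fix p :: "(real^'d) \<times> (real^'d)"
      show "\<exists>I. young_limit (\<lambda>z v. (?\<omega> z * (- 4 * \<epsilon> * ((?y z \<bullet> fst p) * (?y z \<bullet> snd p)))) * (density_cutoff k v * ((fst (snd v) \<bullet> fst p) * (fst (snd v) \<bullet> snd p) / fst v))) I"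
        by (rule cc[OF _ kij]) (intro continuous_intros dc)
    qed
    show ?thesis unfolding e
      by (rule young_limit_add_ex[OF young_limit_add_ex[OF young_limit_add_ex[OF t1 t2] t3] s])
  qed
  have "\<forall>k. \<exists>F. young_limit (f k) F" using flim by blast
  then obtain F where F: "\<And>k. young_limit (f k) (F k)" by metis
  have \<omega>: "0 \<le> ?\<omega> z" "?\<omega> z \<le> T ^ 3" if "z \<in> cylinder T" for z
    using test_weight_bounds[OF that] \<epsilon> b by auto
  have \<theta>: "0 \<le> ?\<theta> z" for z using log_cutoff_bounds(1)[of \<epsilon> "snd z"] \<epsilon> by simp
  have cf0: "0 \<le> convexified_flux \<gamma> (?\<theta> z) \<epsilon> (?y z) (fst v) (fst (snd v)) (snd (snd v))"
    if "v \<in> energy_domain" for z and v :: "real \<times> (real^'d) \<times> real"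
    using that by (intro convexified_flux_nonneg[OF \<gamma> \<theta> _ norm_damped]) (use \<epsilon> in auto)
  have posdom: "v \<in> energy_domain" if "fst v > 0" for v :: "real \<times> (real^'d) \<times> real"
    using that by (cases v) (auto simp: energy_domain_def)
  have fnn: "0 \<le> f k z v" if z: "z \<in> cylinder T" for k z v
  proof -
    have "0 \<le> density_cutoff k v * (?\<omega> z * convexified_flux \<gamma> (?\<theta> z) \<epsilon> (?y z) (fst v) (fst (snd v)) (snd (snd v)))"
    proof (cases "fst v > 0")
      case True thus ?thesis using density_cutoff_bounds(1)[of k v] \<omega>(1)[OF z] cf0[OF posdom] by simp
    next
      case False thus ?thesis by (simp add: density_cutoff_zero)
    qed
    moreover have "0 \<le> ?\<omega> z * (\<kappa> * c) * (cutoff k v * max 0 (- snd (snd v)))"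
      using \<omega>(1)[OF z] \<kappa> c cutoff_bounds(1)[of k v] by simp
    ultimately show ?thesis by (simp add: f_def)
  qed
  have fmono: "f k z v \<le> f l z v" if z: "z \<in> cylinder T" and kl: "k \<le> l" for k l z v
  proof -
    have "density_cutoff k v * (?\<omega> z * convexified_flux \<gamma> (?\<theta> z) \<epsilon> (?y z) (fst v) (fst (snd v)) (snd (snd v)))
      \<le> density_cutoff l v * (?\<omega> z * convexified_flux \<gamma> (?\<theta> z) \<epsilon> (?y z) (fst v) (fst (snd v)) (snd (snd v)))"
    proof (cases "fst v > 0")
      case True thus ?thesis using \<omega>(1)[OF z] cf0[OF posdom]
        by (intro mult_right_mono density_cutoff_mono kl mult_nonneg_nonneg) auto
    next
      case False thus ?thesis by (simp add: density_cutoff_zero)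
    qed
    moreover have "?\<omega> z * (\<kappa> * c) * (cutoff k v * max 0 (- snd (snd v))) \<le> ?\<omega> z * (\<kappa> * c) * (cutoff l v * max 0 (- snd (snd v)))"
      using \<omega>(1)[OF z] \<kappa> c by (intro mult_left_mono mult_right_mono cutoff_mono kl mult_nonneg_nonneg) auto
    ultimately show ?thesis by (simp add: f_def)
  qed
  have ftend: "(\<lambda>k. f k z v) \<longlonglongrightarrow> fl z v" for z v
    unfolding f_def fl_def
  proof (intro tendsto_intros density_cutoff_tendsto)
    show "(\<lambda>k. cutoff k v * max 0 (- snd (snd v))) \<longlonglongrightarrow> max 0 (- snd (snd v))"
      by (rule tendsto_eventually) (use cutoff_eventually[of v] in \<open>auto elim: eventually_mono\<close>)
  qed
  have ident: "fl z v + a z v = flux_energy b \<epsilon> z v" if v: "v \<in> energy_domain" for z v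
  proof -
    have m: "fst (snd v) \<bullet> snd z = (\<Sum>i\<in>Basis. (snd z \<bullet> i) * (fst (snd v) \<bullet> i))"
      by (subst euclidean_inner) (simp add: mult.commute)
    have cf: "(if fst v > 0 then ?\<omega> z * convexified_flux \<gamma> (?\<theta> z) \<epsilon> (?y z) (fst v) (fst (snd v)) (snd (snd v)) else 0)
      = ?\<omega> z * convexified_flux \<gamma> (?\<theta> z) \<epsilon> (?y z) (fst v) (fst (snd v)) (snd (snd v))"
      using v by (auto simp: energy_domain_def convexified_flux_def kinetic_def)
    have S: "snd (snd v) = max 0 (snd (snd v)) - max 0 (- snd (snd v))" by simp
    have sm: "(\<Sum>i\<in>Basis. (test_time b \<epsilon> z * (snd z \<bullet> i)) * (fst (snd v) \<bullet> i)) = test_time b \<epsilon> z * (fst (snd v) \<bullet> snd z)"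
      unfolding m by (simp add: sum_distrib_left mult.assoc)
    have et': "energy_tangent \<gamma> w v = \<alpha> * fst v + fst (snd v) \<bullet> \<beta> + c * (max 0 (snd (snd v)) - max 0 (- snd (snd v))) + \<delta>"
      unfolding et S[symmetric] by (simp add: inner_commute)
    show ?thesis unfolding fl_def a_def flux_energy_def cf sm \<kappa>_def[symmetric] et'
      by (simp add: algebra_simps)
  qed
  have fle: "f k z v \<le> fl z v" if "z \<in> cylinder T" for k z v
    by (rule LIMSEQ_le_const[OF ftend]) (use fmono[OF that] in blast)
  \<comment> \<open>Moving the convergent part to the other side bounds the integrals of the truncated part, uniformly in \<open>k\<close>.\<close>
  define X where "X = m\<^sub>0 + \<kappa> * (T ^ 3 * C) - (LINT z|M. A z)"
  have bd: "(LINT z|M. F k z) \<le> X" for k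
  proof -
    have fa: "young_limit (\<lambda>z v. f k z v + a z v) (\<lambda>z. F k z + A z)" by (rule young_limit_add[OF F A])
    have up: "(LINT z|M. f k z (Z n z) + a z (Z n z)) \<le> (LINT z|M. momentum_functional (Z n) (radial_field b \<epsilon>) z) + \<kappa> * (T ^ 3 * C)" for n
    proof -
      have wi: "integrable M (\<lambda>z. T ^ 3 * bregman_energy \<gamma> w (Z n z))" using R_Z_integrable by auto
      have "AE z in M. f k z (Z n z) + a z (Z n z) \<le> momentum_functional (Z n) (radial_field b \<epsilon>) z + \<kappa> * (T ^ 3 * bregman_energy \<gamma> w (Z n z))"
        using dom[of n] AE_space
      proof eventually_elim
        fix z assume d: "Z n z \<in> energy_domain" and z: "z \<in> space M"
        have zc: "z \<in> cylinder T" using z by simp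
        have "f k z (Z n z) + a z (Z n z) \<le> flux_energy b \<epsilon> z (Z n z)"
          using fle[OF zc, of k "Z n z"] ident[OF d, of z] by linarith
        also have "\<dots> = momentum_functional (Z n) (radial_field b \<epsilon>) z + \<kappa> * (?\<omega> z * bregman_energy \<gamma> w (Z n z))"
          unfolding flux_energy_eq[of "Z n", OF d] \<kappa>_def ..
        also have "\<kappa> * (?\<omega> z * bregman_energy \<gamma> w (Z n z)) \<le> \<kappa> * (T ^ 3 * bregman_energy \<gamma> w (Z n z))"
          using \<omega>[OF zc] \<kappa> R_nonneg[OF d] by (intro mult_left_mono mult_right_mono)
        finally show "f k z (Z n z) + a z (Z n z) \<le> momentum_functional (Z n) (radial_field b \<epsilon>) z + \<kappa> * (T ^ 3 * bregman_energy \<gamma> w (Z n z))" by simp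
      qed
      hence "(LINT z|M. f k z (Z n z) + a z (Z n z)) \<le> (LINT z|M. momentum_functional (Z n) (radial_field b \<epsilon>) z + \<kappa> * (T ^ 3 * bregman_energy \<gamma> w (Z n z)))"
        using fa mi[of n] wi unfolding young_limit_def by (intro integral_mono_AE) auto
      also have "\<dots> = (LINT z|M. momentum_functional (Z n) (radial_field b \<epsilon>) z) + \<kappa> * (T ^ 3 * (LINT z|M. bregman_energy \<gamma> w (Z n z)))"
        using mi[of n] R_Z_integrable[of n] by simp
      also have "\<kappa> * (T ^ 3 * (LINT z|M. bregman_energy \<gamma> w (Z n z))) \<le> \<kappa> * (T ^ 3 * C)"
        using \<kappa> T R_Z_integral by (intro mult_left_mono) auto
      finally show ?thesis by simp
    qed
    have "(LINT z|M. F k z + A z) \<le> m\<^sub>0 + \<kappa> * (T ^ 3 * C)"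
    proof (rule LIMSEQ_le)
      show "(\<lambda>n. LINT z|M. f k z (Z n z) + a z (Z n z)) \<longlonglongrightarrow> (LINT z|M. F k z + A z)" using fa by (simp add: young_limit_def)
      show "(\<lambda>n. (LINT z|M. momentum_functional (Z n) (radial_field b \<epsilon>) z) + \<kappa> * (T ^ 3 * C)) \<longlonglongrightarrow> m\<^sub>0 + \<kappa> * (T ^ 3 * C)"
        by (intro tendsto_intros ml)
      show "\<exists>N. \<forall>n\<ge>N. (LINT z|M. f k z (Z n z) + a z (Z n z)) \<le> (LINT z|M. momentum_functional (Z n) (radial_field b \<epsilon>) z) + \<kappa> * (T ^ 3 * C)"
        using up by blast
    qed
    moreover have "(LINT z|M. F k z + A z) = (LINT z|M. F k z) + (LINT z|M. A z)"
      using F[of k] A unfolding young_limit_def by simp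
    ultimately show ?thesis by (simp add: X_def)
  qed
  obtain Fl where Fl: "integrable M Fl" "(LINT z|M. Fl z) \<le> X"
    "AE z in M. integrable (V z) (fl z) \<and> (LINT v|V z. fl z v) = Fl z"
    using young_monotone_limit[OF F fnn fmono ftend bd] by blast
  have Ai: "integrable M A" "AE z in M. integrable (V z) (a z) \<and> (LINT v|V z. a z v) = A z"
    using A by (auto simp: young_limit_def)
  show ?thesis
  proof (intro exI[of _ "\<lambda>z. Fl z + A z"] conjI)
    show "integrable M (\<lambda>z. Fl z + A z)" using Fl(1) Ai(1) by simp
    show "(LINT z|M. Fl z + A z) \<le> m\<^sub>0 + kappa \<gamma> * \<epsilon> * (T ^ 3 * C)"
      using Fl(1,2) Ai(1) by (simp add: X_def \<kappa>_def)
    show "AE z in M. \<exists>g. integrable (V z) g \<and> (LINT v|V z. g v) = Fl z + A z \<and> (AE v in V z. g v = flux_energy b \<epsilon> z v)"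
      using Fl(3) Ai(2) young_in_energy_domain
    proof eventually_elim
      fix z assume 1: "integrable (V z) (fl z) \<and> (LINT v|V z. fl z v) = Fl z" and 2: "integrable (V z) (a z) \<and> (LINT v|V z. a z v) = A z"
        and d: "AE v in V z. v \<in> energy_domain"
      have "AE v in V z. fl z v + a z v = flux_energy b \<epsilon> z v" using d by eventually_elim (rule ident)
      thus "\<exists>g. integrable (V z) g \<and> (LINT v|V z. g v) = Fl z + A z \<and> (AE v in V z. g v = flux_energy b \<epsilon> z v)"
        using 1 2 by (intro exI[of _ "\<lambda>v. fl z v + a z v"]) auto
    qed
  qed
qed

text \<open>For the barycenter the momentum functional integrates to zero, so by \<open>flux_energy_limit\<close> and \<open>jensen_defect\<close>
the nonnegative functions \<open>D j\<close> have integrals of order \<open>\<epsilon> j\<close>. They dominate the mean relative energy with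
respect to the barycenter times weights, and while \<open>\<epsilon> j\<close> tends to \<open>0\<close> these weights increase to a positive
function of time.\<close>

lemma young_measure_is_dirac:
  assumes bary: "AE z in M. U z = (LINT v|V z. fst v, LINT v|V z. fst (snd v), LINT v|V z. snd (snd v))"
    and vac: "AE z in M. fst (U z) = 0 \<longrightarrow> snd (snd (U z)) = 0"
    and fluxU: "\<And>\<phi>. \<phi> \<in> C1c (cylinder0 T) \<Longrightarrow> (\<And>x. \<phi> (0, x) = 0) \<Longrightarrow>
      integrable M (momentum_functional U \<phi>) \<and> (LINT z|M. momentum_functional U \<phi> z) = 0"
    and fluxZ: "\<And>\<phi> n. \<phi> \<in> C1c (cylinder0 T) \<Longrightarrow> (\<And>x. \<phi> (0, x) = 0) \<Longrightarrow> integrable M (momentum_functional (Z n) \<phi>)"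
    and fluxlim: "\<And>\<phi>. \<phi> \<in> C1c (cylinder0 T) \<Longrightarrow> (\<And>x. \<phi> (0, x) = 0) \<Longrightarrow> (\<lambda>n. LINT z|M. momentum_functional (Z n) \<phi> z) \<longlonglongrightarrow> 0"
  shows "AE z in M. AE v in V z. v = U z"
proof -
  define \<epsilon> where "\<epsilon> j = 1 / real (Suc j)" for j
  \<comment> \<open>The supports of the time bumps exhaust the time interval but stay away from its right end.\<close>
  define b where "b j = T * (1 - 1 / (real j + 2))" for j
  have \<epsilon>: "\<epsilon> j > 0" for j by (simp add: \<epsilon>_def)
  have b: "0 < b j" "b j < T" for j
  proof -
    have "0 < 1 / (real j + 2)" "1 / (real j + 2) < 1" by auto
    thus "0 < b j" "b j < T" using T by (simp_all add: b_def)
  qed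
  let ?\<phi> = "\<lambda>j. radial_field (b j) (\<epsilon> j) :: real \<times> (real^'d) \<Rightarrow> real^'d"
  have \<phi>: "?\<phi> j \<in> C1c (cylinder0 T)" for j by (rule radial_field_C1c[OF \<epsilon> b])
  have \<phi>0: "?\<phi> j (0, x) = 0" for j x by (simp add: radial_field_def time_bump_def)
  have "\<exists>I. integrable M I \<and> (LINT z|M. I z) \<le> 0 + kappa \<gamma> * \<epsilon> j * (T ^ 3 * C) \<and>
    (AE z in M. \<exists>g. integrable (V z) g \<and> (LINT v|V z. g v) = I z \<and> (AE v in V z. g v = flux_energy (b j) (\<epsilon> j) z v))" for j
    by (rule flux_energy_limit[OF \<epsilon> b fluxZ[OF \<phi> \<phi>0] fluxlim[OF \<phi> \<phi>0]])
  hence "\<forall>j. \<exists>I. integrable M I \<and> (LINT z|M. I z) \<le> 0 + kappa \<gamma> * \<epsilon> j * (T ^ 3 * C) \<and>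
    (AE z in M. \<exists>g. integrable (V z) g \<and> (LINT v|V z. g v) = I z \<and> (AE v in V z. g v = flux_energy (b j) (\<epsilon> j) z v))"
    by (rule allI)
  from choice[OF this] obtain I where I': "\<forall>j. integrable M (I j) \<and> (LINT z|M. I j z) \<le> 0 + kappa \<gamma> * \<epsilon> j * (T ^ 3 * C) \<and>
    (AE z in M. \<exists>g. integrable (V z) g \<and> (LINT v|V z. g v) = I j z \<and> (AE v in V z. g v = flux_energy (b j) (\<epsilon> j) z v))" ..
  have I: "\<And>j. integrable M (I j)" "\<And>j. (LINT z|M. I j z) \<le> kappa \<gamma> * \<epsilon> j * (T ^ 3 * C)"
    "\<And>j. AE z in M. \<exists>g. integrable (V z) g \<and> (LINT v|V z. g v) = I j z \<and> (AE v in V z. g v = flux_energy (b j) (\<epsilon> j) z v)"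
    using I' by auto
  define D where "D j z = I j z - momentum_functional U (?\<phi> j) z" for j z
  define \<eta> where "\<eta> j z = test_weight (b j) (\<epsilon> j) z * log_cutoff (\<epsilon> j) (snd z)" for j and z :: "real \<times> (real^'d)"
  define \<kappa> where "\<kappa> = min 2 (\<gamma> - 1)"
  have \<kappa>: "\<kappa> > 0" using \<gamma> by (simp add: \<kappa>_def)
  have gAE: "AE z in M. \<forall>j. \<exists>g. integrable (V z) g \<and> (LINT v|V z. g v) = I j z \<and> (AE v in V z. g v = flux_energy (b j) (\<epsilon> j) z v)"
    using I(3) by (subst AE_all_countable) blast
  have key: "AE z in M. (\<forall>j. 0 \<le> D j z) \<and> 0 \<le> fst (U z) \<and>
      (fst (U z) > 0 \<longrightarrow> (\<forall>j. \<eta> j z > 0 \<longrightarrow> integrable (V z) (bregman_energy \<gamma> (U z)) \<and>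
         \<eta> j z * (\<kappa> * (LINT v|V z. bregman_energy \<gamma> (U z) v)) \<le> D j z)) \<and>
      (fst (U z) = 0 \<longrightarrow> (AE v in V z. v = U z))"
    using gAE young_in_energy_domain young_integrable bary vac AE_space
  proof eventually_elim
    fix z
    assume g: "\<forall>j. \<exists>g. integrable (V z) g \<and> (LINT v|V z. g v) = I j z \<and> (AE v in V z. g v = flux_energy (b j) (\<epsilon> j) z v)"
      and d: "AE v in V z. v \<in> energy_domain"
      and int: "integrable (V z) (\<lambda>v. norm v) \<and> integrable (V z) fst \<and> integrable (V z) (\<lambda>v. fst (snd v)) \<and> integrable (V z) (\<lambda>v. snd (snd v))"
      and U: "U z = (LINT v|V z. fst v, LINT v|V z. fst (snd v), LINT v|V z. snd (snd v))"
      and vac: "fst (U z) = 0 \<longrightarrow> snd (snd (U z)) = 0" and z: "z \<in> space M"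
    have zc: "z \<in> cylinder T" using z by simp
    have P: "prob_space (V z)" by (rule V_prob[OF zc])
    have sV: "sets (V z) = sets borel" by (rule V_sets[OF zc])
    have i1: "integrable (V z) fst" and i2: "integrable (V z) (\<lambda>v. fst (snd v))" and i3: "integrable (V z) (\<lambda>v. snd (snd v))"
      using int by auto
    have vac': "fst (U z) = 0 \<Longrightarrow> snd (snd (U z)) = 0" using vac by blast
    have dir0: "AE v in V z. v = (0, 0, 0)" if "fst (U z) = 0"
      using that vac'[OF that] by (intro vacuum_dirac(1)[OF P d i1 i2 i3]) (auto simp: U)
    have m0: "fst (snd (U z)) = 0" if "fst (U z) = 0"
      using that vac'[OF that] vacuum_dirac(2)[OF P d i1 i2 i3] by (simp add: U)
    have nn: "0 \<le> test_weight (b j) (\<epsilon> j) z" "0 \<le> log_cutoff (\<epsilon> j) (snd z)" "0 \<le> \<epsilon> j" for j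
      using test_weight_bounds(1)[OF zc, of "\<epsilon> j" "b j"] log_cutoff_bounds(1)[of "\<epsilon> j" "snd z"] \<epsilon>[of j] b[of j] by auto
    have U0: "0 \<le> fst (U z)"
    proof -
      obtain g where "integrable (V z) g" "AE v in V z. g v = flux_energy (b 0) (\<epsilon> 0) z v" using g by blast
      thus ?thesis using jensen_defect(4)[OF \<gamma> w P sV d i1 i2 i3 U vac' nn(1)[of 0] nn(2)[of 0] nn(3)[of 0]]
        unfolding flux_energy_def by blast
    qed
    have mom: "momentum_functional U (?\<phi> j) z = test_time (b j) (\<epsilon> j) z * (fst (snd (U z)) \<bullet> snd z)
        + test_weight (b j) (\<epsilon> j) z * momentum_flux_form \<gamma> (log_cutoff (\<epsilon> j) (snd z)) (\<epsilon> j) (snd z) (fst (U z)) (fst (snd (U z))) (snd (snd (U z)))" for j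
      unfolding momentum_functional_def test_time_def test_weight_def
      using U0 m0 momentum_integrand_radial_field[of "\<lambda>z. fst (U z)" "fst z" "snd z" "\<lambda>z. fst (snd (U z))" \<gamma> "\<lambda>z. snd (snd (U z))"]
      by (cases "fst (U z) = 0") auto
    have J: "0 \<le> D j z" "fst (U z) > 0 \<Longrightarrow> \<eta> j z > 0 \<Longrightarrow> integrable (V z) (bregman_energy \<gamma> (U z)) \<and>
         \<eta> j z * (\<kappa> * (LINT v|V z. bregman_energy \<gamma> (U z) v)) \<le> D j z" for j
    proof -
      obtain g where g': "integrable (V z) g" "(LINT v|V z. g v) = I j z" "AE v in V z. g v = flux_energy (b j) (\<epsilon> j) z v" using g by blast
      note JD = jensen_defect[OF \<gamma> w P sV d i1 i2 i3 U vac' nn g'(1) g'(3)[unfolded flux_energy_def], folded mom, unfolded g'(2)]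
      show "0 \<le> D j z" using JD(1) by (simp add: D_def)
      show "integrable (V z) (bregman_energy \<gamma> (U z)) \<and>
         \<eta> j z * (\<kappa> * (LINT v|V z. bregman_energy \<gamma> (U z) v)) \<le> D j z" if "fst (U z) > 0" "\<eta> j z > 0"
        using JD(2,3) that by (simp add: D_def \<eta>_def \<kappa>_def)
    qed
    have "U z = (0, 0, 0)" if "fst (U z) = 0"
      using that m0[OF that] vac'[OF that] by (cases "U z") auto
    with J U0 dir0 show "(\<forall>j. 0 \<le> D j z) \<and> 0 \<le> fst (U z) \<and>
      (fst (U z) > 0 \<longrightarrow> (\<forall>j. \<eta> j z > 0 \<longrightarrow> integrable (V z) (bregman_energy \<gamma> (U z)) \<and>
         \<eta> j z * (\<kappa> * (LINT v|V z. bregman_energy \<gamma> (U z) v)) \<le> D j z)) \<and>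
      (fst (U z) = 0 \<longrightarrow> (AE v in V z. v = U z))" by auto
  qed
  have Di: "integrable M (D j)" for j unfolding D_def[abs_def] using I(1) fluxU[OF \<phi> \<phi>0] by auto
  have DL: "(LINT z|M. norm (D j z)) \<le> kappa \<gamma> * \<epsilon> j * (T ^ 3 * C)" for j
  proof -
    have "AE z in M. norm (D j z) = D j z" using key by eventually_elim simp
    hence "(LINT z|M. norm (D j z)) = (LINT z|M. D j z)" using Di by (intro integral_cong_AE) auto
    also have "\<dots> = (LINT z|M. I j z)" unfolding D_def using I(1) fluxU[OF \<phi> \<phi>0] by simp
    also note I(2)
    finally show ?thesis .
  qed
  have "(\<lambda>j. LINT z|M. norm (D j z)) \<longlonglongrightarrow> 0"
  proof (rule tendsto_sandwich)
    show "\<forall>\<^sub>F j in sequentially. 0 \<le> (LINT z|M. norm (D j z))" by (intro always_eventually allI integral_nonneg_AE) auto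
    show "\<forall>\<^sub>F j in sequentially. (LINT z|M. norm (D j z)) \<le> kappa \<gamma> * \<epsilon> j * (T ^ 3 * C)" using DL by (intro always_eventually allI)
    show "(\<lambda>j. 0 :: real) \<longlonglongrightarrow> 0" by simp
    have "(\<lambda>j. kappa \<gamma> * \<epsilon> j * (T ^ 3 * C)) \<longlonglongrightarrow> kappa \<gamma> * 0 * (T ^ 3 * C)"
      unfolding \<epsilon>_def by (intro tendsto_intros LIMSEQ_Suc[OF lim_1_over_n])
    thus "(\<lambda>j. kappa \<gamma> * \<epsilon> j * (T ^ 3 * C)) \<longlonglongrightarrow> 0" by simp
  qed
  from tendsto_L1_AE_subseq[OF Di this] obtain r where r: "strict_mono r" "AE z in M. (\<lambda>j. D (r j) z) \<longlonglongrightarrow> 0" by auto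
  show ?thesis
    using key r(2) young_in_energy_domain AE_space
  proof eventually_elim
    fix z
    assume k: "(\<forall>j. 0 \<le> D j z) \<and> 0 \<le> fst (U z) \<and>
      (fst (U z) > 0 \<longrightarrow> (\<forall>j. \<eta> j z > 0 \<longrightarrow> integrable (V z) (bregman_energy \<gamma> (U z)) \<and>
         \<eta> j z * (\<kappa> * (LINT v|V z. bregman_energy \<gamma> (U z) v)) \<le> D j z)) \<and>
      (fst (U z) = 0 \<longrightarrow> (AE v in V z. v = U z))"
      and D0: "(\<lambda>j. D (r j) z) \<longlonglongrightarrow> 0" and d: "AE v in V z. v \<in> energy_domain" and z: "z \<in> space M"
    show "AE v in V z. v = U z"
    proof (cases "fst (U z) > 0")
      case False thus ?thesis using k by auto
    next
      case True
      obtain t x where tx: "z = (t, x)" by (cases z)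
      have t: "0 < t" "t < T" using z tx by auto
      have bl: "b \<longlonglongrightarrow> T"
      proof -
        have "(\<lambda>j. 1 / (real j + 2)) \<longlonglongrightarrow> 0"
        proof (rule Lim_null_comparison[OF always_eventually LIMSEQ_Suc[OF lim_1_over_n]], intro allI)
          show "norm (1 / (real j + 2)) \<le> 1 / real (Suc j)" for j by (simp add: frac_le)
        qed
        hence "(\<lambda>j. T * (1 - 1 / (real j + 2))) \<longlonglongrightarrow> T * (1 - 0)" by (intro tendsto_intros)
        thus ?thesis by (simp add: b_def[abs_def])
      qed
      have el: "\<epsilon> \<longlonglongrightarrow> 0" unfolding \<epsilon>_def[abs_def] by (rule LIMSEQ_Suc[OF lim_1_over_n])
      have \<theta>l: "(\<lambda>j. log_cutoff (\<epsilon> j) x) \<longlonglongrightarrow> max 0 (1 - 0 * ln (1 + x \<bullet> x))"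
        unfolding log_cutoff_def by (intro tendsto_intros el)
      have "(\<lambda>j. \<eta> j z) \<longlonglongrightarrow> (t * (max 0 (T - t))\<^sup>2 * max 0 (1 - 0 * ln (1 + x \<bullet> x))) * max 0 (1 - 0 * ln (1 + x \<bullet> x))"
        unfolding \<eta>_def test_weight_def time_bump_def tx fst_conv snd_conv by (intro tendsto_intros bl \<theta>l)
      hence \<eta>l: "(\<lambda>j. \<eta> j z) \<longlonglongrightarrow> t * (T - t)\<^sup>2" using t by simp
      have lp: "t * (T - t)\<^sup>2 > 0" using t by simp
      have ev: "\<forall>\<^sub>F j in sequentially. \<eta> j z > 0" by (rule order_tendstoD(1)[OF \<eta>l lp])
      from eventually_happens'[OF sequentially_bot ev] obtain j where "\<eta> j z > 0" ..
      hence ib: "integrable (V z) (bregman_energy \<gamma> (U z))" using k True by blast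
      define L where "L = (LINT v|V z. bregman_energy \<gamma> (U z) v)"
      have "(t * (T - t)\<^sup>2) * (\<kappa> * L) \<le> 0"
      proof (rule tendsto_le[OF sequentially_bot D0])
        show "(\<lambda>j. \<eta> (r j) z * (\<kappa> * L)) \<longlonglongrightarrow> (t * (T - t)\<^sup>2) * (\<kappa> * L)"
          using LIMSEQ_subseq_LIMSEQ[OF \<eta>l r(1)] by (intro tendsto_intros) (simp add: o_def)
        have "\<forall>\<^sub>F j in sequentially. \<eta> (r j) z > 0" by (rule eventually_subseq[OF r(1) ev])
        thus "\<forall>\<^sub>F j in sequentially. \<eta> (r j) z * (\<kappa> * L) \<le> D (r j) z"
          by eventually_elim (use k True in \<open>auto simp: L_def\<close>)
      qed
      moreover have "(t * (T - t)\<^sup>2) * (\<kappa> * L) > 0" if "L > 0"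
        by (rule mult_pos_pos[OF lp mult_pos_pos[OF \<kappa> that]])
      ultimately have L0: "L \<le> 0" by fastforce
      have nnb: "AE v in V z. 0 \<le> bregman_energy \<gamma> (U z) v"
        using d by eventually_elim (rule bregman_energy_nonneg[OF \<gamma> True])
      hence "L = 0" using L0 integral_nonneg_AE[OF nnb] by (simp add: L_def)
      hence "AE v in V z. bregman_energy \<gamma> (U z) v = 0"
        using integral_nonneg_eq_0_iff_AE[OF ib nnb] by (simp add: L_def)
      thus ?thesis using d by eventually_elim (rule bregman_energy_zero[OF \<gamma> True])
    qed
  qed
qed

end

section \<open>Consistent approximations of the Euler system\<close>

lemma energy_domain_borel: "(energy_domain :: (real \<times> (real^'d) \<times> real) set) \<in> sets borel"
proof -
  have 1: "{v :: real \<times> (real^'d) \<times> real. fst v > 0} \<in> sets borel"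
    by (intro borel_open open_Collect_less continuous_intros)
  have "closed ({v :: real \<times> (real^'d) \<times> real. fst v = 0} \<inter> {v. fst (snd v) = 0} \<inter> {v. snd (snd v) \<le> 0})"
    by (intro closed_Int closed_Collect_eq closed_Collect_le continuous_intros)
  hence 2: "({v :: real \<times> (real^'d) \<times> real. fst v = 0} \<inter> {v. fst (snd v) = 0} \<inter> {v. snd (snd v) \<le> 0}) \<in> sets borel"
    by (rule borel_closed)
  have 3: "energy_domain = {v. fst v > 0} \<union> ({v :: real \<times> (real^'d) \<times> real. fst v = 0} \<inter> {v. fst (snd v) = 0} \<inter> {v. snd (snd v) \<le> 0})"
    by (auto simp: energy_domain_def)
  show ?thesis unfolding 3 by (rule sets.Un[OF 1 2])
qed

lemma e2ennreal_relative_energy: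
  fixes u v :: "real \<times> (real^'d) \<times> real"
  assumes "\<gamma> > 1" "fst u > 0"
  shows "e2ennreal (relative_energy \<gamma> u v) = (if v \<in> energy_domain then ennreal (bregman_energy \<gamma> u v) else \<infinity>)"
  unfolding relative_energy_eq[OF assms]
  by (auto simp: ennreal.abs_eq e2ennreal_infty ereal_infty_less e2ennreal_ereal)

lemma borel_measurable_relative_energy:
  fixes u :: "real \<times> (real^'d) \<times> real"
  assumes "\<gamma> > 1" "fst u > 0"
  shows "(\<lambda>v. e2ennreal (relative_energy \<gamma> u v)) \<in> borel_measurable borel"
  unfolding e2ennreal_relative_energy[OF assms]
proof (rule measurable_If_set)
  show "(\<lambda>v. ennreal (bregman_energy \<gamma> u v)) \<in> borel_measurable borel"
    using borel_measurable_bregman_energy by measurable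
qed (use energy_domain_borel in auto)

text \<open>The energy inequality holds on almost every time slice; integrating it in time gives the bound required
by \<open>euler_young\<close>. An infinite relative energy outside the energy domain is thereby excluded.\<close>

lemma relative_energy_slices:
  fixes Z :: "real \<times> (real^'d) \<Rightarrow> real \<times> (real^'d) \<times> real"
  assumes \<gamma>: "\<gamma> > 1" and w: "fst w > 0" and T: "T > 0" and E: "0 \<le> E"
    and Z: "Z \<in> borel_measurable (lebesgue_on (cylinder T))"
    and bd: "AE t in lebesgue_on {0<..<T}. (\<integral>\<^sup>+x. e2ennreal (relative_energy \<gamma> w (Z (t, x))) \<partial>lebesgue) \<le> ennreal E"
  shows "AE z in lebesgue_on (cylinder T). Z z \<in> energy_domain"
    and "(\<integral>\<^sup>+z. ennreal (bregman_energy \<gamma> w (Z z)) \<partial>lebesgue_on (cylinder T)) \<le> ennreal (E * T)"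
proof -
  let ?M = "lebesgue_on (cylinder T) :: (real \<times> (real^'d)) measure"
  define H where "H v = e2ennreal (relative_energy \<gamma> w v)" for v :: "real \<times> (real^'d) \<times> real"
  have H: "H v = (if v \<in> energy_domain then ennreal (bregman_energy \<gamma> w v) else \<infinity>)" for v
    unfolding H_def by (rule e2ennreal_relative_energy[OF \<gamma> w])
  have [measurable]: "H \<in> borel_measurable borel"
    unfolding H_def[abs_def] by (rule borel_measurable_relative_energy[OF \<gamma> w])
  have HZ: "(\<lambda>z. H (Z z)) \<in> borel_measurable ?M" using Z by measurable
  have "(\<integral>\<^sup>+z. H (Z z) \<partial>?M) = (\<integral>\<^sup>+t. (\<integral>\<^sup>+x. H (Z (t, x)) \<partial>lebesgue) \<partial>lebesgue_on {0<..<T})"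
    by (rule nn_integral_cylinder(1)[OF HZ])
  also have "\<dots> \<le> (\<integral>\<^sup>+t. ennreal E \<partial>lebesgue_on {0<..<T})"
    using bd by (intro nn_integral_mono_AE) (simp add: H_def)
  also have "\<dots> = ennreal (E * T)" using T E by (simp add: emeasure_restrict_space ennreal_mult)
  finally have bH: "(\<integral>\<^sup>+z. H (Z z) \<partial>?M) \<le> ennreal (E * T)" .
  have "AE z in ?M. H (Z z) \<noteq> \<infinity>"
    using bH HZ by (intro nn_integral_PInf_AE) (auto simp: top_unique)
  thus dom: "AE z in ?M. Z z \<in> energy_domain" by eventually_elim (simp add: H split: if_splits)
  have "(\<integral>\<^sup>+z. ennreal (bregman_energy \<gamma> w (Z z)) \<partial>?M) \<le> (\<integral>\<^sup>+z. H (Z z) \<partial>?M)"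
    using dom by (intro nn_integral_mono_AE) (auto simp: H elim: eventually_mono)
  also note bH
  finally show "(\<integral>\<^sup>+z. ennreal (bregman_energy \<gamma> w (Z z)) \<partial>?M) \<le> ennreal (E * T)" .
qed

lemma slices_from_energy:
  fixes Z :: "real \<times> (real^'d) \<Rightarrow> real \<times> (real^'d) \<times> real" and f :: "real \<times> (real^'d) \<Rightarrow> 'b::euclidean_space"
  assumes \<gamma>: "\<gamma> > 1" and w: "fst w > 0" and K: "compact K" and E: "0 \<le> E" and L: "0 \<le> L"
    and Z: "Z \<in> borel_measurable (lebesgue_on (cylinder T))"
    and bd: "AE t in lebesgue_on {0<..<T}. (\<integral>\<^sup>+x. e2ennreal (relative_energy \<gamma> w (Z (t, x))) \<partial>lebesgue) \<le> ennreal E"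
    and f: "\<And>z. Z z \<in> energy_domain \<Longrightarrow> norm (f z) \<le> L + bregman_energy \<gamma> w (Z z)"
  shows "AE t in lebesgue_on {0<..<T}. (\<integral>\<^sup>+x. ennreal (norm (f (t, x))) \<partial>lebesgue_on K) \<le> ennreal (L * measure lebesgue K + E)"
  using bd cylinder_section_measurable[OF Z]
proof eventually_elim
  fix t assume b: "(\<integral>\<^sup>+x. e2ennreal (relative_energy \<gamma> w (Z (t, x))) \<partial>lebesgue) \<le> ennreal E"
    and Zt [measurable]: "(\<lambda>x. Z (t, x)) \<in> borel_measurable lebesgue"
  have KL: "K \<in> lmeasurable" using K by (rule lmeasurable_compact)
  hence KS: "K \<in> sets lebesgue" by (rule fmeasurableD)
  have pt: "ennreal (norm (f z)) \<le> ennreal L + e2ennreal (relative_energy \<gamma> w (Z z))" for z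
  proof (cases "Z z \<in> energy_domain")
    case True
    have "ennreal (norm (f z)) \<le> ennreal (L + bregman_energy \<gamma> w (Z z))" using f[OF True] by (rule ennreal_leI)
    thus ?thesis using True L bregman_energy_nonneg[OF \<gamma> w True] by (simp add: e2ennreal_relative_energy[OF \<gamma> w])
  next
    case False thus ?thesis by (simp add: e2ennreal_relative_energy[OF \<gamma> w])
  qed
  have "(\<integral>\<^sup>+x. ennreal (norm (f (t, x))) \<partial>lebesgue_on K) = (\<integral>\<^sup>+x. ennreal (norm (f (t, x))) * indicator K x \<partial>lebesgue)"
    using KS by (simp add: nn_integral_restrict_space)
  also have "\<dots> \<le> (\<integral>\<^sup>+x. e2ennreal (relative_energy \<gamma> w (Z (t, x))) + ennreal L * indicator K x \<partial>lebesgue)"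
    using pt by (intro nn_integral_mono) (auto simp: indicator_def add.commute)
  also have "\<dots> = (\<integral>\<^sup>+x. e2ennreal (relative_energy \<gamma> w (Z (t, x))) \<partial>lebesgue) + (\<integral>\<^sup>+x. ennreal L * indicator K x \<partial>lebesgue)"
  proof (rule nn_integral_add)
    show "(\<lambda>x. e2ennreal (relative_energy \<gamma> w (Z (t, x)))) \<in> borel_measurable lebesgue"
      by (rule measurable_compose[OF Zt borel_measurable_relative_energy[OF \<gamma> w]])
    show "(\<lambda>x. ennreal L * indicator K x) \<in> borel_measurable lebesgue" using KS by measurable
  qed
  also have "(\<integral>\<^sup>+x. ennreal L * indicator K x \<partial>lebesgue) = ennreal (L * measure lebesgue K)"
    using KS KL L by (simp add: nn_integral_cmult_indicator emeasure_eq_measure2 ennreal_mult)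
  also have "(\<integral>\<^sup>+x. e2ennreal (relative_energy \<gamma> w (Z (t, x))) \<partial>lebesgue) + ennreal (L * measure lebesgue K)
      \<le> ennreal E + ennreal (L * measure lebesgue K)" using b by (rule add_right_mono)
  also have "\<dots> = ennreal (L * measure lebesgue K + E)"
    using E L by (simp add: ennreal_plus[symmetric] add.commute del: ennreal_plus)
  finally show "(\<integral>\<^sup>+x. ennreal (norm (f (t, x))) \<partial>lebesgue_on K) \<le> ennreal (L * measure lebesgue K + E)" .
qed

lemma consistent_approximation_measurable:
  assumes "consistent_approximation \<gamma> T w \<rho> m S \<rho>\<^sub>0 m\<^sub>0 S\<^sub>0"
  shows "\<rho> n \<in> borel_measurable (lebesgue_on (cylinder T))" "m n \<in> borel_measurable (lebesgue_on (cylinder T))"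
    "S n \<in> borel_measurable (lebesgue_on (cylinder T))"
  using assms unfolding consistent_approximation_def by simp_all

text \<open>For test fields that vanish at time \<open>0\<close> only the consistency error is left.\<close>

lemma consistent_approximation_momentum:
  fixes m :: "nat \<Rightarrow> real \<times> (real^'d) \<Rightarrow> real^'d"
  assumes ca: "consistent_approximation \<gamma> T w \<rho> m S \<rho>\<^sub>0 m\<^sub>0 S\<^sub>0"
    and \<phi>: "\<phi> \<in> C1c (cylinder0 T)" "\<And>x. \<phi> (0, x) = 0"
  shows "integrable (lebesgue_on (cylinder T)) (momentum_integrand \<gamma> (\<rho> n) (m n) (S n) \<phi>)"
    and "(\<lambda>n. LINT z|lebesgue_on (cylinder T). momentum_integrand \<gamma> (\<rho> n) (m n) (S n) \<phi> z) \<longlonglongrightarrow> 0"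
proof -
  have "\<exists>E2. \<forall>\<phi> \<in> C1c (cylinder0 T). vanishing_error T (\<lambda>n. E2 n \<phi>) \<and> (\<forall>n.
           integrable (lebesgue_on (cylinder T)) (momentum_integrand \<gamma> (\<rho> n) (m n) (S n) \<phi>) \<and>
           integrable lebesgue (\<lambda>x. m\<^sub>0 n x \<bullet> \<phi> (0, x)) \<and>
           - (LINT x|lebesgue. m\<^sub>0 n x \<bullet> \<phi> (0, x))
             = (LINT z|lebesgue_on (cylinder T). momentum_integrand \<gamma> (\<rho> n) (m n) (S n) \<phi> z)
               + (LINT t|lebesgue_on {0<..<T}. E2 n \<phi> t))"
    using ca unfolding consistent_approximation_def by - (elim conjE exE, intro exI, assumption)
  then obtain E2 where E2: "vanishing_error T (\<lambda>n. E2 n \<phi>)"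
    "\<And>n. integrable (lebesgue_on (cylinder T)) (momentum_integrand \<gamma> (\<rho> n) (m n) (S n) \<phi>)"
    "\<And>n. - (LINT x|lebesgue. m\<^sub>0 n x \<bullet> \<phi> (0, x))
             = (LINT z|lebesgue_on (cylinder T). momentum_integrand \<gamma> (\<rho> n) (m n) (S n) \<phi> z)
               + (LINT t|lebesgue_on {0<..<T}. E2 n \<phi> t)"
    using \<phi>(1) by meson
  show "integrable (lebesgue_on (cylinder T)) (momentum_integrand \<gamma> (\<rho> n) (m n) (S n) \<phi>)" by (rule E2(2))
  have eq: "(LINT z|lebesgue_on (cylinder T). momentum_integrand \<gamma> (\<rho> n) (m n) (S n) \<phi> z) = - (LINT t|lebesgue_on {0<..<T}. E2 n \<phi> t)" for n
    using E2(3)[of n] by (simp add: \<phi>(2))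
  show "(\<lambda>n. LINT z|lebesgue_on (cylinder T). momentum_integrand \<gamma> (\<rho> n) (m n) (S n) \<phi> z) \<longlonglongrightarrow> 0"
  proof (rule Lim_null_comparison)
    show "(\<lambda>n. LINT t|lebesgue_on {0<..<T}. \<bar>E2 n \<phi> t\<bar>) \<longlonglongrightarrow> 0" using E2(1) by (simp add: vanishing_error_def)
    show "\<forall>\<^sub>F n in sequentially. norm (LINT z|lebesgue_on (cylinder T). momentum_integrand \<gamma> (\<rho> n) (m n) (S n) \<phi> z)
        \<le> (LINT t|lebesgue_on {0<..<T}. \<bar>E2 n \<phi> t\<bar>)"
      unfolding eq by (intro always_eventually allI) (simp add: integral_abs_bound)
  qed
qed

lemma consistent_approximation_energy:
  fixes m :: "nat \<Rightarrow> real \<times> (real^'d) \<Rightarrow> real^'d"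
  assumes ca: "consistent_approximation \<gamma> T w \<rho> m S \<rho>\<^sub>0 m\<^sub>0 S\<^sub>0"
    and E0: "\<And>n. total_relative_energy \<gamma> w (\<rho>\<^sub>0 n) (m\<^sub>0 n) (S\<^sub>0 n) \<le> ennreal E0"
  shows "\<exists>E\<ge>0. \<forall>n. AE t in lebesgue_on {0<..<T}.
    (\<integral>\<^sup>+x. e2ennreal (relative_energy \<gamma> w (\<rho> n (t, x), m n (t, x), S n (t, x))) \<partial>lebesgue) \<le> ennreal E"
proof -
  have "\<exists>E3. (\<forall>n. 0 \<le> E3 n) \<and> E3 \<longlonglongrightarrow> 0 \<and>
        (\<forall>n. AE \<tau> in lebesgue_on {0<..<T}.
           total_relative_energy \<gamma> w (\<lambda>x. \<rho> n (\<tau>, x)) (\<lambda>x. m n (\<tau>, x)) (\<lambda>x. S n (\<tau>, x))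
             \<le> total_relative_energy \<gamma> w (\<rho>\<^sub>0 n) (m\<^sub>0 n) (S\<^sub>0 n) + ennreal (E3 n))"
    using ca unfolding consistent_approximation_def by - (elim conjE exE, intro exI conjI, assumption+)
  then obtain E3 where E3: "\<And>n. 0 \<le> E3 n" "E3 \<longlonglongrightarrow> 0"
    "\<And>n. AE \<tau> in lebesgue_on {0<..<T}.
           total_relative_energy \<gamma> w (\<lambda>x. \<rho> n (\<tau>, x)) (\<lambda>x. m n (\<tau>, x)) (\<lambda>x. S n (\<tau>, x))
             \<le> total_relative_energy \<gamma> w (\<rho>\<^sub>0 n) (m\<^sub>0 n) (S\<^sub>0 n) + ennreal (E3 n)" by blast
  \<comment> \<open>The errors converge, hence the bound is uniform in \<open>n\<close>.\<close>
  have "Bseq E3" using E3(2) by (intro convergent_imp_Bseq) (auto simp: convergent_def)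
  then obtain B where B: "B > 0" "\<And>n. norm (E3 n) \<le> B" unfolding Bseq_def by blast
  have "AE t in lebesgue_on {0<..<T}.
    (\<integral>\<^sup>+x. e2ennreal (relative_energy \<gamma> w (\<rho> n (t, x), m n (t, x), S n (t, x))) \<partial>lebesgue) \<le> ennreal (max 0 E0 + B)" for n
    using E3(3)[of n]
  proof eventually_elim
    fix t assume t: "total_relative_energy \<gamma> w (\<lambda>x. \<rho> n (t, x)) (\<lambda>x. m n (t, x)) (\<lambda>x. S n (t, x))
             \<le> total_relative_energy \<gamma> w (\<rho>\<^sub>0 n) (m\<^sub>0 n) (S\<^sub>0 n) + ennreal (E3 n)"
    also have "\<dots> \<le> ennreal (max 0 E0) + ennreal B"
      using B(2)[of n] by (intro add_mono order_trans[OF E0] ennreal_leI) auto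
    also have "\<dots> = ennreal (max 0 E0 + B)" using B(1) by (simp add: ennreal_plus)
    finally show "(\<integral>\<^sup>+x. e2ennreal (relative_energy \<gamma> w (\<rho> n (t, x), m n (t, x), S n (t, x))) \<partial>lebesgue) \<le> ennreal (max 0 E0 + B)"
      by (simp add: total_relative_energy_def)
  qed
  thus ?thesis using B(1) by (intro exI[of _ "max 0 E0 + B"]) auto
qed

lemma admissible_weak_solution_momentum:
  assumes "admissible_weak_solution \<gamma> T w \<rho> m S \<rho>\<^sub>0 m\<^sub>0 S\<^sub>0"
    and \<phi>: "\<phi> \<in> C1c (cylinder0 T)" "\<And>x. \<phi> (0, x) = 0"
  shows "integrable (lebesgue_on (cylinder T)) (momentum_integrand \<gamma> \<rho> m S \<phi>) \<and>
    (LINT z|lebesgue_on (cylinder T). momentum_integrand \<gamma> \<rho> m S \<phi> z) = 0"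
proof -
  have "\<forall>\<phi> \<in> C1c (cylinder0 T).
        integrable (lebesgue_on (cylinder T)) (momentum_integrand \<gamma> \<rho> m S \<phi>) \<and>
        integrable lebesgue (\<lambda>x. m\<^sub>0 x \<bullet> \<phi> (0, x)) \<and>
        (LINT z|lebesgue_on (cylinder T). momentum_integrand \<gamma> \<rho> m S \<phi> z)
          = - (LINT x|lebesgue. m\<^sub>0 x \<bullet> \<phi> (0, x))"
    using assms(1) unfolding admissible_weak_solution_def by (elim conjE)
  from bspec[OF this \<phi>(1)] show ?thesis by (simp add: \<phi>(2))
qed

theorem theorem3p3:
  fixes \<gamma> T \<rho>inf Sinf E0 :: real
    and minf :: "real^'d"
    and \<rho>n Sn sn :: "nat \<Rightarrow> real \<times> (real^'d) \<Rightarrow> real"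
    and mn :: "nat \<Rightarrow> real \<times> (real^'d) \<Rightarrow> real^'d"
    and \<rho>0n S0n s0n :: "nat \<Rightarrow> real^'d \<Rightarrow> real"
    and m0n :: "nat \<Rightarrow> real^'d \<Rightarrow> real^'d"
    and \<rho> S :: "real \<times> (real^'d) \<Rightarrow> real"
    and m :: "real \<times> (real^'d) \<Rightarrow> real^'d"
    and \<rho>0 S0 :: "real^'d \<Rightarrow> real"
    and m0 :: "real^'d \<Rightarrow> real^'d"
    and V :: "real \<times> (real^'d) \<Rightarrow> (real \<times> (real^'d) \<times> real) measure"
  assumes dim: "CARD('d) = 2 \<or> CARD('d) = 3"
    and gamma: "\<gamma> > 1"
    and T: "T > 0"
    and \<rho>inf: "\<rho>inf > 0"
    and approx: "consistent_approximation \<gamma> T (\<rho>inf, minf, Sinf) \<rho>n mn Sn \<rho>0n m0n S0n"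
    and Sn: "\<And>n. AE z in lebesgue_on (cylinder T). Sn n z = \<rho>n n z * sn n z"
    and S0n: "\<And>n. AE x in lebesgue. S0n n x = \<rho>0n n x * s0n n x"
    and \<rho>0n_nonneg: "\<And>n. AE x in lebesgue. 0 \<le> \<rho>0n n x"
    and energy_bound:
      "\<And>n. total_relative_energy \<gamma> (\<rho>inf, minf, Sinf) (\<rho>0n n) (m0n n) (S0n n) \<le> ennreal E0"
    and \<rho>0n_L2_L1: "\<And>n. in_L2_plus_L1 (\<lambda>x. \<rho>0n n x - \<rho>inf)"
    and \<rho>0_nonneg: "AE x in lebesgue. 0 \<le> \<rho>0 x"
    and \<rho>0n_limit:
      "converges_in_Mloc (\<lambda>n. density lebesgue (\<lambda>x. ennreal (\<rho>0n n x)))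
         (density lebesgue (\<lambda>x. ennreal (\<rho>0 x)))"
    and young: "generates_young_measure (cylinder T) (\<lambda>n z. (\<rho>n n z, mn n z, Sn n z)) V"
    and barycenter: "AE z in lebesgue_on (cylinder T).
       \<rho> z = (LINT w|V z. fst w) \<and>
       m z = (LINT w|V z. fst (snd w)) \<and>
       S z = (LINT w|V z. snd (snd w))"
    and weak_solution: "admissible_weak_solution \<gamma> T (\<rho>inf, minf, Sinf) \<rho> m S \<rho>0 m0 S0"
    and vacuum: "AE z in lebesgue_on (cylinder T). \<rho> z = 0 \<longrightarrow> S z = 0"
  shows "(\<forall>q::real. 1 \<le> q \<longrightarrow>
            converges_in_Lq_L1loc q T \<rho>n \<rho> \<and> converges_in_Lq_L1loc q T mn m)
       \<and> converges_ae_up_to_subsequences (cylinder T) Sn S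
       \<and> (\<exists>r::nat \<Rightarrow> nat. strict_mono r \<and>
            converges_ae (cylinder T) (\<lambda>n. \<rho>n (r n)) \<rho> \<and>
            converges_ae (cylinder T) (\<lambda>n. mn (r n)) m \<and>
            converges_ae (cylinder T) (\<lambda>n. Sn (r n)) S)"
proof -
  define w where "w = (\<rho>inf, minf, Sinf)"
  define Z where "Z n z = (\<rho>n n z, mn n z, Sn n z)" for n z
  define U where "U z = (\<rho> z, m z, S z)" for z
  let ?M = "lebesgue_on (cylinder T) :: (real \<times> (real^'d)) measure"
  have w: "fst w > 0" using \<rho>inf by (simp add: w_def)
  note meas = consistent_approximation_measurable[OF approx]
  have Zm: "Z n \<in> borel_measurable ?M" for n
    unfolding Z_def[abs_def] using meas[of n] by (intro borel_measurable_Pair)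
  have mU: "\<rho> \<in> borel_measurable ?M" "m \<in> borel_measurable ?M" "S \<in> borel_measurable ?M"
    using weak_solution unfolding admissible_weak_solution_def by - (elim conjE, assumption)+
  have Um: "U \<in> borel_measurable ?M"
    unfolding U_def[abs_def] using mU by (intro borel_measurable_Pair)
  obtain E where E: "E \<ge> 0" "\<And>n. AE t in lebesgue_on {0<..<T}.
    (\<integral>\<^sup>+x. e2ennreal (relative_energy \<gamma> w (Z n (t, x))) \<partial>lebesgue) \<le> ennreal E"
    using consistent_approximation_energy[OF approx energy_bound] unfolding w_def Z_def by blast
  note sl = relative_energy_slices[OF gamma w T E(1) Zm E(2)]
  obtain B where B: "B \<ge> 0" "\<And>v. v \<in> energy_domain \<Longrightarrow> norm v \<le> B * (1 + bregman_energy \<gamma> w v)"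
    using norm_le_energy[OF gamma w] by blast
  interpret euler_young T Z V \<gamma> w "E * T" B
  proof
    show "generates_young_measure (cylinder T) Z V" using young by (simp add: Z_def[abs_def])
    show "bregman_energy \<gamma> w \<in> borel_measurable borel" by (rule borel_measurable_bregman_energy)
    show "0 \<le> bregman_energy \<gamma> w v" if "v \<in> energy_domain" for v by (rule bregman_energy_nonneg[OF gamma w that])
  qed (use sl B E(1) T gamma w in auto)
  have mfZ: "momentum_functional (Z n) \<phi> = momentum_integrand \<gamma> (\<rho>n n) (mn n) (Sn n) \<phi>" for n \<phi>
    by (simp add: momentum_functional_def Z_def)
  have mfU: "momentum_functional U \<phi> = momentum_integrand \<gamma> \<rho> m S \<phi>" for \<phi>
    by (simp add: momentum_functional_def U_def)
  have dirac: "AE z in ?M. AE v in V z. v = U z"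
  proof (rule young_measure_is_dirac)
    show "AE z in ?M. U z = (LINT v|V z. fst v, LINT v|V z. fst (snd v), LINT v|V z. snd (snd v))"
      using barycenter by eventually_elim (simp add: U_def)
    show "AE z in ?M. fst (U z) = 0 \<longrightarrow> snd (snd (U z)) = 0" using vacuum by (simp add: U_def)
  qed (auto simp: mfZ mfU consistent_approximation_momentum[OF approx] admissible_weak_solution_momentum[OF weak_solution])
  have sub: "\<exists>k :: nat \<Rightarrow> nat. strict_mono k \<and> (AE z in ?M. (\<lambda>n. Z (r (k n)) z) \<longlonglongrightarrow> U z)"
    if "strict_mono r" for r :: "nat \<Rightarrow> nat"
    by (rule dirac_AE_subsequence[OF Um dirac that])
  have comp: "converges_ae (cylinder T) (\<lambda>n. \<rho>n (r n)) \<rho>" "converges_ae (cylinder T) (\<lambda>n. mn (r n)) m"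
    "converges_ae (cylinder T) (\<lambda>n. Sn (r n)) S"
    if l: "AE z in ?M. (\<lambda>n. Z (r n) z) \<longlonglongrightarrow> U z" for r
  proof -
    have "AE z in ?M. (\<lambda>n. \<rho>n (r n) z) \<longlonglongrightarrow> \<rho> z \<and> (\<lambda>n. mn (r n) z) \<longlonglongrightarrow> m z \<and> (\<lambda>n. Sn (r n) z) \<longlonglongrightarrow> S z"
      using l
    proof eventually_elim
      fix z assume z: "(\<lambda>n. Z (r n) z) \<longlonglongrightarrow> U z"
      from tendsto_fst[OF z] tendsto_fst[OF tendsto_snd[OF z]] tendsto_snd[OF tendsto_snd[OF z]]
      show "(\<lambda>n. \<rho>n (r n) z) \<longlonglongrightarrow> \<rho> z \<and> (\<lambda>n. mn (r n) z) \<longlonglongrightarrow> m z \<and> (\<lambda>n. Sn (r n) z) \<longlonglongrightarrow> S z"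
        by (simp add: Z_def U_def)
    qed
    thus "converges_ae (cylinder T) (\<lambda>n. \<rho>n (r n)) \<rho>" "converges_ae (cylinder T) (\<lambda>n. mn (r n)) m"
      "converges_ae (cylinder T) (\<lambda>n. Sn (r n)) S" unfolding converges_ae_def by (auto elim: eventually_mono)
  qed
  obtain k :: "nat \<Rightarrow> nat" where k: "strict_mono k" "AE z in ?M. (\<lambda>n. Z (k n) z) \<longlonglongrightarrow> U z"
    using sub[OF strict_mono_id] by auto
  obtain L where L: "L \<ge> 0" "\<And>v :: real \<times> (real^'d) \<times> real. v \<in> energy_domain \<Longrightarrow> \<bar>fst v\<bar> \<le> L + 1 * bregman_energy \<gamma> w v"
    using equi_integrable_density zero_less_one unfolding equi_integrable_def by blast
  obtain L' where L': "L' \<ge> 0" "\<And>v :: real \<times> (real^'d) \<times> real. v \<in> energy_domain \<Longrightarrow>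
      norm (fst (snd v)) + max 0 (snd (snd v)) \<le> L' + 1 * bregman_energy \<gamma> w v"
    using momentum_entropy_equi[OF zero_less_one] by blast
  have weight: "integrable ?M (indicator ({0<..<T} \<times> K) :: real \<times> (real^'d) \<Rightarrow> real)" if K: "compact K" for K
  proof -
    have S: "{0<..<T} \<times> K \<in> sets ?M"
    proof -
      have "{0<..<T} \<times> K \<in> sets lebesgue"
        using K by (intro sets_completionI_sets) (auto intro!: borel_Times simp: compact_imp_closed borel_closed)
      thus ?thesis by (subst sets_restrict_space_iff) auto
    qed
    moreover have "emeasure ?M ({0<..<T} \<times> K) < \<infinity>"
    proof -
      have "emeasure ?M ({0<..<T} \<times> K) = emeasure lebesgue ({0<..<T} \<times> K)"
        using S by (subst emeasure_restrict_space) auto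
      also have "\<dots> \<le> emeasure lebesgue ({0..T} \<times> K)"
        using K by (intro emeasure_mono fmeasurableD lmeasurable_compact compact_Times) auto
      also have "\<dots> < \<infinity>"
      proof -
        have "{0..T} \<times> K \<in> lmeasurable" using K by (intro lmeasurable_compact compact_Times) auto
        from fmeasurableD2[OF this] show ?thesis by (simp only: infinity_ennreal_def top.not_eq_extremum)
      qed
      finally show ?thesis .
    qed
    ultimately show ?thesis by (rule integrable_real_indicator)
  qed
  have L1: "(\<lambda>n. LINT z|?M. indicator ({0<..<T} \<times> K) z * \<bar>h (Z n z) - h (U z)\<bar>) \<longlonglongrightarrow> 0"
    and L1i: "integrable ?M (\<lambda>z. indicator ({0<..<T} \<times> K) z * \<bar>h (Z n z) - h (U z)\<bar>)"
    if K: "compact K" and h: "equi_integrable h" for K h n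
  proof -
    let ?g = "indicator ({0<..<T} \<times> K) :: real \<times> (real^'d) \<Rightarrow> real"
    note de = dirac_equi[OF Um dirac weight[OF K] _ _ zero_le_one h]
    show "(\<lambda>n. LINT z|?M. ?g z * \<bar>h (Z n z) - h (U z)\<bar>) \<longlonglongrightarrow> 0" by (rule de(1)) (auto simp: indicator_def)
    have [measurable]: "h \<in> borel_measurable borel"
      using h unfolding equi_integrable_def by (auto intro: borel_measurable_continuous_onI)
    note [measurable] = Um borel_measurable_integrable[OF weight[OF K]]
    have "integrable ?M (\<lambda>z. ?g z * \<bar>h (Z n z)\<bar> + ?g z * \<bar>h (U z)\<bar>)"
      by (intro Bochner_Integration.integrable_add de(2) de(3)) (auto simp: indicator_def)
    thus "integrable ?M (\<lambda>z. ?g z * \<bar>h (Z n z) - h (U z)\<bar>)"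
    proof (rule Bochner_Integration.integrable_bound)
      show "(\<lambda>z. ?g z * \<bar>h (Z n z) - h (U z)\<bar>) \<in> borel_measurable ?M" by measurable
      show "AE z in ?M. norm (?g z * \<bar>h (Z n z) - h (U z)\<bar>) \<le> norm (?g z * \<bar>h (Z n z)\<bar> + ?g z * \<bar>h (U z)\<bar>)"
        by (intro AE_I2) (auto simp: indicator_def)
    qed
  qed
  have \<rho>conv: "converges_in_Lq_L1loc q T \<rho>n \<rho>" if q: "1 \<le> q" for q
  proof (rule converges_in_Lq_L1loc_I[OF meas(1) mU(1) q])
    fix K :: "(real^'d) set" assume K: "compact K"
    have b: "AE t in lebesgue_on {0<..<T}. (\<integral>\<^sup>+x. ennreal (norm (\<rho>n n (t, x))) \<partial>lebesgue_on K) \<le> ennreal (L * measure lebesgue K + E)" for n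
    proof (rule slices_from_energy[OF gamma w K E(1) L(1) Zm[of n] E(2)[of n]])
      fix z assume "Z n z \<in> energy_domain"
      from L(2)[OF this] show "norm (\<rho>n n z) \<le> L + bregman_energy \<gamma> w (Z n z)" by (simp add: Z_def)
    qed
    have KS: "K \<in> sets lebesgue" using K by (intro fmeasurableD lmeasurable_compact)
    have "AE t in lebesgue_on {0<..<T}. (\<integral>\<^sup>+x. ennreal (norm (\<rho> (t, x))) \<partial>lebesgue_on K) \<le> ennreal (L * measure lebesgue K + E)"
      using comp(1)[OF k(2)] by (intro slice_bound_limit[OF meas(1) KS _ b]) (simp add: converges_ae_def)
    with b L(1) E(1) show "\<exists>B\<ge>0. (\<forall>n. AE t in lebesgue_on {0<..<T}. (\<integral>\<^sup>+x. ennreal (norm (\<rho>n n (t, x))) \<partial>lebesgue_on K) \<le> ennreal B)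
        \<and> (AE t in lebesgue_on {0<..<T}. (\<integral>\<^sup>+x. ennreal (norm (\<rho> (t, x))) \<partial>lebesgue_on K) \<le> ennreal B)"
      by (intro exI[of _ "L * measure lebesgue K + E"]) auto
    show "(\<lambda>n. LINT z|?M. indicator ({0<..<T} \<times> K) z * norm (\<rho>n n z - \<rho> z)) \<longlonglongrightarrow> 0"
      using L1[OF K equi_integrable_density] by (simp add: Z_def U_def)
  qed
  have mconv: "converges_in_Lq_L1loc q T mn m" if q: "1 \<le> q" for q
  proof (rule converges_in_Lq_L1loc_I[OF meas(2) mU(2) q])
    fix K :: "(real^'d) set" assume K: "compact K"
    have b: "AE t in lebesgue_on {0<..<T}. (\<integral>\<^sup>+x. ennreal (norm (mn n (t, x))) \<partial>lebesgue_on K) \<le> ennreal (L' * measure lebesgue K + E)" for n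
    proof (rule slices_from_energy[OF gamma w K E(1) L'(1) Zm[of n] E(2)[of n]])
      fix z assume "Z n z \<in> energy_domain"
      from L'(2)[OF this] have "norm (mn n z) + max 0 (Sn n z) \<le> L' + bregman_energy \<gamma> w (Z n z)"
        by (simp add: Z_def)
      thus "norm (mn n z) \<le> L' + bregman_energy \<gamma> w (Z n z)" by linarith
    qed
    have KS: "K \<in> sets lebesgue" using K by (intro fmeasurableD lmeasurable_compact)
    have "AE t in lebesgue_on {0<..<T}. (\<integral>\<^sup>+x. ennreal (norm (m (t, x))) \<partial>lebesgue_on K) \<le> ennreal (L' * measure lebesgue K + E)"
      using comp(2)[OF k(2)] by (intro slice_bound_limit[OF meas(2) KS _ b]) (simp add: converges_ae_def)
    with b L'(1) E(1) show "\<exists>B\<ge>0. (\<forall>n. AE t in lebesgue_on {0<..<T}. (\<integral>\<^sup>+x. ennreal (norm (mn n (t, x))) \<partial>lebesgue_on K) \<le> ennreal B)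
        \<and> (AE t in lebesgue_on {0<..<T}. (\<integral>\<^sup>+x. ennreal (norm (m (t, x))) \<partial>lebesgue_on K) \<le> ennreal B)"
      by (intro exI[of _ "L' * measure lebesgue K + E"]) auto
    let ?g = "indicator ({0<..<T} \<times> K) :: real \<times> (real^'d) \<Rightarrow> real"
    have i: "integrable ?M (\<lambda>z. ?g z * \<bar>mn n z \<bullet> i - m z \<bullet> i\<bar>)" for n i
      using L1i[OF K equi_integrable_momentum, of n i] by (simp add: Z_def U_def)
    have l: "(\<lambda>n. LINT z|?M. ?g z * \<bar>mn n z \<bullet> i - m z \<bullet> i\<bar>) \<longlonglongrightarrow> 0" for i
      using L1[OF K equi_integrable_momentum, of i] by (simp add: Z_def U_def)
    show "(\<lambda>n. LINT z|?M. ?g z * norm (mn n z - m z)) \<longlonglongrightarrow> 0"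
    proof (rule tendsto_sandwich)
      show "\<forall>\<^sub>F n in sequentially. 0 \<le> (LINT z|?M. ?g z * norm (mn n z - m z))"
        by (intro always_eventually allI Bochner_Integration.integral_nonneg) auto
      show "(\<lambda>n. 0 :: real) \<longlonglongrightarrow> 0" by simp
      have "(\<lambda>n. \<Sum>i\<in>Basis. LINT z|?M. ?g z * \<bar>mn n z \<bullet> i - m z \<bullet> i\<bar>) \<longlonglongrightarrow> (\<Sum>i\<in>(Basis :: (real^'d) set). 0)"
        by (intro tendsto_sum l)
      thus "(\<lambda>n. \<Sum>i\<in>Basis. LINT z|?M. ?g z * \<bar>mn n z \<bullet> i - m z \<bullet> i\<bar>) \<longlonglongrightarrow> 0" by simp
      show "\<forall>\<^sub>F n in sequentially. (LINT z|?M. ?g z * norm (mn n z - m z)) \<le> (\<Sum>i\<in>Basis. LINT z|?M. ?g z * \<bar>mn n z \<bullet> i - m z \<bullet> i\<bar>)"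
      proof (intro always_eventually allI)
        fix n
        have "(LINT z|?M. ?g z * norm (mn n z - m z)) \<le> (LINT z|?M. (\<Sum>i\<in>Basis. ?g z * \<bar>mn n z \<bullet> i - m z \<bullet> i\<bar>))"
        proof (rule integral_mono')
          show "integrable ?M (\<lambda>z. \<Sum>i\<in>Basis. ?g z * \<bar>mn n z \<bullet> i - m z \<bullet> i\<bar>)"
            by (intro Bochner_Integration.integrable_sum i)
          fix z
          have "norm (mn n z - m z) \<le> (\<Sum>i\<in>Basis. \<bar>(mn n z - m z) \<bullet> i\<bar>)" by (rule norm_le_l1)
          hence "?g z * norm (mn n z - m z) \<le> ?g z * (\<Sum>i\<in>Basis. \<bar>(mn n z - m z) \<bullet> i\<bar>)" by (intro mult_left_mono) auto
          thus "?g z * norm (mn n z - m z) \<le> (\<Sum>i\<in>Basis. ?g z * \<bar>mn n z \<bullet> i - m z \<bullet> i\<bar>)"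
            by (simp add: sum_distrib_left inner_diff_left)
          show "0 \<le> (\<Sum>i\<in>Basis. ?g z * \<bar>mn n z \<bullet> i - m z \<bullet> i\<bar>)" by (intro sum_nonneg) auto
        qed
        also have "\<dots> = (\<Sum>i\<in>Basis. LINT z|?M. ?g z * \<bar>mn n z \<bullet> i - m z \<bullet> i\<bar>)"
          by (intro Bochner_Integration.integral_sum i)
        finally show "(LINT z|?M. ?g z * norm (mn n z - m z)) \<le> (\<Sum>i\<in>Basis. LINT z|?M. ?g z * \<bar>mn n z \<bullet> i - m z \<bullet> i\<bar>)" .
      qed
    qed
  qed
  have Ssub: "converges_ae_up_to_subsequences (cylinder T) Sn S"
    unfolding converges_ae_up_to_subsequences_def
  proof (intro allI impI)
    fix r :: "nat \<Rightarrow> nat" assume r: "strict_mono r"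
    obtain l :: "nat \<Rightarrow> nat" where "strict_mono l" "AE z in ?M. (\<lambda>n. Z (r (l n)) z) \<longlonglongrightarrow> U z" using sub[OF r] by blast
    thus "\<exists>l :: nat \<Rightarrow> nat. strict_mono l \<and> converges_ae (cylinder T) (\<lambda>n. Sn (r (l n))) S"
      using comp(3)[of "\<lambda>n. r (l n)"] by blast
  qed
  show ?thesis
    using \<rho>conv mconv Ssub k(1) comp[OF k(2)] by blast
qed

end
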